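(* Multiplication $u^-\otimes u^0\otimes u^+\mapsto u^-u^0u^+$ gives a $\mathbb C(q)$-linear isomorphism $$U_q(\mathfrak g)\cong U_q^-\otimes U_q^0\otimes U_q^+ .$$
   Context: Let $n$ be a positive integer, $\mathfrak g=\mathfrak q(n)$, $P^\vee=\bigoplus_{i=1}^n\mathbb Zk_i$. The quantum superalgebra $U_q(\mathfrak g)=U_q(\mathfrak q(n))$ is the unital associative superalgebra over $\mathbb C(q)$ generated by $L_{ij}$, for $i\le j$ with $i,j\in\{\pm1,\dots,\pm n\}$ ($L_{ij}$ of parity $p(i,j)$), with defining relations $L_{ii}L_{-i,-i}=L_{-i,-i}L_{ii}=1$ and, for all $i\le j$, $k\le l$, $$\begin{aligned}&(-1)^{p(i,j)p(k,l)}q^{\varphi(j,l)}L_{ij}L_{kl}+\{k\le j<l\}\theta(i,j,k)(q-q^{-1})L_{il}L_{kj}\\&\quad+\{i\le -l<j\le -k\}\theta(-i,-j,k)(q-q^{-1})L_{i,-l}L_{k,-j}\\&=q^{\varphi(i,k)}L_{kl}L_{ij}+\{k<i\le l\}\theta(i,j,k)(q-q^{-1})L_{il}L_{kj}\\&\quad+\{-l\le i<-k\le j\}\theta(-i,-j,k)(q-q^{-1})L_{-i,l}L_{-k,j},\end{aligned}$$ where $\varphi(i,j)=\delta_{|i|,|j|}\,\mathrm{sgn}(j)$, $\theta(i,j,k)=\mathrm{sgn}(\mathrm{sgn}(i)+\mathrm{sgn}(j)+\mathrm{sgn}(k))$, $p(i,j)=0$ if $ij>0$ and $1$ if $ij<0$,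 and $\{\cdots\}$ is $1$ if all the inequalities inside hold and $0$ otherwise. Put $q^{k_i}:=L_{i,i}$, $q^{-k_i}:=L_{-i,-i}$, $q^h:=\prod_i(q^{k_i})^{a_i}$ for $h=\sum_ia_ik_i\in P^\vee$, $e_i:=-\frac{1}{q-q^{-1}}L_{-i-1,-i}$, $f_i:=\frac{1}{q-q^{-1}}L_{i,i+1}$, $e_{\bar i}:=-\frac1{q-q^{-1}}L_{-i-1,i}$, $f_{\bar i}:=-\frac1{q-q^{-1}}L_{-i,i+1}$ ($1\le i\le n-1$), $k_{\bar l}:=-\frac1{q-q^{-1}}L_{-l,l}$ ($1\le l\le n$). $U_q^+$ (resp. $U_q^-$) is the subalgebra generated by all $e_i,e_{\bar i}$ (resp. all $f_i,f_{\bar i}$), $1\le i\le n-1$; $U_q^0$ is the subalgebra generated by all $q^h$ ($h\in P^\vee$) and $k_{\bar l}$ ($1\le l\le n$). Tensor products are over $\mathbb C(q)$. *)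

theory Defs
  imports
    "HOL-Algebra.Algebra"
    "HOL-Algebra.Algebraic_Closure_Type"
    "HOL-Library.Poly_Mapping"
    "HOL-Computational_Algebra.Polynomial_Factorial"
begin

section \<open>Modules\<close>

text \<open>
  Modules are \<^typ>\<open>('k, 'a) module\<close> records; for a mere module, which carries no ring
  structure, the fields \<^const>\<open>monoid.mult\<close> and \<^const>\<open>one\<close> are irrelevant.  The scalars are the
  elements of a type, viewed as the ring \<^term>\<open>ring_of_type_algebra\<close>.
\<close>

definition free_module :: "'x set \<Rightarrow> ('k :: comm_ring_1, 'x \<Rightarrow>\<^sub>0 'k) module" where
  "free_module B =
    \<lparr>carrier = {p. Poly_Mapping.keys p \<subseteq> B}, monoid.mult = undefined, one = undefined,
     ring.zero = 0, add = (+), module.smult = (\<lambda>c. Poly_Mapping.map ((*) c))\<rparr>"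

text \<open>The quotient by a submodule, or by a two-sided ideal in the case of an algebra.\<close>

definition quotient_module :: "('k, 'a, 'm) module_scheme \<Rightarrow> 'a set \<Rightarrow> ('k, 'a set) module" where
  "quotient_module M N =
    ring.extend (M Quot N) (module.fields (\<lambda>c A. \<Union>x\<in>A. N +>\<^bsub>M\<^esub> (c \<odot>\<^bsub>M\<^esub> x)))"

definition submodule_generated ::
  "('k, 'r) ring_scheme \<Rightarrow> ('k, 'a, 'm) module_scheme \<Rightarrow> 'a set \<Rightarrow> 'a set" where
  "submodule_generated R M S = \<Inter>{N. submodule N R M \<and> S \<subseteq> N}"

definition module_iso ::
  "('k, 'r) ring_scheme \<Rightarrow> ('k, 'a, 'm) module_scheme \<Rightarrow> ('k, 'b, 'n) module_scheme \<Rightarrow>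
    ('a \<Rightarrow> 'b) set" where
  "module_iso R M N =
    {\<phi>. bij_betw \<phi> (carrier M) (carrier N) \<and>
        (\<forall>x \<in> carrier M. \<forall>y \<in> carrier M. \<phi> (x \<oplus>\<^bsub>M\<^esub> y) = \<phi> x \<oplus>\<^bsub>N\<^esub> \<phi> y) \<and>
        (\<forall>c \<in> carrier R. \<forall>x \<in> carrier M. \<phi> (c \<odot>\<^bsub>M\<^esub> x) = c \<odot>\<^bsub>N\<^esub> \<phi> x)}"

definition tensor_relators ::
  "('k :: comm_ring_1, 'a, 'm) module_scheme \<Rightarrow> ('k, 'b, 'n) module_scheme \<Rightarrow>
    ('a \<times> 'b \<Rightarrow>\<^sub>0 'k) set" where
  "tensor_relators M N =
    (let \<delta> = (\<lambda>x y. Poly_Mapping.single (x, y) 1) in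
      {\<delta> (x \<oplus>\<^bsub>M\<^esub> x') y - \<delta> x y - \<delta> x' y | x x' y.
        x \<in> carrier M \<and> x' \<in> carrier M \<and> y \<in> carrier N} \<union>
      {\<delta> x (y \<oplus>\<^bsub>N\<^esub> y') - \<delta> x y - \<delta> x y' | x y y'.
        x \<in> carrier M \<and> y \<in> carrier N \<and> y' \<in> carrier N} \<union>
      {\<delta> (c \<odot>\<^bsub>M\<^esub> x) y - Poly_Mapping.map ((*) c) (\<delta> x y) | c x y.
        x \<in> carrier M \<and> y \<in> carrier N} \<union>
      {\<delta> x (c \<odot>\<^bsub>N\<^esub> y) - Poly_Mapping.map ((*) c) (\<delta> x y) | c x y.
        x \<in> carrier M \<and> y \<in> carrier N})"

definition tensor_null ::
  "('k :: comm_ring_1, 'a, 'm) module_scheme \<Rightarrow> ('k, 'b, 'n) module_scheme \<Rightarrow>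
    ('a \<times> 'b \<Rightarrow>\<^sub>0 'k) set" where
  "tensor_null M N =
    submodule_generated ring_of_type_algebra (free_module (carrier M \<times> carrier N))
      (tensor_relators M N)"

definition tensor_product ::
  "('k :: comm_ring_1, 'a, 'm) module_scheme \<Rightarrow> ('k, 'b, 'n) module_scheme \<Rightarrow>
    ('k, ('a \<times> 'b \<Rightarrow>\<^sub>0 'k) set) module" where
  "tensor_product M N =
    quotient_module (free_module (carrier M \<times> carrier N)) (tensor_null M N)"

definition pure_tensor ::
  "('k :: comm_ring_1, 'a, 'm) module_scheme \<Rightarrow> ('k, 'b, 'n) module_scheme \<Rightarrow>
    'a \<Rightarrow> 'b \<Rightarrow> ('a \<times> 'b \<Rightarrow>\<^sub>0 'k) set" where
  "pure_tensor M N x y =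
    tensor_null M N +>\<^bsub>free_module (carrier M \<times> carrier N)\<^esub> Poly_Mapping.single (x, y) 1"


section \<open>Algebras\<close>

datatype 'a word_monoid = Word (letters: "'a list")

text \<open>
  Words under concatenation, written additively, so that the convolution product of
  \<^typ>\<open>'a word_monoid \<Rightarrow>\<^sub>0 'k\<close> is the product of noncommutative polynomials.
\<close>

instantiation word_monoid :: (type) monoid_add
begin

definition zero_word_monoid :: "'a word_monoid" where
  "0 = Word []"

definition plus_word_monoid :: "'a word_monoid \<Rightarrow> 'a word_monoid \<Rightarrow> 'a word_monoid" where
  "v + w = Word (letters v @ letters w)"

instance
  by standard (auto simp: zero_word_monoid_def plus_word_monoid_def)

end

definition free_algebra :: "'x set \<Rightarrow> ('k :: comm_ring_1, 'x word_monoid \<Rightarrow>\<^sub>0 'k) module" where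
  "free_algebra B = (free_module {w. set (letters w) \<subseteq> B})\<lparr>monoid.mult := (*), one := 1\<rparr>"

text \<open>The unital subalgebra generated by a set.\<close>

inductive_set subalgebra_generated ::
  "('k, 'r) ring_scheme \<Rightarrow> ('k, 'a, 'm) module_scheme \<Rightarrow> 'a set \<Rightarrow> 'a set"
  for R and A and S where
  one: "\<one>\<^bsub>A\<^esub> \<in> subalgebra_generated R A S"
| incl: "x \<in> S \<Longrightarrow> x \<in> subalgebra_generated R A S"
| add: "x \<in> subalgebra_generated R A S \<Longrightarrow> y \<in> subalgebra_generated R A S \<Longrightarrow>
    x \<oplus>\<^bsub>A\<^esub> y \<in> subalgebra_generated R A S"
| mult: "x \<in> subalgebra_generated R A S \<Longrightarrow> y \<in> subalgebra_generated R A S \<Longrightarrow>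
    x \<otimes>\<^bsub>A\<^esub> y \<in> subalgebra_generated R A S"
| smult: "c \<in> carrier R \<Longrightarrow> x \<in> subalgebra_generated R A S \<Longrightarrow>
    c \<odot>\<^bsub>A\<^esub> x \<in> subalgebra_generated R A S"


section \<open>The quantum queer superalgebra\<close>

type_synonym cq = "complex poly fract"

abbreviation cq_ring :: "cq ring" where
  "cq_ring \<equiv> ring_of_type_algebra"

definition qvar :: cq where
  "qvar = to_fract [:0, 1:]"

type_synonym queer_free = "(int \<times> int) word_monoid \<Rightarrow>\<^sub>0 cq"

definition queer_index :: "nat \<Rightarrow> int set" where
  "queer_index n = {- int n..int n} - {0}"

definition queer_gens :: "nat \<Rightarrow> (int \<times> int) set" where
  "queer_gens n = {(i, j). i \<in> queer_index n \<and> j \<in> queer_index n \<and> i \<le> j}"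

definition parity :: "int \<Rightarrow> int \<Rightarrow> nat" where
  "parity i j = (if i * j > 0 then 0 else 1)"

definition phi :: "int \<Rightarrow> int \<Rightarrow> int" where
  "phi i j = of_bool (\<bar>i\<bar> = \<bar>j\<bar>) * sgn j"

definition theta :: "int \<Rightarrow> int \<Rightarrow> int \<Rightarrow> int" where
  "theta i j k = sgn (sgn i + sgn j + sgn k)"

definition free_L :: "int \<Rightarrow> int \<Rightarrow> queer_free" where
  "free_L i j = Poly_Mapping.single (Word [(i, j)]) 1"

text \<open>
  Left-hand side minus right-hand side of the defining relation.  A bracket that vanishes
  makes its coefficient zero, and a bracket that holds ensures that the two letters occurring
  next to it lie in \<^const>\<open>queer_gens\<close>.
\<close>

definition queer_relator :: "int \<Rightarrow> int \<Rightarrow> int \<Rightarrow> int \<Rightarrow> queer_free" where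
  "queer_relator i j k l =
    (let scale = (\<lambda>c. Poly_Mapping.map ((*) c)); z = qvar - inverse qvar in
      (scale ((-1) ^ (parity i j * parity k l) * qvar powi phi j l) (free_L i j * free_L k l)
        + scale (of_bool (k \<le> j \<and> j < l) * of_int (theta i j k) * z)
            (free_L i l * free_L k j)
        + scale (of_bool (i \<le> -l \<and> -l < j \<and> j \<le> -k) * of_int (theta (-i) (-j) k) * z)
            (free_L i (-l) * free_L k (-j)))
      - (scale (qvar powi phi i k) (free_L k l * free_L i j)
        + scale (of_bool (k < i \<and> i \<le> l) * of_int (theta i j k) * z)
            (free_L i l * free_L k j)
        + scale (of_bool (-l \<le> i \<and> i < -k \<and> -k \<le> j) * of_int (theta (-i) (-j) k) * z)
            (free_L (-i) l * free_L (-k) j)))"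

text \<open>Both relations \<open>L\<^sub>i\<^sub>i L\<^sub>-\<^sub>i\<^sub>-\<^sub>i = 1\<close> and \<open>L\<^sub>-\<^sub>i\<^sub>-\<^sub>i L\<^sub>i\<^sub>i = 1\<close> occur, since \<open>i\<close> takes both signs.\<close>

definition queer_relators :: "nat \<Rightarrow> queer_free set" where
  "queer_relators n =
    {free_L i i * free_L (-i) (-i) - 1 | i. i \<in> queer_index n} \<union>
    {queer_relator i j k l | i j k l. (i, j) \<in> queer_gens n \<and> (k, l) \<in> queer_gens n}"

definition queer_ideal :: "nat \<Rightarrow> queer_free set" where
  "queer_ideal n = genideal (free_algebra (queer_gens n)) (queer_relators n)"

text \<open>
  The underlying algebra of the superalgebra.  All relators are homogeneous for \<^const>\<open>parity\<close>,
  which therefore induces the grading; the product carries no extra signs.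
\<close>

definition Uq :: "nat \<Rightarrow> (cq, queer_free set) module" where
  "Uq n = quotient_module (free_algebra (queer_gens n)) (queer_ideal n)"

definition L_gen :: "nat \<Rightarrow> int \<Rightarrow> int \<Rightarrow> queer_free set" where
  "L_gen n i j = queer_ideal n +>\<^bsub>free_algebra (queer_gens n)\<^esub> free_L i j"

definition e_gen :: "nat \<Rightarrow> int \<Rightarrow> queer_free set" where
  "e_gen n i = (- (1 / (qvar - inverse qvar))) \<odot>\<^bsub>Uq n\<^esub> L_gen n (-i - 1) (-i)"

definition f_gen :: "nat \<Rightarrow> int \<Rightarrow> queer_free set" where
  "f_gen n i = (1 / (qvar - inverse qvar)) \<odot>\<^bsub>Uq n\<^esub> L_gen n i (i + 1)"

definition e_bar :: "nat \<Rightarrow> int \<Rightarrow> queer_free set" where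
  "e_bar n i = (- (1 / (qvar - inverse qvar))) \<odot>\<^bsub>Uq n\<^esub> L_gen n (-i - 1) i"

definition f_bar :: "nat \<Rightarrow> int \<Rightarrow> queer_free set" where
  "f_bar n i = (- (1 / (qvar - inverse qvar))) \<odot>\<^bsub>Uq n\<^esub> L_gen n (-i) (i + 1)"

definition k_bar :: "nat \<Rightarrow> int \<Rightarrow> queer_free set" where
  "k_bar n l = (- (1 / (qvar - inverse qvar))) \<odot>\<^bsub>Uq n\<^esub> L_gen n (-l) l"

text \<open>An element \<open>h = \<Sum>i. a i * k_i\<close> of \<open>P^\<or>\<close> is given by its coordinate function \<open>a\<close>.\<close>

definition P_dual :: "nat \<Rightarrow> (int \<Rightarrow> int) set" where
  "P_dual n = {1..int n} \<rightarrow>\<^sub>E UNIV"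

text \<open>The product is taken in increasing order of \<open>i\<close>; its factors commute in \<^term>\<open>Uq n\<close>.\<close>

definition q_pow :: "nat \<Rightarrow> (int \<Rightarrow> int) \<Rightarrow> queer_free set" where
  "q_pow n a =
    foldr (\<lambda>i x. (L_gen n i i [^]\<^bsub>Uq n\<^esub> a i) \<otimes>\<^bsub>Uq n\<^esub> x) [1..int n] \<one>\<^bsub>Uq n\<^esub>"

definition Uq_plus :: "nat \<Rightarrow> queer_free set set" where
  "Uq_plus n =
    subalgebra_generated cq_ring (Uq n) (e_gen n ` {1..int n - 1} \<union> e_bar n ` {1..int n - 1})"

definition Uq_minus :: "nat \<Rightarrow> queer_free set set" where
  "Uq_minus n =
    subalgebra_generated cq_ring (Uq n) (f_gen n ` {1..int n - 1} \<union> f_bar n ` {1..int n - 1})"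

definition Uq_zero :: "nat \<Rightarrow> queer_free set set" where
  "Uq_zero n = subalgebra_generated cq_ring (Uq n) (q_pow n ` P_dual n \<union> k_bar n ` {1..int n})"

abbreviation Uq_minus_mod :: "nat \<Rightarrow> (cq, queer_free set) module" where
  "Uq_minus_mod n \<equiv> (Uq n)\<lparr>carrier := Uq_minus n\<rparr>"

abbreviation Uq_zero_mod :: "nat \<Rightarrow> (cq, queer_free set) module" where
  "Uq_zero_mod n \<equiv> (Uq n)\<lparr>carrier := Uq_zero n\<rparr>"

abbreviation Uq_plus_mod :: "nat \<Rightarrow> (cq, queer_free set) module" where
  "Uq_plus_mod n \<equiv> (Uq n)\<lparr>carrier := Uq_plus n\<rparr>"

end

theory Submission
  imports Defs
begin

text \<open>
  The products of monomials in the generators of the three subalgebras span \<open>Uq n\<close>, because the defining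
  relations move the letters of \<open>U\<^sup>-\<close> to the left and those of \<open>U\<^sup>+\<close> to the right, and every
  \<open>L\<^sub>i\<^sub>j\<close> is an iterated commutator of such letters up to a Cartan factor.

  Independence is tested with the functionals on words that vanish on the ideal.  Adjoining a parity operator
  turns the defining relations into an ordinary RTT relation for generators \<open>M\<^sub>i\<^sub>j\<close>, so
  \<open>M\<^sub>i\<^sub>j \<mapsto> \<Sum>\<^sub>k M\<^sub>i\<^sub>k \<otimes> M\<^sub>k\<^sub>j\<close> induces a convolution of such functionals, and they may be cut off
  by weight.  For \<open>x\<close>, \<open>y\<close>, \<open>w\<close> in the three subalgebras and \<open>f\<close> supported in the height of \<open>x\<close>, the
  convolution of \<open>f\<close> and \<open>h\<close> at \<open>x y w\<close> is a sum of terms \<open>f (x y') h (y'' w)\<close>, where \<open>y'\<close> and \<open>y''\<close> share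
  the odd factors of \<open>y\<close>.  A dependence between the products thus yields one between products of two
  factors, and then one inside a single subalgebra.  The monomials of \<open>U\<^sup>0\<close> are
  separated by the matrix entries of the vector representation, which exists by the Yang--Baxter equation,
  and by their convolutions.
\<close>

section \<open>The Yang--Baxter equation\<close>

text \<open>Rewriting words bounds the algebra from above; the hard part is to show that it is not
  smaller. Functionals that respect the relations have to be produced, and their source is the
  R-matrix in the relations: its entries are functionals because it solves the Yang--Baxter
  equation, and the coproduct multiplies functionals. For the quantum group of gl(n) the coproduct
  of a triangular product has a single extremal term. Here it does not: an odd Cartan letter
  \<open>M_{-i,i}\<close> goes to
  \<open>M_{-i,-i} \<otimes> M_{-i,i} + M_{-i,i} \<otimes> M_{i,i}\<close>, and both summands have
  weight zero. Hence the sums over subsets of the odd letters and the choice of extremal terms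
  before a coefficient can be isolated. This is also why \<open>Uq_zero\<close> gets an explicit
  basis, whereas bases of \<open>Uq_minus\<close> and \<open>Uq_plus\<close> are picked abstractly
  among the words in their generators and are never described. The algebra is studied through the
  free algebra modulo the ideal; only at the end are the results transferred to the cosets that form
  \<open>Uq n\<close> and to its tensor products.\<close>

definition zq :: cq where "zq = qvar - inverse qvar"

definition neg :: "int \<Rightarrow> nat" where
  "neg i = of_bool (i < 0)"

text \<open>\<open>Acoef\<close>, \<open>Ucoef\<close> and \<open>Vcoef\<close> are the three kinds
  of nonzero entries of the R-matrix: the diagonal ones, those that exchange the two indices, and
  those that exchange and negate them. The last kind is peculiar to the queer case.\<close>

definition Acoef :: "int \<Rightarrow> int \<Rightarrow> cq" where
  "Acoef a b = (-1) ^ (neg a * neg b) * qvar powi phi a b"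

definition Ucoef :: "int \<Rightarrow> int \<Rightarrow> cq" where
  "Ucoef a b = of_bool (b < a) * zq"

definition Vcoef :: "int \<Rightarrow> int \<Rightarrow> cq" where
  "Vcoef a b = of_bool (a < -b) * (-1) ^ (neg a + 1) * zq"

text \<open>
  \<open>SL\<close> and \<open>SR\<close> apply the R-matrix to a pair of row indices and to a pair of column indices; the defining
  relations say that \<open>SR j l (\<lambda>a b. M\<^sub>i\<^sub>a M\<^sub>k\<^sub>b) = SL i k (\<lambda>a b. M\<^sub>b\<^sub>l M\<^sub>a\<^sub>j)\<close>.
\<close>

definition SL :: "int \<Rightarrow> int \<Rightarrow> (int \<Rightarrow> int \<Rightarrow> cq) \<Rightarrow> cq" where
  "SL i k G = Acoef i k * G i k + Ucoef i k * G k i + Vcoef i k * G (-k) (-i)"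

definition SR :: "int \<Rightarrow> int \<Rightarrow> (int \<Rightarrow> int \<Rightarrow> cq) \<Rightarrow> cq" where
  "SR j l G = Acoef j l * G j l + Ucoef l j * G l j + Vcoef (-l) (-j) * G (-l) (-j)"

lemma qvar_nonzero [simp]: "qvar \<noteq> 0"
  by (simp add: qvar_def)

lemma qvar_cancel: "qvar * (inverse qvar * x) = x" "inverse qvar * (qvar * x) = x"
  by (simp_all flip: mult.assoc)

text \<open>\<open>H\<close> is arbitrary, so this is an identity of operators on three indices,
  which can be checked by comparing the coefficients of the values of \<open>H\<close>.\<close>

definition YB :: "(int \<Rightarrow> int \<Rightarrow> int \<Rightarrow> cq) \<Rightarrow> int \<Rightarrow> int \<Rightarrow> int \<Rightarrow> bool" where
  "YB H s i k \<longleftrightarrow>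
    SL s i (\<lambda>y a. SL y k (\<lambda>x b. SL a b (\<lambda>c d. H x c d))) =
    SL i k (\<lambda>a b. SL s b (\<lambda>y d. SL y a (\<lambda>x c. H x c d)))"

text \<open>The thirteen weak orders of three integers. Once the signs are fixed, every condition in
  the coefficients (\<open>b < a\<close>, \<open>a < -b\<close>,
  \<open>\<bar>a\<bar> = \<bar>b\<bar>\<close>) is decided by the weak order of the absolute values.
  The Yang--Baxter equation for all indices thus reduces to eight sign patterns times thirteen
  orders, each an identity in \<open>qvar\<close>.\<close>

definition ordering_type :: "int \<Rightarrow> int \<Rightarrow> int \<Rightarrow> bool" where
  "ordering_type s i k \<longleftrightarrow> i = s \<and> k = s \<or> i = s \<and> k < s \<or> i = s \<and> s < k \<or> k = s \<and> i < s \<or> k = s \<and> s < i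
     \<or> k = i \<and> i < s \<or> k = i \<and> s < i \<or> s < i \<and> i < k \<and> s < k \<or> s < k \<and> k < i \<and> s < i
     \<or> i < s \<and> s < k \<and> i < k \<or> i < k \<and> k < s \<and> i < s \<or> k < s \<and> s < i \<and> k < i \<or> k < i \<and> i < s \<and> k < s"

lemma ordering_type: "ordering_type s i k"
  unfolding ordering_type_def
  by (cases i s rule: linorder_cases; cases k s rule: linorder_cases; cases i k rule: linorder_cases) simp_all

lemmas YB_simps = SL_def Acoef_def Ucoef_def Vcoef_def phi_def neg_def

lemma YB_0:
  assumes "0 < s" "0 < i" "0 < k"
  shows "YB H s i k"
  using assms ordering_type[of s i k] unfolding YB_def ordering_type_def
  by (elim disjE conjE) (simp add: YB_simps; (simp add: zq_def algebra_simps qvar_cancel)?)+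

lemma YB_1:
  assumes "0 < s" "0 < i" "0 < k"
  shows "YB H s i (-k)"
  using assms ordering_type[of s i k] unfolding YB_def ordering_type_def
  by (elim disjE conjE) (simp add: YB_simps; (simp add: zq_def algebra_simps qvar_cancel)?)+

lemma YB_2:
  assumes "0 < s" "0 < i" "0 < k"
  shows "YB H s (-i) k"
  using assms ordering_type[of s i k] unfolding YB_def ordering_type_def
  by (elim disjE conjE) (simp add: YB_simps; (simp add: zq_def algebra_simps qvar_cancel)?)+

lemma YB_3:
  assumes "0 < s" "0 < i" "0 < k"
  shows "YB H s (-i) (-k)"
  using assms ordering_type[of s i k] unfolding YB_def ordering_type_def
  by (elim disjE conjE) (simp add: YB_simps; (simp add: zq_def algebra_simps qvar_cancel)?)+

lemma YB_4:
  assumes "0 < s" "0 < i" "0 < k"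
  shows "YB H (-s) i k"
  using assms ordering_type[of s i k] unfolding YB_def ordering_type_def
  by (elim disjE conjE) (simp add: YB_simps; (simp add: zq_def algebra_simps qvar_cancel)?)+

lemma YB_5:
  assumes "0 < s" "0 < i" "0 < k"
  shows "YB H (-s) i (-k)"
  using assms ordering_type[of s i k] unfolding YB_def ordering_type_def
  by (elim disjE conjE) (simp add: YB_simps; (simp add: zq_def algebra_simps qvar_cancel)?)+

lemma YB_6:
  assumes "0 < s" "0 < i" "0 < k"
  shows "YB H (-s) (-i) k"
  using assms ordering_type[of s i k] unfolding YB_def ordering_type_def
  by (elim disjE conjE) (simp add: YB_simps; (simp add: zq_def algebra_simps qvar_cancel)?)+

lemma YB_7:
  assumes "0 < s" "0 < i" "0 < k"
  shows "YB H (-s) (-i) (-k)"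
  using assms ordering_type[of s i k] unfolding YB_def ordering_type_def
  by (elim disjE conjE) (simp add: YB_simps; (simp add: zq_def algebra_simps qvar_cancel)?)+


text \<open>This makes the R-matrix itself a source of functionals: \<open>vec_rtt\<close> is the
  case where \<open>H\<close> consists of two Kronecker deltas and an entry of the remaining
  word.\<close>

theorem yang_baxter:
  assumes "s \<noteq> 0" "i \<noteq> 0" "k \<noteq> 0"
  shows "SL s i (\<lambda>y a. SL y k (\<lambda>x b. SL a b (\<lambda>c d. H x c d))) =
         SL i k (\<lambda>a b. SL s b (\<lambda>y d. SL y a (\<lambda>x c. H x c d)))"
proof -
  have "YB H s i k"
    using assms YB_0[of s i k H] YB_1[of s i "-k" H] YB_2[of s "-i" k H] YB_3[of s "-i" "-k" H]
      YB_4[of "-s" i k H] YB_5[of "-s" i "-k" H] YB_6[of "-s" "-i" k H] YB_7[of "-s" "-i" "-k" H]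
    by (cases s "0 :: int" rule: linorder_cases; cases i "0 :: int" rule: linorder_cases; cases k "0 :: int" rule: linorder_cases) simp_all
  then show ?thesis by (simp only: YB_def)
qed

section \<open>The coproduct on functionals\<close>

type_synonym wd = "(int \<times> int) list"

definition pw :: "wd \<Rightarrow> nat" where
  "pw w = (\<Sum>(i, j) \<leftarrow> w. neg i + neg j)"

lemma pw_simps [simp]: "pw [] = 0" "pw ((i, j) # w) = neg i + neg j + pw w" "pw (u @ v) = pw u + pw v"
  by (simp_all add: pw_def)

text \<open>
  Functionals on words in the \<open>M\<^sub>i\<^sub>j\<close> that respect their relations.  A form is zero on words with a letter
  \<open>(i, j)\<close>, \<open>j < i\<close>, which makes the relation meaningful for all indices.
\<close>

definition rtt_form :: "nat \<Rightarrow> (wd \<Rightarrow> cq) \<Rightarrow> bool" where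
  "rtt_form n f \<longleftrightarrow>
    (\<forall>w. f w \<noteq> 0 \<longrightarrow> set w \<subseteq> queer_gens n) \<and>
    (\<forall>u v. \<forall>i \<in> queer_index n. f (u @ [(i, i), (-i, -i)] @ v) = (-1) ^ pw v * f (u @ v)) \<and>
    (\<forall>u v. \<forall>i \<in> queer_index n. \<forall>j \<in> queer_index n. \<forall>k \<in> queer_index n. \<forall>l \<in> queer_index n.
      SR j l (\<lambda>a b. f (u @ [(i, a), (k, b)] @ v)) = SL i k (\<lambda>a b. f (u @ [(b, l), (a, j)] @ v)))"

lemma rtt_form_gens: "rtt_form n f \<Longrightarrow> \<not> set w \<subseteq> queer_gens n \<Longrightarrow> f w = 0"
  by (auto simp: rtt_form_def)

lemma rtt_form_cancel:
  "rtt_form n f \<Longrightarrow> i \<in> queer_index n \<Longrightarrow> f (u @ (i, i) # (-i, -i) # v) = (-1) ^ pw v * f (u @ v)"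
  by (auto simp: rtt_form_def)

lemma rtt_form_rtt:
  "rtt_form n f \<Longrightarrow> i \<in> queer_index n \<Longrightarrow> j \<in> queer_index n \<Longrightarrow> k \<in> queer_index n \<Longrightarrow> l \<in> queer_index n \<Longrightarrow>
    SR j l (\<lambda>a b. f (u @ (i, a) # (k, b) # v)) = SL i k (\<lambda>a b. f (u @ (b, l) # (a, j) # v))"
  by (auto simp: rtt_form_def)

text \<open>\<open>\<beta>\<close> is a functional of two words rather than a product of two
  functionals, so that the recursion can push the letters already read into it, and a relation can
  be used in one argument while the other is fixed.\<close>

fun coprod :: "nat \<Rightarrow> (wd \<Rightarrow> wd \<Rightarrow> cq) \<Rightarrow> wd \<Rightarrow> cq" where
  "coprod n \<beta> [] = \<beta> [] []"
| "coprod n \<beta> ((i, j) # w) = (\<Sum>k \<in> queer_index n. coprod n (\<lambda>u v. \<beta> ((i, k) # u) ((k, j) # v)) w)"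

lemma finite_index [simp]: "finite (queer_index n)"
  by (simp add: queer_index_def)

lemma index_uminus [simp]: "- i \<in> queer_index n \<longleftrightarrow> i \<in> queer_index n"
  by (auto simp: queer_index_def)

lemma index_nonzero: "i \<in> queer_index n \<Longrightarrow> i \<noteq> 0"
  by (auto simp: queer_index_def)

lemma coprod_append:
  "coprod n \<beta> (u @ w) = coprod n (\<lambda>u1 u2. coprod n (\<lambda>w1 w2. \<beta> (u1 @ w1) (u2 @ w2)) w) u"
  by (induction n \<beta> u rule: coprod.induct) simp_all

lemma coprod_scale: "coprod n (\<lambda>u v. c * \<beta> u v) w = c * coprod n \<beta> w"
  by (induction n \<beta> w rule: coprod.induct) (simp_all add: sum_distrib_left)

lemma coprod_add: "coprod n (\<lambda>u v. \<beta> u v + \<gamma> u v) w = coprod n \<beta> w + coprod n \<gamma> w"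
proof (induction w arbitrary: \<beta> \<gamma>)
  case (Cons a w)
  obtain i j where a: "a = (i, j)" by force
  show ?case by (simp add: a Cons sum.distrib)
qed simp

lemma coprod_zero [simp]: "coprod n (\<lambda>u v. 0) w = 0"
  using coprod_scale[of n 0 "\<lambda>_ _. 0"] by simp

text \<open>An intermediate index occurs once in each factor, so it adds an even number to
  \<open>pw u + pw v\<close>.\<close>

lemma coprod_parity: "coprod n (\<lambda>u v. (-1) ^ (pw u + pw v) * \<beta> u v) w = (-1) ^ pw w * coprod n \<beta> w"
proof (induction w arbitrary: \<beta>)
  case (Cons a w)
  obtain i j where a: "a = (i, j)" by force
  have "coprod n (\<lambda>u v. (-1) ^ (pw ((i, k) # u) + pw ((k, j) # v)) * \<beta> ((i, k) # u) ((k, j) # v)) w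
     = (-1) ^ pw ((i, j) # w) * coprod n (\<lambda>u v. \<beta> ((i, k) # u) ((k, j) # v)) w" for k
  proof -
    have "(\<lambda>u v. (-1) ^ (pw ((i, k) # u) + pw ((k, j) # v)) * \<beta> ((i, k) # u) ((k, j) # v))
      = (\<lambda>u v. (-1) ^ (neg i + neg j) * ((-1) ^ (pw u + pw v) * \<beta> ((i, k) # u) ((k, j) # v)))"
      by (simp add: power_add algebra_simps)
    then show ?thesis by (simp only: coprod_scale Cons) (simp add: power_add)
  qed
  then show ?case by (simp add: a sum_distrib_left)
qed simp

lemma SL_sum: "SL i k (\<lambda>a b. \<Sum>x \<in> A. G x a b) = (\<Sum>x \<in> A. SL i k (G x))"
  by (simp add: SL_def sum.distrib sum_distrib_left)

lemma SR_sum: "SR i k (\<lambda>a b. \<Sum>x \<in> A. G x a b) = (\<Sum>x \<in> A. SR i k (G x))"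
  by (simp add: SR_def sum.distrib sum_distrib_left)

lemma coprod_SL: "coprod n (\<lambda>u v. SL i k (\<lambda>a b. G a b u v)) w = SL i k (\<lambda>a b. coprod n (G a b) w)"
  by (simp add: SL_def coprod_add coprod_scale)

lemma coprod_SR: "coprod n (\<lambda>u v. SR i k (\<lambda>a b. G a b u v)) w = SR i k (\<lambda>a b. coprod n (G a b) w)"
  by (simp add: SR_def coprod_add coprod_scale)

text \<open>\<open>SR\<close> is the transpose of \<open>SL\<close>. This carries the R-matrix
  across the summed indices, from one factor of a coproduct to the other.\<close>

lemma sum_SL_eq_sum_SR:
  "(\<Sum>c \<in> queer_index n. \<Sum>d \<in> queer_index n. SL c d (\<lambda>a b. H c d a b)) =
   (\<Sum>a \<in> queer_index n. \<Sum>b \<in> queer_index n. SR a b (\<lambda>c d. H c d a b))"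
proof -
  let ?I = "queer_index n"
  have 1: "(\<Sum>c \<in> ?I. \<Sum>d \<in> ?I. Ucoef c d * H c d d c) = (\<Sum>a \<in> ?I. \<Sum>b \<in> ?I. Ucoef b a * H b a a b)"
    by (rule sum.swap)
  have "(\<Sum>c \<in> ?I. \<Sum>d \<in> ?I. Vcoef c d * H c d (-d) (-c)) = (\<Sum>b \<in> ?I. \<Sum>a \<in> ?I. Vcoef (-b) (-a) * H (-b) (-a) a b)"
    by (rule sum.reindex_bij_witness[of _ uminus uminus], (simp_all)[4],
        rule sum.reindex_bij_witness[of _ uminus uminus], simp_all)
  also have "\<dots> = (\<Sum>a \<in> ?I. \<Sum>b \<in> ?I. Vcoef (-b) (-a) * H (-b) (-a) a b)"
    by (rule sum.swap)
  finally show ?thesis using 1 by (simp only: SL_def SR_def sum.distrib)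
qed

lemma coprod_gens:
  assumes "\<And>u v. \<beta> u v \<noteq> 0 \<Longrightarrow> set u \<subseteq> queer_gens n \<and> set v \<subseteq> queer_gens n" "coprod n \<beta> w \<noteq> 0"
  shows "set w \<subseteq> queer_gens n"
  using assms
proof (induction w arbitrary: \<beta>)
  case (Cons a w)
  obtain i j where a: "a = (i, j)" by force
  let ?b = "\<lambda>k u v. \<beta> ((i, k) # u) ((k, j) # v)"
  obtain k where k: "coprod n (?b k) w \<noteq> 0" using Cons.prems(2) by (auto simp: a elim: sum.not_neutral_contains_not_neutral)
  have b: "?b k u v \<noteq> 0 \<Longrightarrow> set u \<subseteq> queer_gens n \<and> set v \<subseteq> queer_gens n \<and> (i, k) \<in> queer_gens n \<and> (k, j) \<in> queer_gens n" for u v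
    using Cons.prems(1) by fastforce
  then have "set w \<subseteq> queer_gens n" using Cons.IH[of "?b k"] k by blast
  moreover have "\<exists>u v. ?b k u v \<noteq> 0"
  proof (rule ccontr)
    assume "\<not> ?thesis" then have "?b k = (\<lambda>u v. 0)" by auto
    then show False using k by simp
  qed
  then have "(i, j) \<in> queer_gens n" using b unfolding queer_gens_def by fastforce
  ultimately show ?case by (simp add: a)
qed simp

text \<open>The relation is used in the second factor, the R-matrix is carried over by
  \<open>sum_SL_eq_sum_SR\<close>, and the relation is used in the first factor.\<close>

theorem rtt_form_coprod:
  assumes "\<And>v. rtt_form n (\<lambda>u. \<beta> u v)" "\<And>u. rtt_form n (\<beta> u)"
  shows "rtt_form n (coprod n \<beta>)"
proof -
  let ?I = "queer_index n"
  have gens: "\<beta> u v \<noteq> 0 \<Longrightarrow> set u \<subseteq> queer_gens n \<and> set v \<subseteq> queer_gens n" for u v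
    using rtt_form_gens[OF assms(1)] rtt_form_gens[OF assms(2)] by blast
  have c: "coprod n \<beta> (u @ [(i, i), (-i, -i)] @ v) = (-1) ^ pw v * coprod n \<beta> (u @ v)" if i: "i \<in> ?I" for u v i
  proof -
    have "coprod n (\<lambda>w1 w2. \<beta> (u1 @ w1) (u2 @ w2)) ([(i, i), (-i, -i)] @ v) =
          (-1) ^ pw v * coprod n (\<lambda>w1 w2. \<beta> (u1 @ w1) (u2 @ w2)) v" for u1 u2
    proof -
      \<comment> \<open>A letter \<open>(i, k)\<close> in one factor and \<open>(k, i)\<close> in
        the other are both generators only for \<open>k = i\<close>; all other intermediate indices
        drop out.\<close>
      have z: "\<beta> (u1 @ (i, k) # (-i, m) # v1) (u2 @ (k, i) # (m, -i) # v2) =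
         (if k = i then if m = -i then (-1) ^ (pw v1 + pw v2) * \<beta> (u1 @ v1) (u2 @ v2) else 0 else 0)" for k m v1 v2
      proof (cases "k = i \<and> m = -i")
        case True
        then show ?thesis using rtt_form_cancel[OF assms(1) i] rtt_form_cancel[OF assms(2) i]
          by (simp add: power_add mult.assoc)
      next
        case False
        then have "\<not> set (u1 @ (i, k) # (-i, m) # v1) \<subseteq> queer_gens n \<or> \<not> set (u2 @ (k, i) # (m, -i) # v2) \<subseteq> queer_gens n"
          by (auto simp: queer_gens_def)
        then show ?thesis using gens False by (metis (no_types, lifting))
      qed
      have "coprod n (\<lambda>w1 w2. \<beta> (u1 @ w1) (u2 @ w2)) ([(i, i), (-i, -i)] @ v) =
        (\<Sum>k \<in> ?I. \<Sum>m \<in> ?I. coprod n (\<lambda>v1 v2. if k = i then if m = -i then (-1) ^ (pw v1 + pw v2) * \<beta> (u1 @ v1) (u2 @ v2) else 0 else 0) v)"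
        by (simp add: z)
      also have "\<dots> = (\<Sum>k \<in> ?I. \<Sum>m \<in> ?I. if k = i then if m = -i then coprod n (\<lambda>v1 v2. (-1) ^ (pw v1 + pw v2) * \<beta> (u1 @ v1) (u2 @ v2)) v else 0 else 0)"
        by (intro sum.cong refl) simp
      also have "\<dots> = (\<Sum>k \<in> ?I. if k = i then (\<Sum>m \<in> ?I. if m = -i then coprod n (\<lambda>v1 v2. (-1) ^ (pw v1 + pw v2) * \<beta> (u1 @ v1) (u2 @ v2)) v else 0) else 0)"
        by (intro sum.cong refl) simp
      also have "\<dots> = coprod n (\<lambda>v1 v2. (-1) ^ (pw v1 + pw v2) * \<beta> (u1 @ v1) (u2 @ v2)) v"
        using i by simp
      finally show ?thesis by (simp add: coprod_parity)
    qed
    then show ?thesis by (subst (1 2) coprod_append) (simp only: coprod_scale)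
  qed
  have r: "SR j l (\<lambda>a b. coprod n \<beta> (u @ [(i, a), (k, b)] @ v)) = SL i k (\<lambda>a b. coprod n \<beta> (u @ [(b, l), (a, j)] @ v))"
    if ix: "i \<in> ?I" "j \<in> ?I" "k \<in> ?I" "l \<in> ?I" for u v i j k l
  proof -
    have "SR j l (\<lambda>a b. coprod n (\<lambda>w1 w2. \<beta> (u1 @ w1) (u2 @ w2)) ([(i, a), (k, b)] @ v)) =
          SL i k (\<lambda>a b. coprod n (\<lambda>w1 w2. \<beta> (u1 @ w1) (u2 @ w2)) ([(b, l), (a, j)] @ v))" (is "?L = ?R") for u1 u2
    proof -
      let ?X = "\<lambda>p q r s v1 v2. \<beta> (u1 @ p # q # v1) (u2 @ r # s # v2)"
      have "?L = (\<Sum>c \<in> ?I. \<Sum>d \<in> ?I. SR j l (\<lambda>a b. coprod n (?X (i, c) (k, d) (c, a) (d, b)) v))"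
        by (simp add: SR_sum)
      also have "\<dots> = (\<Sum>c \<in> ?I. \<Sum>d \<in> ?I. SL c d (\<lambda>a b. coprod n (?X (i, c) (k, d) (b, l) (a, j)) v))"
      proof (intro sum.cong refl)
        fix c d assume "c \<in> ?I" "d \<in> ?I"
        then show "SR j l (\<lambda>a b. coprod n (?X (i, c) (k, d) (c, a) (d, b)) v) = SL c d (\<lambda>a b. coprod n (?X (i, c) (k, d) (b, l) (a, j)) v)"
          by (simp flip: coprod_SL coprod_SR add: rtt_form_rtt[OF assms(2)] ix)
      qed
      also have "\<dots> = (\<Sum>a \<in> ?I. \<Sum>b \<in> ?I. SR a b (\<lambda>c d. coprod n (?X (i, c) (k, d) (b, l) (a, j)) v))"
        by (rule sum_SL_eq_sum_SR)
      also have "\<dots> = (\<Sum>a \<in> ?I. \<Sum>b \<in> ?I. SL i k (\<lambda>c d. coprod n (?X (d, b) (c, a) (b, l) (a, j)) v))"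
      proof (intro sum.cong refl)
        fix a b assume ab: "a \<in> ?I" "b \<in> ?I"
        have "SR a b (\<lambda>c d. ?X (i, c) (k, d) (b, l) (a, j) v1 v2) = SL i k (\<lambda>c d. ?X (d, b) (c, a) (b, l) (a, j) v1 v2)" for v1 v2
          using rtt_form_rtt[OF assms(1)] ix ab by blast
        then show "SR a b (\<lambda>c d. coprod n (?X (i, c) (k, d) (b, l) (a, j)) v) = SL i k (\<lambda>c d. coprod n (?X (d, b) (c, a) (b, l) (a, j)) v)"
          by (simp flip: coprod_SL coprod_SR)
      qed
      also have "\<dots> = (\<Sum>b \<in> ?I. \<Sum>a \<in> ?I. SL i k (\<lambda>c d. coprod n (?X (d, b) (c, a) (b, l) (a, j)) v))"
        by (rule sum.swap)
      also have "\<dots> = ?R" by (simp add: SL_sum)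
      finally show ?thesis .
    qed
    then show ?thesis by (subst (1 2) coprod_append) (simp flip: coprod_SL coprod_SR)
  qed
  show ?thesis unfolding rtt_form_def using coprod_gens[OF gens] c r by blast
qed

text \<open>
  A weight is recorded by its pairing with a function on the indices; the pairing with the identity is the height.
\<close>

definition weight :: "wd \<Rightarrow> (int \<Rightarrow> int) \<Rightarrow> int" where
  "weight w f = (\<Sum>(i, j) \<leftarrow> w. f \<bar>j\<bar> - f \<bar>i\<bar>)"

lemma weight_simps [simp]: "weight [] = (\<lambda>f. 0)" "weight ((i, j) # w) = (\<lambda>f. f \<bar>j\<bar> - f \<bar>i\<bar> + weight w f)"
   "weight (u @ v) = (\<lambda>f. weight u f + weight v f)"
  by (simp_all add: weight_def fun_eq_iff)

lemma SL_scale: "SL i k (\<lambda>a b. c * G a b) = c * SL i k G" and SR_scale: "SR i k (\<lambda>a b. c * G a b) = c * SR i k G"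
  by (simp_all add: SL_def SR_def algebra_simps)

text \<open>All terms of a relation have the same absolute values of row indices and of column
  indices, hence the same weight. With an indicator function for \<open>\<gamma>\<close> this cuts a
  form off to a weight or a height.\<close>

lemma rtt_form_graded:
  assumes "rtt_form n f"
  shows "rtt_form n (\<lambda>w. \<gamma> (weight w) * f w)"
proof -
  have "SR j l (\<lambda>a b. \<gamma> (weight (u @ [(i, a), (k, b)] @ v)) * f (u @ [(i, a), (k, b)] @ v)) =
    SL i k (\<lambda>a b. \<gamma> (weight (u @ [(b, l), (a, j)] @ v)) * f (u @ [(b, l), (a, j)] @ v))"
    if "i \<in> queer_index n" "j \<in> queer_index n" "k \<in> queer_index n" "l \<in> queer_index n" for u v i j k l
  proof -
    let ?c = "\<gamma> (\<lambda>h. weight u h + (h \<bar>j\<bar> - h \<bar>i\<bar> + (h \<bar>l\<bar> - h \<bar>k\<bar>)) + weight v h)"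
    have "SR j l (\<lambda>a b. \<gamma> (weight (u @ [(i, a), (k, b)] @ v)) * f (u @ [(i, a), (k, b)] @ v)) =
      ?c * SR j l (\<lambda>a b. f (u @ [(i, a), (k, b)] @ v))"
      by (simp add: SR_def algebra_simps)
    also have "\<dots> = ?c * SL i k (\<lambda>a b. f (u @ [(b, l), (a, j)] @ v))"
      using assms that by (simp add: rtt_form_rtt)
    also have "\<dots> = SL i k (\<lambda>a b. \<gamma> (weight (u @ [(b, l), (a, j)] @ v)) * f (u @ [(b, l), (a, j)] @ v))"
      by (simp add: SL_def algebra_simps)
    finally show ?thesis .
  qed
  moreover have "\<gamma> (weight (u @ [(i, i), (-i, -i)] @ v)) * f (u @ [(i, i), (-i, -i)] @ v) = (-1) ^ pw v * (\<gamma> (weight (u @ v)) * f (u @ v))"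
    if "i \<in> queer_index n" for u v i
    using rtt_form_cancel[OF assms that, of u v] by simp
  moreover have "\<gamma> (weight w) * f w \<noteq> 0 \<longrightarrow> set w \<subseteq> queer_gens n" for w
    using rtt_form_gens[OF assms] by auto
  ultimately show ?thesis unfolding rtt_form_def by blast
qed

section \<open>The vector representation\<close>

text \<open>Matrix entries of the vector representation: a letter \<open>(i, j)\<close> acts by the
  R-matrix with auxiliary index running from \<open>i\<close> to \<open>j\<close>, and
  \<open>vec s t w\<close> is the entry of the product in row \<open>s\<close> and column
  \<open>t\<close>.\<close>

fun vec :: "int \<Rightarrow> int \<Rightarrow> wd \<Rightarrow> cq" where
  "vec s t [] = of_bool (s = t)"
| "vec s t ((i, j) # w) = SL s i (\<lambda>y j'. of_bool (j' = j) * vec y t w)"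

text \<open>Transposition of the R-matrix again, now against Kronecker deltas. It turns the action
  on columns into the third R-matrix of the Yang--Baxter equation.\<close>

lemma SR_delta:
  shows "SR j l (\<lambda>a b. of_bool (a' = a) * (of_bool (b' = b) * c)) = SL a' b' (\<lambda>a b. of_bool (a = j) * (of_bool (b = l) * c))"
  unfolding SL_def SR_def by (auto simp: of_bool_def)

lemma SR_SL: "SR j l (\<lambda>a b. SL s i (\<lambda>y k. F a b y k)) = SL s i (\<lambda>y k. SR j l (\<lambda>a b. F a b y k))"
  by (simp add: SR_def SL_def algebra_simps)

lemma SL_SL: "SL j l (\<lambda>a b. SL s i (\<lambda>y k. F a b y k)) = SL s i (\<lambda>y k. SL j l (\<lambda>a b. F a b y k))"
  by (simp add: SL_def algebra_simps)

lemma SL_cong: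
  "(\<And>y k. y \<in> {s, i, -i} \<Longrightarrow> G y k = G' y k) \<Longrightarrow> SL s i G = SL s i G'"
  by (simp add: SL_def)

lemma vec_diag: "vec s t ((i, i) # w) = Acoef s i * vec s t w"
  by (auto simp: SL_def Ucoef_def Vcoef_def)

lemma vec_lower: "j < i \<Longrightarrow> vec s t ((i, j) # w) = 0"
  by (auto simp: SL_def Ucoef_def Vcoef_def)

lemma Acoef_inverse: "s \<noteq> 0 \<Longrightarrow> i \<noteq> 0 \<Longrightarrow> Acoef s i * Acoef s (-i) = (-1) ^ neg s"
  by (auto simp: Acoef_def phi_def neg_def)

text \<open>The R-matrix preserves the total parity of the state and the auxiliary index, so the
  sign of a word with a nonzero entry is determined by the states at its two ends.\<close>

lemma vec_parity:
  "s \<noteq> 0 \<Longrightarrow> \<forall>(i, j) \<in> set w. i \<noteq> 0 \<Longrightarrow> (-1) ^ pw w * vec s t w = (-1) ^ (neg s + neg t) * vec s t w"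
proof (induction w arbitrary: s)
  case Nil
  then show ?case by (auto simp: of_bool_def neg_def)
next
  case (Cons a w)
  obtain i j where a: "a = (i, j)" by force
  have i: "i \<noteq> 0" and w: "\<forall>(i, j) \<in> set w. i \<noteq> 0" using Cons.prems(2) by (auto simp: a)
  note IH = Cons.IH[OF _ w]
  have e: "(-1) ^ pw (a # w) * (of_bool (j' = j) * vec y t w) = (-1) ^ (neg s + neg t) * (of_bool (j' = j) * vec y t w)"
    if "y \<noteq> 0" "(-1) ^ (neg i + neg j' + neg y) = ((-1) ^ neg s :: cq)" for y j'
  proof (cases "j' = j")
    case True
    have "(-1) ^ pw (a # w) * vec y t w = (-1) ^ (neg i + neg j) * ((-1) ^ pw w * vec y t w)"
      by (simp add: a power_add)
    also have "\<dots> = (-1) ^ (neg i + neg j' + neg y) * (-1) ^ neg t * vec y t w"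
      using IH[OF that(1)] True by (simp add: power_add)
    finally show ?thesis using that(2) True by (simp add: power_add)
  qed simp
  have "(-1) ^ pw (a # w) * (of_bool (i = j) * vec s t w) = (-1) ^ (neg s + neg t) * (of_bool (i = j) * vec s t w)"
    by (rule e) (use Cons.prems in \<open>auto simp: neg_def\<close>)
  moreover have "(-1) ^ pw (a # w) * (of_bool (s = j) * vec i t w) = (-1) ^ (neg s + neg t) * (of_bool (s = j) * vec i t w)"
    by (rule e) (use Cons.prems i in \<open>auto simp: neg_def\<close>)
  moreover have "(-1) ^ pw (a # w) * (of_bool (-s = j) * vec (-i) t w) = (-1) ^ (neg s + neg t) * (of_bool (-s = j) * vec (-i) t w)"
    by (rule e) (use Cons.prems i in \<open>auto simp: neg_def\<close>)
  ultimately show ?case unfolding a vec.simps SL_scale[symmetric] by (simp only: SL_def a)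
qed

text \<open>The two diagonal letters act on the state that reaches them as the parity operator.
  \<open>rtt_form\<close> has this operator moved through \<open>v\<close> to the right end and
  dropped there; it acts on the final state \<open>t\<close>, and trivially because \<open>t\<close>
  is positive.\<close>

lemma vec_cancel:
  assumes "i \<noteq> 0" "s \<noteq> 0" "t > 0" "\<forall>(i, j) \<in> set u \<union> set v. i \<noteq> 0"
  shows "vec s t (u @ (i, i) # (-i, -i) # v) = (-1) ^ pw v * vec s t (u @ v)"
  using assms
proof (induction u arbitrary: s)
  case Nil
  have "(-1) ^ pw v * vec s t v = (-1) ^ neg s * vec s t v"
    using vec_parity[of s v t] Nil by (simp add: neg_def)
  moreover have "vec s t ([] @ (i, i) # (-i, -i) # v) = Acoef s i * Acoef s (-i) * vec s t v"
    by (simp only: append_Nil vec_diag mult.assoc)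
  ultimately show ?case using Acoef_inverse[of s i] Nil by (metis append_Nil)
next
  case (Cons a u)
  obtain p r where a: "a = (p, r)" by force
  have "SL s p (\<lambda>y j'. of_bool (j' = r) * vec y t (u @ (i, i) # (-i, -i) # v)) =
    SL s p (\<lambda>y j'. (-1) ^ pw v * (of_bool (j' = r) * vec y t (u @ v)))"
    by (rule SL_cong, subst Cons.IH) (use Cons.prems in \<open>auto simp: a\<close>)
  then show ?case by (simp add: a SL_scale)
qed

text \<open>Letters in front of the pair only change the state that reaches it, so the pair may be
  assumed to come first. Then \<open>SR_delta\<close> turns the column action into an R-matrix and
  the claim is \<open>yang_baxter\<close>.\<close>

lemma vec_rtt:
  assumes "i \<noteq> 0" "j \<noteq> 0" "k \<noteq> 0" "l \<noteq> 0" "s \<noteq> 0" "\<forall>(i, j) \<in> set u. i \<noteq> 0"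
  shows "SR j l (\<lambda>a b. vec s t (u @ (i, a) # (k, b) # v)) = SL i k (\<lambda>a b. vec s t (u @ (b, l) # (a, j) # v))"
  using assms
proof (induction u arbitrary: s)
  case Nil
  have "SR j l (\<lambda>a b. vec s t ((i, a) # (k, b) # v)) =
    SL s i (\<lambda>y a'. SL y k (\<lambda>x b'. SR j l (\<lambda>a b. of_bool (a' = a) * (of_bool (b' = b) * vec x t v))))"
    by (simp add: SR_SL flip: SL_scale)
  also have "\<dots> = SL s i (\<lambda>y a'. SL y k (\<lambda>x b'. SL a' b' (\<lambda>a b. of_bool (a = j) * (of_bool (b = l) * vec x t v))))"
    using Nil by (simp add: SR_delta)
  also have "\<dots> = SL i k (\<lambda>a b. SL s b (\<lambda>y d. SL y a (\<lambda>x c. of_bool (c = j) * (of_bool (d = l) * vec x t v))))"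
    using Nil by (intro yang_baxter)
  also have "\<dots> = SL i k (\<lambda>a b. vec s t ((b, l) # (a, j) # v))"
    by (simp add: mult.left_commute flip: SL_scale)
  finally show ?case by simp
next
  case (Cons c u)
  obtain p r where c: "c = (p, r)" by force
  have "SR j l (\<lambda>a b. vec s t ((c # u) @ (i, a) # (k, b) # v)) =
     SL s p (\<lambda>y j'. of_bool (j' = r) * SR j l (\<lambda>a b. vec y t (u @ (i, a) # (k, b) # v)))"
    by (simp add: c SR_SL SR_scale)
  also have "\<dots> = SL s p (\<lambda>y j'. of_bool (j' = r) * SL i k (\<lambda>a b. vec y t (u @ (b, l) # (a, j) # v)))"
    by (rule SL_cong, subst Cons.IH) (use Cons.prems in \<open>auto simp: c\<close>)
  also have "\<dots> = SL i k (\<lambda>a b. vec s t ((c # u) @ (b, l) # (a, j) # v))"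
    by (simp add: c SL_SL[of i k] SL_scale)
  finally show ?case .
qed

definition vec_rep :: "nat \<Rightarrow> int \<Rightarrow> int \<Rightarrow> wd \<Rightarrow> cq" where
  "vec_rep n s t w = of_bool (set w \<subseteq> queer_gens n) * vec s t w"

lemma vec_lower': "j < i \<Longrightarrow> vec s t (u @ (i, j) # w) = 0"
proof (induction u arbitrary: s)
  case (Cons c u)
  obtain p r where c: "c = (p, r)" by force
  show ?case by (simp add: c Cons SL_def)
qed (simp only: vec_lower append_Nil)

lemma rtt_form_vec_rep:
  assumes "s \<noteq> 0" "t > 0"
  shows "rtt_form n (vec_rep n s t)"
proof -
  let ?I = "queer_index n" and ?G = "queer_gens n"
  have nz: "set w \<subseteq> ?G \<Longrightarrow> \<forall>(i, j) \<in> set w. i \<noteq> 0" for w by (auto simp: queer_gens_def queer_index_def)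
  have "vec_rep n s t (u @ [(i, i), (-i, -i)] @ v) = (-1) ^ pw v * vec_rep n s t (u @ v)" if "i \<in> ?I" for u v i
  proof (cases "set (u @ v) \<subseteq> ?G")
    case True
    then have "\<forall>(i, j) \<in> set u \<union> set v. i \<noteq> 0" using nz[of "u @ v"] by auto
    then show ?thesis using vec_cancel[of i s t u v] that assms True
      by (simp add: vec_rep_def index_nonzero) (simp add: queer_gens_def)
  qed (auto simp: vec_rep_def)
  moreover have "SR j l (\<lambda>a b. vec_rep n s t (u @ [(i, a), (k, b)] @ v)) = SL i k (\<lambda>a b. vec_rep n s t (u @ [(b, l), (a, j)] @ v))"
    if ix: "i \<in> ?I" "j \<in> ?I" "k \<in> ?I" "l \<in> ?I" for u v i j k l
  proof (cases "set (u @ v) \<subseteq> ?G")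
    case True
    \<comment> \<open>The cut-off to generators changes nothing here, since a letter below the
      diagonal already acts by zero.\<close>
    have *: "vec_rep n s t (u @ [(a, b), (c, d)] @ v) = vec s t (u @ (a, b) # (c, d) # v)"
      if "a \<in> ?I" "b \<in> ?I" "c \<in> ?I" "d \<in> ?I" for a b c d
    proof (cases "a \<le> b \<and> c \<le> d")
      case False
      then have "vec s t (u @ (a, b) # (c, d) # v) = 0"
        using vec_lower'[of b a s t u] vec_lower'[of d c s t "u @ [(a, b)]"] by auto
      then show ?thesis by (simp add: vec_rep_def)
    qed (use True that in \<open>simp add: vec_rep_def queer_gens_def\<close>)
    have "SR j l (\<lambda>a b. vec_rep n s t (u @ [(i, a), (k, b)] @ v)) = SR j l (\<lambda>a b. vec s t (u @ (i, a) # (k, b) # v))"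
      using ix by (simp add: SR_def *[simplified])
    also have "\<dots> = SL i k (\<lambda>a b. vec s t (u @ (b, l) # (a, j) # v))"
      using nz[of u] True by (intro vec_rtt) (use ix index_nonzero assms in auto)
    also have "\<dots> = SL i k (\<lambda>a b. vec_rep n s t (u @ [(b, l), (a, j)] @ v))"
      using ix by (simp add: SL_def *[simplified])
    finally show ?thesis .
  qed (auto simp: vec_rep_def SL_def SR_def)
  ultimately show ?thesis unfolding rtt_form_def by (auto simp: vec_rep_def)
qed

text \<open>The counit of the coproduct. It provides the first character of the Cartan part, from
  which others are built by convolution.\<close>

definition counit :: "nat \<Rightarrow> wd \<Rightarrow> cq" where
  "counit n w = of_bool (\<forall>(i, j) \<in> set w. i = j \<and> i \<in> queer_index n)"

lemma rtt_form_counit: "rtt_form n (counit n)"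
proof -
  let ?I = "queer_index n"
  have *: "\<forall>(i, j) \<in> set v. i = j \<Longrightarrow> even (pw v)" for v
    by (induction v) auto
  have c: "(-1) ^ pw v * counit n (u @ v) = counit n (u @ v)" for u v
  proof (cases "counit n (u @ v) = 0")
    case False
    then have "\<forall>(i, j) \<in> set v. i = j"
      by (simp add: counit_def case_prod_beta ball_Un)
    then show ?thesis using * by simp
  qed simp
  have "SR j l (\<lambda>a b. counit n (u @ [(i, a), (k, b)] @ v)) = SL i k (\<lambda>a b. counit n (u @ [(b, l), (a, j)] @ v))"
    if ix: "i \<in> ?I" "j \<in> ?I" "k \<in> ?I" "l \<in> ?I" for u v i j k l
  proof -
    have "counit n (u @ [(i, a), (k, b)] @ v) = of_bool (i = a) * (of_bool (k = b) * counit n (u @ v))" for a b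
      using ix by (auto simp: counit_def)
    moreover have "counit n (u @ [(b, l), (a, j)] @ v) = of_bool (a = j) * (of_bool (b = l) * counit n (u @ v))" for a b
      using ix by (auto simp: counit_def)
    ultimately show ?thesis using SR_delta[of j l i k "counit n (u @ v)"] by presburger
  qed
  moreover have "counit n (u @ [(i, i), (-i, -i)] @ v) = (-1) ^ pw v * counit n (u @ v)" if "i \<in> ?I" for u v i
    unfolding c using that by (auto simp: counit_def)
  moreover have "counit n w \<noteq> 0 \<longrightarrow> set w \<subseteq> queer_gens n" for w
    by (auto simp: counit_def queer_gens_def)
  ultimately show ?thesis unfolding rtt_form_def by blast
qed

section \<open>Summands of the coproduct that survive a cut-off by height\<close>

abbreviation height :: "wd \<Rightarrow> int" where
  "height w \<equiv> weight w (\<lambda>a. a)"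

definition minus_letter :: "int \<times> int \<Rightarrow> bool" where
  "minus_letter p \<longleftrightarrow> (case p of (i, j) \<Rightarrow> i \<noteq> 0 \<and> j = \<bar>i\<bar> + 1)"

definition plus_letter :: "int \<times> int \<Rightarrow> bool" where
  "plus_letter p \<longleftrightarrow> (case p of (i, j) \<Rightarrow> j \<noteq> 0 \<and> i = - \<bar>j\<bar> - 1)"

text \<open>The condition bounds the row index, so that it covers every intermediate index: if
  \<open>i \<le> k \<le> j\<close> then \<open>\<bar>k\<bar> \<le> \<bar>i\<bar>\<close>, and the
  letter \<open>(i, k)\<close> of the first factor cannot gain height.\<close>

definition nonpos_letter :: "int \<times> int \<Rightarrow> bool" where
  "nonpos_letter p \<longleftrightarrow> (case p of (i, j) \<Rightarrow> i = j \<or> i < 0 \<and> \<bar>j\<bar> \<le> \<bar>i\<bar>)"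

lemma coprod_high:
  assumes "\<And>u v. \<beta> u v \<noteq> 0 \<Longrightarrow> set u \<subseteq> queer_gens n \<and> set v \<subseteq> queer_gens n \<and> int (length x) < height u"
    and "\<forall>p \<in> set x. minus_letter p" "\<forall>p \<in> set r. nonpos_letter p"
  shows "coprod n \<beta> (x @ r) = 0"
  using assms(1,2)
proof (induction x arbitrary: \<beta>)
  case Nil
  from assms(3) Nil(1) show ?case
  proof (induction r arbitrary: \<beta>)
    case Nil
    then show ?case by fastforce
  next
    case (Cons a r)
    obtain i j where a: "a = (i, j)" by force
    have "coprod n (\<lambda>u v. \<beta> ((i, k) # u) ((k, j) # v)) r = 0" for k
    proof -
      have "coprod n (\<lambda>u v. \<beta> ((i, k) # u) ((k, j) # v)) ([] @ r) = 0"
      proof (rule Cons.IH)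
        fix u v assume "\<beta> ((i, k) # u) ((k, j) # v) \<noteq> 0"
        from Cons.prems(2)[OF this] Cons.prems(1)
        show "set u \<subseteq> queer_gens n \<and> set v \<subseteq> queer_gens n \<and> int (length ([] :: wd)) < height u"
          by (auto simp: queer_gens_def nonpos_letter_def a)
      qed (use Cons.prems in auto)
      then show ?thesis by simp
    qed
    then show ?case by (simp add: a)
  qed
next
  case (Cons a x)
  obtain i j where a: "a = (i, j)" by force
  have "coprod n (\<lambda>u v. \<beta> ((i, k) # u) ((k, j) # v)) (x @ r) = 0" for k
  proof (rule Cons.IH)
    fix u v assume "\<beta> ((i, k) # u) ((k, j) # v) \<noteq> 0"
    from Cons.prems(1)[OF this] Cons.prems(2)
    show "set u \<subseteq> queer_gens n \<and> set v \<subseteq> queer_gens n \<and> int (length x) < height u"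
      by (auto simp: queer_gens_def minus_letter_def a)
  qed (use Cons.prems in auto)
  then show ?case by (simp add: a)
qed

text \<open>To reach the full height, each letter of \<open>x\<close> must take its largest
  intermediate index \<open>k = j\<close>, which leaves the diagonal letter \<open>(j, j)\<close> to
  the second factor.\<close>

lemma coprod_minus:
  assumes "\<And>u v. \<beta> u v \<noteq> 0 \<Longrightarrow> set u \<subseteq> queer_gens n \<and> set v \<subseteq> queer_gens n \<and> int (length x) \<le> height u"
    and "\<forall>p \<in> set x. minus_letter p" "\<forall>p \<in> set r. nonpos_letter p" "set x \<subseteq> queer_gens n"
  shows "coprod n \<beta> (x @ r) = coprod n (\<lambda>u v. \<beta> (x @ u) (map (\<lambda>(i, j). (j, j)) x @ v)) r"
  using assms(1,2,4)
proof (induction x arbitrary: \<beta>)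
  case (Cons a x)
  obtain i j where a: "a = (i, j)" by force
  let ?b = "\<lambda>k u v. \<beta> ((i, k) # u) ((k, j) # v)"
  have j: "j \<in> queer_index n" using Cons.prems(3) by (auto simp: a queer_gens_def)
  have "coprod n (?b k) (x @ r) = 0" if "k \<noteq> j" for k
  proof (rule coprod_high)
    fix u v assume "?b k u v \<noteq> 0"
    from Cons.prems(1)[OF this] Cons.prems(2) that
    show "set u \<subseteq> queer_gens n \<and> set v \<subseteq> queer_gens n \<and> int (length x) < height u"
      by (auto simp: queer_gens_def minus_letter_def a)
  qed (use Cons.prems assms in auto)
  then have "coprod n \<beta> ((a # x) @ r) = (\<Sum>k \<in> queer_index n. if k = j then coprod n (?b j) (x @ r) else 0)"
    unfolding a append_Cons coprod.simps by (intro sum.cong refl) auto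
  also have "\<dots> = coprod n (?b j) (x @ r)" using j by simp
  also have "\<dots> = coprod n (\<lambda>u v. ?b j (x @ u) (map (\<lambda>(i, j). (j, j)) x @ v)) r"
  proof (rule Cons.IH)
    fix u v assume "?b j u v \<noteq> 0"
    from Cons.prems(1)[OF this] Cons.prems(2)
    show "set u \<subseteq> queer_gens n \<and> set v \<subseteq> queer_gens n \<and> int (length x) \<le> height u"
      by (auto simp: queer_gens_def minus_letter_def a)
  qed (use Cons.prems in auto)
  finally show ?case by (simp add: a)
qed simp

text \<open>The strict inequality \<open>\<bar>j\<bar> < \<bar>i\<bar>\<close> excludes
  \<open>k = -i\<close>, so \<open>k = i\<close> is the only intermediate index that does not lower
  the height of the first factor.\<close>

lemma coprod_plus:
  assumes "\<And>u v. \<beta> u v \<noteq> 0 \<Longrightarrow> set u \<subseteq> queer_gens n \<and> set v \<subseteq> queer_gens n \<and> 0 \<le> height u"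
    and "\<forall>(i, j) \<in> set r. i = j \<or> i < 0 \<and> \<bar>j\<bar> < \<bar>i\<bar>" "set r \<subseteq> queer_gens n"
  shows "coprod n \<beta> r = \<beta> (map (\<lambda>(i, j). (i, i)) r) r"
  using assms
proof (induction r arbitrary: \<beta>)
  case (Cons a r)
  obtain i j where a: "a = (i, j)" by force
  let ?b = "\<lambda>k u v. \<beta> ((i, k) # u) ((k, j) # v)"
  have i: "i \<in> queer_index n" using Cons.prems(3) by (auto simp: a queer_gens_def)
  have "coprod n (?b k) r = 0" if "k \<noteq> i" for k
  proof -
    have "coprod n (?b k) ([] @ r) = 0"
    proof (rule coprod_high)
      fix u v assume "?b k u v \<noteq> 0"
      from Cons.prems(1)[OF this] Cons.prems(2) that
      show "set u \<subseteq> queer_gens n \<and> set v \<subseteq> queer_gens n \<and> int (length ([] :: wd)) < height u"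
        by (auto simp: queer_gens_def minus_letter_def a)
    qed (use Cons.prems in \<open>auto simp: nonpos_letter_def\<close>)
    then show ?thesis by simp
  qed
  then have "coprod n \<beta> (a # r) = (\<Sum>k \<in> queer_index n. if k = i then coprod n (?b i) r else 0)"
    unfolding a append_Cons coprod.simps by (intro sum.cong refl) auto
  also have "\<dots> = coprod n (?b i) r" using i by simp
  also have "\<dots> = ?b i (map (\<lambda>(i, j). (i, i)) r) r"
  proof (rule Cons.IH)
    fix u v assume "?b i u v \<noteq> 0"
    from Cons.prems(1)[OF this]
    show "set u \<subseteq> queer_gens n \<and> set v \<subseteq> queer_gens n \<and> 0 \<le> height u" by auto
  qed (use Cons.prems in auto)
  finally show ?case by (simp add: a)
qed simp

definition odd1 :: "int set \<Rightarrow> int list \<Rightarrow> wd" where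
  "odd1 T l = map (\<lambda>i. (-i, if i \<in> T then -i else i)) l"

definition odd2 :: "int set \<Rightarrow> int list \<Rightarrow> wd" where
  "odd2 T l = map (\<lambda>i. (if i \<in> T then -i else i, i)) l"

abbreviation odd_word :: "int list \<Rightarrow> wd" where
  "odd_word l \<equiv> map (\<lambda>i. (-i, i)) l"

lemma sum_Pow_insert:
  assumes "finite A" "a \<notin> A"
  shows "(\<Sum>T \<in> Pow (insert a A). f T) = (\<Sum>T \<in> Pow A. f T + f (insert a T))"
proof -
  have "inj_on (insert a) (Pow A)" using assms(2) by (auto simp: inj_on_def)
  moreover have "Pow A \<inter> insert a ` Pow A = {}" using assms(2) by auto
  ultimately show ?thesis using assms(1)
    by (simp add: Pow_insert sum.union_disjoint sum.reindex sum.distrib)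
qed

text \<open>For a letter \<open>(-i, i)\<close> both \<open>k = i\<close> and \<open>k = -i\<close>
  keep the height. The first leaves the odd letter on the left and puts \<open>(i, i)\<close> on the
  right; the second leaves \<open>(-i, -i)\<close> on the left and sends the odd letter to the
  right, which is recorded by \<open>i \<in> T\<close>.\<close>

lemma coprod_odd:
  assumes "\<And>u v. \<beta> u v \<noteq> 0 \<Longrightarrow> set u \<subseteq> queer_gens n \<and> set v \<subseteq> queer_gens n \<and> 0 \<le> height u"
    and "distinct l" "set l \<subseteq> {1..int n}" "\<forall>p \<in> set r. nonpos_letter p"
  shows "coprod n \<beta> (odd_word l @ r) = (\<Sum>T \<in> Pow (set l). coprod n (\<lambda>u v. \<beta> (odd1 T l @ u) (odd2 T l @ v)) r)"
  using assms(1-3)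
proof (induction l arbitrary: \<beta>)
  case (Cons i l)
  let ?b = "\<lambda>k u v. \<beta> ((-i, k) # u) ((k, i) # v)"
  have i: "i \<in> queer_index n" "i > 0" using Cons.prems(3) by (auto simp: queer_index_def)
  have np: "\<forall>p \<in> set (odd_word l @ r). nonpos_letter p"
    using Cons.prems(3) assms(4) by (auto simp: nonpos_letter_def)
  have "coprod n (?b k) (odd_word l @ r) = 0" if "k \<noteq> i" "k \<noteq> -i" for k
  proof -
    have "coprod n (?b k) ([] @ (odd_word l @ r)) = 0"
    proof (rule coprod_high)
      fix u v assume "?b k u v \<noteq> 0"
      from Cons.prems(1)[OF this] that
      show "set u \<subseteq> queer_gens n \<and> set v \<subseteq> queer_gens n \<and> int (length ([] :: wd)) < height u"
        by (auto simp: queer_gens_def)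
    qed (use np in auto)
    then show ?thesis by simp
  qed
  then have "coprod n \<beta> (odd_word (i # l) @ r) = (\<Sum>k \<in> queer_index n. if k \<in> {i, -i} then coprod n (?b k) (odd_word l @ r) else 0)"
    unfolding list.map append_Cons coprod.simps by (intro sum.cong refl) auto
  also have "\<dots> = (\<Sum>k \<in> {i, -i}. coprod n (?b k) (odd_word l @ r))"
    using i by (subst sum.inter_restrict[symmetric]) (auto intro!: sum.cong)
  also have "\<dots> = (\<Sum>k \<in> {i, -i}. \<Sum>T \<in> Pow (set l). coprod n (\<lambda>u v. ?b k (odd1 T l @ u) (odd2 T l @ v)) r)"
  proof (intro sum.cong refl Cons.IH)
    fix k u v assume "k \<in> {i, -i}" "?b k u v \<noteq> 0"
    with Cons.prems(1)[OF this(2)]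
    show "set u \<subseteq> queer_gens n \<and> set v \<subseteq> queer_gens n \<and> 0 \<le> height u" by auto
  qed (use Cons.prems in auto)
  also have "\<dots> = (\<Sum>T \<in> Pow (set l). coprod n (\<lambda>u v. ?b i (odd1 T l @ u) (odd2 T l @ v)) r +
      coprod n (\<lambda>u v. ?b (-i) (odd1 T l @ u) (odd2 T l @ v)) r)"
    using i by (simp add: sum.distrib)
  also have "\<dots> = (\<Sum>T \<in> Pow (set l). coprod n (\<lambda>u v. \<beta> (odd1 T (i # l) @ u) (odd2 T (i # l) @ v)) r +
      coprod n (\<lambda>u v. \<beta> (odd1 (insert i T) (i # l) @ u) (odd2 (insert i T) (i # l) @ v)) r)"
  proof (rule sum.cong[OF refl])
    fix T assume "T \<in> Pow (set l)"
    then have T: "i \<notin> T" using Cons.prems(2) by auto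
    have "odd1 (insert i T) l = odd1 T l" "odd2 (insert i T) l = odd2 T l"
      using Cons.prems(2) by (auto simp: odd1_def odd2_def)
    then have "odd1 (insert i T) (i # l) = (-i, -i) # odd1 T l" "odd2 (insert i T) (i # l) = (-i, i) # odd2 T l"
      "odd1 T (i # l) = (-i, i) # odd1 T l" "odd2 T (i # l) = (i, i) # odd2 T l"
      using T by (simp_all add: odd1_def odd2_def)
    then show "coprod n (\<lambda>u v. ?b i (odd1 T l @ u) (odd2 T l @ v)) r + coprod n (\<lambda>u v. ?b (-i) (odd1 T l @ u) (odd2 T l @ v)) r =
      coprod n (\<lambda>u v. \<beta> (odd1 T (i # l) @ u) (odd2 T (i # l) @ v)) r +
      coprod n (\<lambda>u v. \<beta> (odd1 (insert i T) (i # l) @ u) (odd2 (insert i T) (i # l) @ v)) r"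
      by simp
  qed
  also have "\<dots> = (\<Sum>T \<in> Pow (set (i # l)). coprod n (\<lambda>u v. \<beta> (odd1 T (i # l) @ u) (odd2 T (i # l) @ v)) r)"
    using Cons.prems(2) by (simp add: sum_Pow_insert)
  finally show ?case .
qed (simp add: odd1_def odd2_def)

text \<open>
  Each letter of \<open>x\<close> raises the height of the first factor by at most one and no later letter raises it, so
  only the summands in which all of \<open>x\<close> stays on the left survive.
\<close>

theorem coprod_triangular:
  assumes f: "rtt_form n f" "\<And>u. f u \<noteq> 0 \<Longrightarrow> int (length x) \<le> height u" and g: "rtt_form n g"
    and x: "\<forall>p \<in> set x. minus_letter p" "set x \<subseteq> queer_gens n"
    and l: "distinct l" "set l \<subseteq> {1..int n}"
    and r: "\<forall>(i, j) \<in> set r. i = j \<or> i < 0 \<and> \<bar>j\<bar> < \<bar>i\<bar>" "set r \<subseteq> queer_gens n"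
  shows "coprod n (\<lambda>u v. f u * g v) (x @ odd_word l @ r) =
    (\<Sum>T \<in> Pow (set l). f (x @ odd1 T l @ map (\<lambda>(i, j). (i, i)) r) * g (map (\<lambda>(i, j). (j, j)) x @ odd2 T l @ r))"
proof -
  have nr: "\<forall>p \<in> set r. nonpos_letter p" using r(1) by (auto simp: nonpos_letter_def)
  have nl: "\<forall>p \<in> set (odd_word l @ r). nonpos_letter p" using nr l(2) by (auto simp: nonpos_letter_def)
  have gn: "f u * g v \<noteq> 0 \<Longrightarrow> set u \<subseteq> queer_gens n \<and> set v \<subseteq> queer_gens n \<and> int (length x) \<le> height u" for u v
    using f g rtt_form_gens by (metis mult_eq_0_iff)
  have lx: "height x = int (length x)" using x(1) by (induction x) (auto simp: minus_letter_def)
  have l1: "height (odd1 T l) = 0" for T using l(2) by (induction l) (auto simp: odd1_def)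
  let ?K = "map (\<lambda>(i, j). (j, j)) x"
  have b1: "set u \<subseteq> queer_gens n \<and> set v \<subseteq> queer_gens n \<and> 0 \<le> height u" if "f (x @ u) * g (?K @ v) \<noteq> 0" for u v
    using gn[OF that] lx by auto
  have b2: "set u \<subseteq> queer_gens n \<and> set v \<subseteq> queer_gens n \<and> 0 \<le> height u"
    if "f (x @ odd1 T l @ u) * g (?K @ odd2 T l @ v) \<noteq> 0" for u v T
    using b1[OF that] l1 by auto
  have "coprod n (\<lambda>u v. f u * g v) (x @ odd_word l @ r) = coprod n (\<lambda>u v. f (x @ u) * g (?K @ v)) (odd_word l @ r)"
    by (intro coprod_minus gn x nl)
  also have "\<dots> = (\<Sum>T \<in> Pow (set l). coprod n (\<lambda>u v. f (x @ odd1 T l @ u) * g (?K @ odd2 T l @ v)) r)"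
    by (intro coprod_odd b1 l nr)
  also have "\<dots> = (\<Sum>T \<in> Pow (set l). f (x @ odd1 T l @ map (\<lambda>(i, j). (i, i)) r) * g (?K @ odd2 T l @ r))"
    by (intro sum.cong refl coprod_plus b2 r)
  finally show ?thesis .
qed

section \<open>Functionals on the quantum superalgebra\<close>

abbreviation lookup where "lookup \<equiv> Poly_Mapping.lookup"
abbreviation keys where "keys \<equiv> Poly_Mapping.keys"

abbreviation scal :: "'k::comm_ring_1 \<Rightarrow> ('x \<Rightarrow>\<^sub>0 'k) \<Rightarrow> ('x \<Rightarrow>\<^sub>0 'k)" where
  "scal c \<equiv> Poly_Mapping.map ((*) c)"

lemma lookup_scal [simp]: "lookup (scal c p) x = c * lookup p x"
  by (simp add: Poly_Mapping.map.rep_eq when_def)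

lemma scal_algebra:
  "scal c (p + q) = scal c p + scal c q" "scal (c + d) p = scal c p + scal d p"
  "scal c (scal d p) = scal (c * d) p" "scal 1 p = p" "scal 0 p = 0" "scal c 0 = 0"
  "scal c (p - q) = scal c p - scal c q" "scal (-1) p = - p" "scal (- c) p = - scal c p"
  "scal (c - d) p = scal c p - scal d p" "scal c (- p) = - scal c p"
  by (rule poly_mapping_eqI, simp add: lookup_add lookup_minus algebra_simps)+

lemma keys_scal: "keys (scal c p) \<subseteq> keys p"
  by (auto simp: in_keys_iff)

lemma scal_sum: "scal c (\<Sum>x \<in> A. f x) = (\<Sum>x \<in> A. scal c (f x))"
  by (induction A rule: infinite_finite_induct) (simp_all add: scal_algebra)

lemma vector_space_scal: "vector_space (scal :: 'k::field \<Rightarrow> ('x \<Rightarrow>\<^sub>0 'k) \<Rightarrow> ('x \<Rightarrow>\<^sub>0 'k))"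
  by unfold_locales (simp_all add: scal_algebra)

lemma poly_mapping_sum_single: "p = (\<Sum>x \<in> keys p. Poly_Mapping.single x (lookup p x))"
proof (rule poly_mapping_eqI)
  fix y
  show "lookup p y = lookup (\<Sum>x \<in> keys p. Poly_Mapping.single x (lookup p x)) y"
    by (simp add: lookup_sum lookup_single when_def in_keys_iff)
qed

lemma mult_scal_left: "scal c p * q = scal c (p * q)"
  by (simp add: mult_map_scale_conv_mult mult.assoc)

lemma single_zero_commute: "p * Poly_Mapping.single 0 c = Poly_Mapping.single 0 c * p"
  for p :: "'x::monoid_add \<Rightarrow>\<^sub>0 'k::comm_ring_1"
  by (subst (1 2) poly_mapping_sum_single[of p])
     (simp add: sum_distrib_left sum_distrib_right mult_single mult.commute)

lemma mult_scal_right: "p * scal c q = scal c (p * q)"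
  for p :: "'x::monoid_add \<Rightarrow>\<^sub>0 'k::comm_ring_1"
  by (simp add: mult_map_scale_conv_mult single_zero_commute flip: mult.assoc)

section \<open>Functionals on words, extended to the free algebra\<close>

definition lin :: "(wd \<Rightarrow> cq) \<Rightarrow> queer_free \<Rightarrow> cq" where
  "lin f p = (\<Sum>w \<in> keys p. lookup p w * f (letters w))"

definition wmon :: "wd \<Rightarrow> queer_free" where
  "wmon w = Poly_Mapping.single (Word w) 1"

lemma lin_superset: "finite A \<Longrightarrow> keys p \<subseteq> A \<Longrightarrow> lin f p = (\<Sum>w \<in> A. lookup p w * f (letters w))"
  unfolding lin_def by (rule sum.mono_neutral_left) (auto simp: in_keys_iff)

lemma lin_simps [simp]:
  "lin f 0 = 0" "lin f (p + q) = lin f p + lin f q" "lin f (scal c p) = c * lin f p"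
  "lin f (- p) = - lin f p" "lin f (p - q) = lin f p - lin f q" "lin f (wmon w) = f w"
  "lin f (Poly_Mapping.single x c) = c * f (letters x)"
proof -
  show s: "lin f (scal c p) = c * lin f p" for c p
    using keys_scal[of c p] by (subst (1 2) lin_superset[of "keys p"]) (simp_all add: sum_distrib_left mult.assoc)
  show a: "lin f (p + q) = lin f p + lin f q" for p q
    using Poly_Mapping.keys_add[of p q]
    by (simp add: lin_superset[of "keys p \<union> keys q"] lookup_add algebra_simps sum.distrib)
  show "lin f 0 = 0" by (simp add: lin_def)
  show m: "lin f (- p) = - lin f p" for p using s[of "-1" p] by (simp add: scal_algebra)
  show "lin f (p - q) = lin f p - lin f q" using a[of p "-q"] m[of q] by simp
  show l: "lin f (Poly_Mapping.single x c) = c * f (letters x)" for x c by (simp add: lin_def)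
  show "lin f (wmon w) = f w" by (simp add: wmon_def l)
qed

lemma lin_sum: "lin f (\<Sum>x \<in> A. p x) = (\<Sum>x \<in> A. lin f (p x))"
  by (induction A rule: infinite_finite_induct) simp_all

lemma mon_append: "wmon (u @ v) = wmon u * wmon v"
  by (simp add: wmon_def mult_single plus_word_monoid_def)

lemma mon_Nil: "wmon [] = 1"
  by (simp add: wmon_def flip: zero_word_monoid_def)

lemma mon_expand: "p = (\<Sum>w \<in> keys p. scal (lookup p w) (wmon (letters w)))"
  using poly_mapping_sum_single[of p] by (simp add: wmon_def)

lemma lin_mon_left: "lin f (wmon u * p) = lin (\<lambda>w. f (u @ w)) p"
proof -
  have "wmon u * p = (\<Sum>w \<in> keys p. scal (lookup p w) (wmon (u @ letters w)))"
    by (subst mon_expand[of p]) (simp add: sum_distrib_left mult_scal_right mon_append)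
  then show ?thesis by (simp add: lin_sum) (simp add: lin_def)
qed

lemma lin_mon_right: "lin f (p * wmon u) = lin (\<lambda>w. f (w @ u)) p"
proof -
  have "p * wmon u = (\<Sum>w \<in> keys p. scal (lookup p w) (wmon (letters w @ u)))"
    by (subst mon_expand[of p]) (simp add: sum_distrib_right mult_scal_left mon_append)
  then show ?thesis by (simp add: lin_sum) (simp add: lin_def)
qed

section \<open>The free algebra and the ideal of relations\<close>

definition Fc :: "nat \<Rightarrow> queer_free set" where
  "Fc n = {p. \<forall>w \<in> keys p. set (letters w) \<subseteq> queer_gens n}"

lemma carrier_free_algebra: "carrier (free_algebra (queer_gens n)) = Fc n"
  by (auto simp: free_algebra_def free_module_def Fc_def)

lemma free_algebra_simps [simp]:
  "monoid.mult (free_algebra B) = (*)" "one (free_algebra B) = 1" "ring.zero (free_algebra B) = 0"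
  "add (free_algebra B) = (+)" "module.smult (free_algebra B) = scal"
  by (simp_all add: free_algebra_def free_module_def)

lemma Fc_closed [simp]:
  "0 \<in> Fc n" "1 \<in> Fc n" "p \<in> Fc n \<Longrightarrow> q \<in> Fc n \<Longrightarrow> p + q \<in> Fc n"
  "p \<in> Fc n \<Longrightarrow> q \<in> Fc n \<Longrightarrow> p - q \<in> Fc n" "p \<in> Fc n \<Longrightarrow> - p \<in> Fc n"
  "p \<in> Fc n \<Longrightarrow> scal c p \<in> Fc n" "p \<in> Fc n \<Longrightarrow> q \<in> Fc n \<Longrightarrow> p * q \<in> Fc n"
proof -
  show "p \<in> Fc n \<Longrightarrow> q \<in> Fc n \<Longrightarrow> p + q \<in> Fc n" using Poly_Mapping.keys_add[of p q] by (auto simp: Fc_def)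
  show "p \<in> Fc n \<Longrightarrow> q \<in> Fc n \<Longrightarrow> p - q \<in> Fc n" using Poly_Mapping.keys_diff[of p q] by (auto simp: Fc_def)
  show "p \<in> Fc n \<Longrightarrow> scal c p \<in> Fc n" using keys_scal[of c p] by (auto simp: Fc_def)
  show "p \<in> Fc n \<Longrightarrow> q \<in> Fc n \<Longrightarrow> p * q \<in> Fc n"
    using Poly_Mapping.keys_mult[of p q] by (fastforce simp: Fc_def plus_word_monoid_def)
qed (auto simp: Fc_def zero_word_monoid_def in_keys_iff)

lemma Fc_sum: "(\<And>x. x \<in> A \<Longrightarrow> f x \<in> Fc n) \<Longrightarrow> (\<Sum>x \<in> A. f x) \<in> Fc n"
  by (induction A rule: infinite_finite_induct) simp_all

lemma Fc_mon [simp]: "wmon w \<in> Fc n \<longleftrightarrow> set w \<subseteq> queer_gens n"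
  by (simp add: Fc_def wmon_def)

lemma ring_free_algebra: "ring (free_algebra (queer_gens n) :: (cq, queer_free) module)"
proof (rule ringI)
  show "abelian_group (free_algebra (queer_gens n) :: (cq, queer_free) module)"
    by (rule abelian_groupI) (auto simp: carrier_free_algebra algebra_simps intro!: bexI[of _ "- x" for x])
  show "monoid (free_algebra (queer_gens n) :: (cq, queer_free) module)"
    by (rule monoidI) (auto simp: carrier_free_algebra mult.assoc)
qed (auto simp: carrier_free_algebra algebra_simps)

lemma free_L_mon: "free_L i j = wmon [(i, j)]"
  by (simp add: free_L_def wmon_def)

lemma queer_relator_closed:
  assumes "(i, j) \<in> queer_gens n" "(k, l) \<in> queer_gens n"
  shows "queer_relator i j k l \<in> Fc n"
proof -
  have s: "(P \<Longrightarrow> p \<in> Fc n) \<Longrightarrow> scal (of_bool P * c * d) p \<in> Fc n" for P c d p by (cases P) (auto simp: scal_algebra)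
  have L: "free_L a b \<in> Fc n" if "a \<in> queer_index n" "b \<in> queer_index n" "a \<le> b" for a b
    using that by (simp add: free_L_mon queer_gens_def)
  have ix: "i \<in> queer_index n" "j \<in> queer_index n" "k \<in> queer_index n" "l \<in> queer_index n" "i \<le> j" "k \<le> l"
    using assms by (auto simp: queer_gens_def)
  show ?thesis unfolding queer_relator_def Let_def
    by (rule Fc_closed(4) Fc_closed(3) s Fc_closed(6) Fc_closed(7) L ix | (use ix in \<open>auto; fail\<close>))+
qed

lemma queer_relators_closed: "queer_relators n \<subseteq> Fc n"
  unfolding queer_relators_def by (auto simp: queer_relator_closed free_L_mon queer_gens_def intro!: Fc_closed)

lemma ideal_queer_ideal: "ideal (queer_ideal n) (free_algebra (queer_gens n))"
  unfolding queer_ideal_def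
  by (rule ring.genideal_ideal[OF ring_free_algebra]) (simp add: carrier_free_algebra queer_relators_closed)

lemma queer_ideal_closed:
  shows ideal_sub: "p \<in> queer_ideal n \<Longrightarrow> p \<in> Fc n"
    and ideal_zero [simp]: "0 \<in> queer_ideal n"
    and ideal_add: "p \<in> queer_ideal n \<Longrightarrow> q \<in> queer_ideal n \<Longrightarrow> p + q \<in> queer_ideal n"
    and ideal_mult_left: "p \<in> queer_ideal n \<Longrightarrow> x \<in> Fc n \<Longrightarrow> x * p \<in> queer_ideal n"
    and ideal_mult_right: "p \<in> queer_ideal n \<Longrightarrow> x \<in> Fc n \<Longrightarrow> p * x \<in> queer_ideal n"
    and ideal_relators: "r \<in> queer_relators n \<Longrightarrow> r \<in> queer_ideal n"
    and ideal_scal: "p \<in> queer_ideal n \<Longrightarrow> scal c p \<in> queer_ideal n"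
    and ideal_uminus: "p \<in> queer_ideal n \<Longrightarrow> - p \<in> queer_ideal n"
    and ideal_diff: "p \<in> queer_ideal n \<Longrightarrow> q \<in> queer_ideal n \<Longrightarrow> p - q \<in> queer_ideal n"
proof -
  interpret ideal "queer_ideal n" "free_algebra (queer_gens n)" by (rule ideal_queer_ideal)
  show "p \<in> queer_ideal n \<Longrightarrow> p \<in> Fc n" using a_Hcarr by (auto simp: carrier_free_algebra)
  show "0 \<in> queer_ideal n" using additive_subgroup.zero_closed[OF is_additive_subgroup] by simp
  show a: "p \<in> queer_ideal n \<Longrightarrow> q \<in> queer_ideal n \<Longrightarrow> p + q \<in> queer_ideal n" for p q
    using additive_subgroup.a_closed[OF is_additive_subgroup] by simp
  show m: "p \<in> queer_ideal n \<Longrightarrow> x \<in> Fc n \<Longrightarrow> x * p \<in> queer_ideal n" for x p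
    using I_l_closed by (simp add: carrier_free_algebra)
  show "p \<in> queer_ideal n \<Longrightarrow> x \<in> Fc n \<Longrightarrow> p * x \<in> queer_ideal n"
    using I_r_closed by (simp add: carrier_free_algebra)
  show "r \<in> queer_relators n \<Longrightarrow> r \<in> queer_ideal n"
    unfolding queer_ideal_def
    using ring.genideal_self[OF ring_free_algebra] queer_relators_closed carrier_free_algebra by blast
  show s: "p \<in> queer_ideal n \<Longrightarrow> scal c p \<in> queer_ideal n" for c p
    using m[of p "scal c 1"] by (simp add: mult_scal_left)
  show u: "p \<in> queer_ideal n \<Longrightarrow> - p \<in> queer_ideal n" for p
    using s[of p "-1"] by (simp add: scal_algebra)
  show "p \<in> queer_ideal n \<Longrightarrow> q \<in> queer_ideal n \<Longrightarrow> p - q \<in> queer_ideal n"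
    using a[of p "- q"] u by simp
qed

lemma ideal_sum: "(\<And>x. x \<in> A \<Longrightarrow> f x \<in> queer_ideal n) \<Longrightarrow> (\<Sum>x \<in> A. f x) \<in> queer_ideal n"
  by (induction A rule: infinite_finite_induct) (simp_all add: ideal_add)

text \<open>The set \<open>J\<close> of the proof is the largest two-sided ideal inside the kernel
  of \<open>lin f\<close>, so it contains the generated ideal as soon as it contains the
  relators.\<close>

lemma lin_ideal_eq_zero:
  assumes "\<And>u v r. set u \<subseteq> queer_gens n \<Longrightarrow> set v \<subseteq> queer_gens n \<Longrightarrow> r \<in> queer_relators n \<Longrightarrow>
      lin f (wmon u * r * wmon v) = 0"
    and "p \<in> queer_ideal n"
  shows "lin f p = 0"
proof -
  let ?R = "free_algebra (queer_gens n) :: (cq, queer_free) module"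
  let ?W = "{w. set w \<subseteq> queer_gens n}"
  define J where "J = {p \<in> Fc n. \<forall>u \<in> ?W. \<forall>v \<in> ?W. lin f (wmon u * p * wmon v) = 0}"
  have add: "p + q \<in> J" if "p \<in> J" "q \<in> J" for p q
    using that by (auto simp: J_def algebra_simps)
  have scl: "scal c p \<in> J" if "p \<in> J" for c p
    using that by (auto simp: J_def mult_scal_left mult_scal_right)
  have sm: "(\<And>x. x \<in> A \<Longrightarrow> g x \<in> J) \<Longrightarrow> (\<Sum>x \<in> A. g x) \<in> J" for A :: "(int \<times> int) word_monoid set" and g
    by (induction A rule: infinite_finite_induct) (simp_all add: add, simp_all add: J_def)
  have left: "x * p \<in> J" if "p \<in> J" "x \<in> Fc n" for x p
  proof -
    have "wmon u * p \<in> J" if u: "u \<in> ?W" for u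
      using that \<open>p \<in> J\<close> by (auto simp: J_def simp flip: mult.assoc mon_append)
    then have "(\<Sum>w \<in> keys x. scal (lookup x w) (wmon (letters w) * p)) \<in> J"
      using that(2) by (intro sm scl) (auto simp: Fc_def)
    then show ?thesis by (subst mon_expand[of x]) (simp add: sum_distrib_right mult_scal_left)
  qed
  have right: "p * x \<in> J" if "p \<in> J" "x \<in> Fc n" for x p
  proof -
    have "p * wmon u \<in> J" if u: "u \<in> ?W" for u
      using that \<open>p \<in> J\<close> by (auto simp: J_def mult.assoc simp flip: mon_append)
    then have "(\<Sum>w \<in> keys x. scal (lookup x w) (p * wmon (letters w))) \<in> J"
      using that(2) by (intro sm scl) (auto simp: Fc_def)
    then show ?thesis by (subst mon_expand[of x]) (simp add: sum_distrib_left mult_scal_right)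
  qed
  have "ideal J ?R"
  proof (rule idealI[OF ring_free_algebra])
    interpret R: ring ?R by (rule ring_free_algebra)
    have inv: "\<exists>y \<in> J. y + x = 0" if "x \<in> J" for x
      using scl[OF that, of "-1"] by (intro bexI[of _ "- x"]) (auto simp: scal_algebra)
    show "subgroup J (add_monoid ?R)"
    proof (rule group.subgroupI[OF R.a_group])
      show "J \<subseteq> carrier (add_monoid ?R)" by (auto simp: J_def carrier_free_algebra)
      show "J \<noteq> {}" using sm[of "{}"] by auto
      show "inv\<^bsub>add_monoid ?R\<^esub> a \<in> J" if a: "a \<in> J" for a
      proof -
        have "- a \<in> J" using scl[OF a, of "-1"] by (simp add: scal_algebra)
        moreover have "inv\<^bsub>add_monoid ?R\<^esub> a = - a"
          using a calculation group.inv_equality[OF R.a_group, of "- a" a] by (auto simp: J_def carrier_free_algebra)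
        ultimately show ?thesis by simp
      qed
    qed (use add in auto)
  qed (use left right in \<open>auto simp: carrier_free_algebra\<close>)
  moreover have "queer_relators n \<subseteq> J" using assms(1) queer_relators_closed[of n] by (auto simp: J_def)
  ultimately have "queer_ideal n \<subseteq> J"
    unfolding queer_ideal_def by (rule ring.genideal_minimal[OF ring_free_algebra])
  then have "lin f (wmon [] * p * wmon []) = 0" using assms(2) by (auto simp: J_def)
  then show ?thesis by (simp add: mon_Nil)
qed

section \<open>From the defining relations to an RTT relation without signs\<close>

text \<open>The number of factors of the parity operator that the letters of a word bring with
  them.\<close>

definition cw :: "wd \<Rightarrow> nat" where
  "cw w = (\<Sum>(i, j) \<leftarrow> w. neg j)"

lemma cw_simps [simp]: "cw [] = 0" "cw ((i, j) # w) = neg j + cw w" "cw (u @ v) = cw u + cw v"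
  by (simp_all add: cw_def)

text \<open>
  With a parity operator \<open>\<sigma>\<close> adjoined, the elements
  \<open>M\<^sub>i\<^sub>j = (-1) ^ (neg j * (neg i + 1)) L\<^sub>i\<^sub>j \<sigma> ^ neg j\<close> satisfy an ordinary (not super) RTT relation.
  The product of the \<open>M\<^sub>i\<^sub>j\<close> along \<open>w\<close> is \<open>sg w\<close> times the product of the \<open>L\<^sub>i\<^sub>j\<close> times a power of \<open>\<sigma>\<close>.
\<close>

fun sg :: "wd \<Rightarrow> cq" where
  "sg [] = 1"
| "sg ((i, j) # w) = (-1) ^ (neg j * (neg i + 1) + neg j * pw w) * sg w"

lemma sg_append: "sg (u @ w) = sg u * sg w * ((-1) ^ cw u) ^ pw w"
  by (induction u rule: sg.induct) (simp_all add: power_add algebra_simps flip: power_mult)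

lemma sg_square: "sg w * sg w = 1"
  by (induction w rule: sg.induct) (simp_all add: mult.left_commute flip: power_add mult.assoc)

lemma sg_square' [simp]: "sg w * (sg w * x) = x"
  by (simp add: sg_square flip: mult.assoc)

text \<open>Passage from words in the \<open>L_ij\<close> to words in the \<open>M_ij\<close>. The
  cut-off supplies the vanishing on letters below the diagonal that \<open>rtt_form\<close>
  demands.\<close>

definition twisted :: "nat \<Rightarrow> (wd \<Rightarrow> cq) \<Rightarrow> wd \<Rightarrow> cq" where
  "twisted n h w = of_bool (set w \<subseteq> queer_gens n) * (sg w * h w)"

lemma neg_cases: "i \<noteq> 0 \<Longrightarrow> (i < 0 \<and> neg i = 1 \<and> neg (-i) = 0 \<and> sgn i = -1) \<or> (i > 0 \<and> neg i = 0 \<and> neg (-i) = 1 \<and> sgn i = 1)"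
  by (auto simp: neg_def)

lemma parity_neg: "i \<noteq> 0 \<Longrightarrow> j \<noteq> 0 \<Longrightarrow> (-1) ^ parity i j = ((-1) ^ (neg i + neg j) :: cq)"
  by (auto simp: parity_def neg_def zero_less_mult_iff)

text \<open>Up to a sign, each relator is the difference of the two sides of the RTT relation. The
  sign depends on the surrounding words and on the four indices, hence the existential
  quantifier.\<close>

lemma lin_relator:
  assumes ij: "(i, j) \<in> queer_gens n" and kl: "(k, l) \<in> queer_gens n"
    and u: "set u \<subseteq> queer_gens n" and v: "set v \<subseteq> queer_gens n"
  shows "\<exists>\<epsilon>. \<epsilon> \<noteq> 0 \<and> lin h (wmon u * queer_relator i j k l * wmon v) =
     \<epsilon> * (SR j l (\<lambda>a b. twisted n h (u @ [(i, a), (k, b)] @ v)) - SL i k (\<lambda>a b. twisted n h (u @ [(b, l), (a, j)] @ v)))"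
proof -
  define sx sy K :: cq where "sx = (-1) ^ cw u" and "sy = (-1) ^ pw v" and "K = sg u * sg v * ((-1) ^ cw u) ^ pw v"
  have sxy: "sx * sx = 1" "sy * sy = 1" "sx * (sx * x) = x" "sy * (sy * x) = x" for x
    by (simp_all add: sx_def sy_def flip: power_add mult.assoc)
  have K: "K * K = 1" "K \<noteq> 0"
  proof -
    have "K * K = (sg u * sg u) * (sg v * sg v) * (((-1) ^ cw u) ^ pw v * ((-1) ^ cw u) ^ pw v)"
      unfolding K_def by (simp only: ac_simps)
    then show "K * K = 1" by (simp add: sg_square flip: power_add power_mult)
    then show "K \<noteq> 0" by auto
  qed
  define g where "g a b c d = twisted n h (u @ [(a, b), (c, d)] @ v)" for a b c d
  \<comment> \<open>The part of the sign that depends on the two middle letters; \<open>K\<close>,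
    \<open>sx\<close> and \<open>sy\<close> collect the influence of the surrounding words.\<close>
  define s where "s a b c d = sx ^ (neg a + neg b + neg c + neg d) * sy ^ (neg b + neg d) *
     ((-1) ^ (neg b * (neg a + 1) + neg b * (neg c + neg d) + neg d * (neg c + 1)) :: cq)" for a b c d
  let ?I = "queer_index n"
  have ix: "i \<in> ?I" "j \<in> ?I" "k \<in> ?I" "l \<in> ?I" "i \<le> j" "k \<le> l" using ij kl by (auto simp: queer_gens_def)
  have sg: "sg (u @ [(a, b), (c, d)] @ v) = K * s a b c d" for a b c d
    by (simp add: sg_append K_def s_def sx_def sy_def power_add algebra_simps flip: power_mult)
  have h: "h (u @ (a, b) # (c, d) # v) = K * s a b c d * g a b c d"
    if "a \<in> ?I" "b \<in> ?I" "c \<in> ?I" "d \<in> ?I" "a \<le> b" "c \<le> d" for a b c d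
  proof -
    have "set (u @ [(a, b), (c, d)] @ v) \<subseteq> queer_gens n" using that u v by (auto simp: queer_gens_def)
    then have "g a b c d = sg (u @ [(a, b), (c, d)] @ v) * h (u @ [(a, b), (c, d)] @ v)"
      unfolding g_def twisted_def by simp
    then show ?thesis by (simp flip: sg)
  qed
  have g0: "g a b c d = 0" if "\<not> (a \<le> b \<and> c \<le> d)" for a b c d
    using that by (auto simp: g_def twisted_def queer_gens_def)
  \<comment> \<open>Each bracket shrinks to one inequality: if one of the others fails, then one of
    the two letters lies below the diagonal and \<open>g\<close> vanishes.\<close>
  have B: "of_bool (k \<le> j \<and> j < l) * (c * h (u @ (i, l) # (k, j) # v)) = of_bool (j < l) * (c * (K * s i l k j * g i l k j))"
    "of_bool (i \<le> -l \<and> -l < j \<and> j \<le> -k) * (c * h (u @ (i, -l) # (k, -j) # v)) = of_bool (-l < j) * (c * (K * s i (-l) k (-j) * g i (-l) k (-j)))"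
    "of_bool (k < i \<and> i \<le> l) * (c * h (u @ (i, l) # (k, j) # v)) = of_bool (k < i) * (c * (K * s i l k j * g i l k j))"
    "of_bool (-l \<le> i \<and> i < -k \<and> -k \<le> j) * (c * h (u @ (-i, l) # (-k, j) # v)) = of_bool (i < -k) * (c * (K * s (-i) l (-k) j * g (-i) l (-k) j))"
    for c using ix by (auto simp: of_bool_def h g0)
  have "lin h (wmon u * queer_relator i j k l * wmon v) =
      ((-1) ^ parity i j) ^ parity k l * (qvar powi phi j l * (K * s i j k l * g i j k l))
      + of_bool (j < l) * (of_int (theta i j k) * zq * (K * s i l k j * g i l k j))
      + of_bool (-l < j) * (of_int (theta (-i) (-j) k) * zq * (K * s i (-l) k (-j) * g i (-l) k (-j)))
      - (qvar powi phi i k * (K * s k l i j * g k l i j)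
      + of_bool (k < i) * (of_int (theta i j k) * zq * (K * s i l k j * g i l k j))
      + of_bool (i < -k) * (of_int (theta (-i) (-j) k) * zq * (K * s (-i) l (-k) j * g (-i) l (-k) j)))"
    unfolding queer_relator_def Let_def lin_mon_left lin_mon_right
    using ix by (simp add: free_L_mon flip: mon_append zq_def B power_mult) (simp add: h mult.assoc)
  also have "((-1) ^ parity i j) ^ parity k l = (((-1) ^ (neg i + neg j)) ^ (neg k + neg l) :: cq)" (is "?a = ?b")
  proof -
    have "?a = ((-1) ^ (neg i + neg j)) ^ parity k l" using ix index_nonzero parity_neg by metis
    also have "\<dots> = ((-1) ^ parity k l) ^ (neg i + neg j)" by (simp add: mult.commute flip: power_mult)
    also have "\<dots> = ((-1) ^ (neg k + neg l)) ^ (neg i + neg j)" using ix index_nonzero parity_neg by metis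
    also have "\<dots> = ?b" by (simp add: mult.commute flip: power_mult)
    finally show ?thesis .
  qed
  finally have *: "lin h (wmon u * queer_relator i j k l * wmon v) = K * (
      ((-1) ^ (neg i + neg j)) ^ (neg k + neg l) * (qvar powi phi j l * (s i j k l * g i j k l))
      + of_bool (j < l) * (of_int (theta i j k) * zq * (s i l k j * g i l k j))
      + of_bool (-l < j) * (of_int (theta (-i) (-j) k) * zq * (s i (-l) k (-j) * g i (-l) k (-j)))
      - (qvar powi phi i k * (s k l i j * g k l i j)
      + of_bool (k < i) * (of_int (theta i j k) * zq * (s i l k j * g i l k j))
      + of_bool (i < -k) * (of_int (theta (-i) (-j) k) * zq * (s (-i) l (-k) j * g (-i) l (-k) j))))"
    by (simp add: algebra_simps)
  \<comment> \<open>The common sign of all terms, to be checked for the sixteen sign patterns of the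
    four indices.\<close>
  define e where "e = sx ^ (neg i + neg j + neg k + neg l) * sy ^ (neg j + neg l) *
    ((-1) ^ (neg i * neg j + neg k * neg l + neg i * neg k + neg i * neg l + neg j + neg l + neg j * neg l) :: cq)"
  note cases = neg_cases[OF index_nonzero[OF ix(1)]] neg_cases[OF index_nonzero[OF ix(2)]]
    neg_cases[OF index_nonzero[OF ix(3)]] neg_cases[OF index_nonzero[OF ix(4)]]
  have e: "((-1) ^ (neg i + neg j)) ^ (neg k + neg l) * (qvar powi phi j l * (s i j k l * g i j k l))
      + of_bool (j < l) * (of_int (theta i j k) * zq * (s i l k j * g i l k j))
      + of_bool (-l < j) * (of_int (theta (-i) (-j) k) * zq * (s i (-l) k (-j) * g i (-l) k (-j)))
      - (qvar powi phi i k * (s k l i j * g k l i j)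
      + of_bool (k < i) * (of_int (theta i j k) * zq * (s i l k j * g i l k j))
      + of_bool (i < -k) * (of_int (theta (-i) (-j) k) * zq * (s (-i) l (-k) j * g (-i) l (-k) j)))
    = e * (SR j l (\<lambda>a b. g i a k b) - SL i k (\<lambda>a b. g b l a j))"
    using cases unfolding e_def SR_def SL_def Acoef_def Ucoef_def Vcoef_def s_def theta_def sgn_minus
    by (elim disjE conjE; simp; simp add: algebra_simps sxy power2_eq_square)
  have "e \<noteq> 0" using sxy(1,2) unfolding e_def by auto
  then show ?thesis using * e K(2) unfolding g_def
    by (intro exI[of _ "K * e"]) (simp add: mult.assoc)
qed

definition annih :: "nat \<Rightarrow> (wd \<Rightarrow> cq) \<Rightarrow> bool" where
  "annih n h \<longleftrightarrow> (\<forall>p \<in> queer_ideal n. lin h p = 0)"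

lemma sg_cancel: "i \<noteq> 0 \<Longrightarrow> sg (u @ (i, i) # (-i, -i) # v) = (-1) ^ pw v * sg (u @ v)"
proof (induction u rule: sg.induct)
  case 1
  then show ?case by (auto simp: neg_def power_add)
next
  case (2 i' j' w)
  then show ?case by (auto simp: neg_def power_add)
qed

text \<open>With a letter below the diagonal the diagonal and the negating terms vanish. The
  exchange terms of both sides involve the same value \<open>g i l k j\<close>, and their brackets
  agree whenever it is nonzero.\<close>

lemma rtt_trivial:
  assumes "\<And>a b c d. \<not> (a \<le> b \<and> c \<le> d) \<Longrightarrow> g a b c d = 0" "j < i \<or> l < k"
  shows "SR j l (\<lambda>a b. g i a k b) = SL i k (\<lambda>a b. g b l a j)"
  using assms(2) unfolding SR_def SL_def Ucoef_def Vcoef_def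
  by (auto simp: assms(1) not_le)

text \<open>The two descriptions of functionals on the algebra agree. \<open>annih\<close> is suited
  to linear algebra modulo the ideal, \<open>rtt_form\<close> to coproducts and cut-offs.\<close>

lemma rtt_form_twisted_iff: "rtt_form n (twisted n h) \<longleftrightarrow> annih n h"
proof
  let ?I = "queer_index n" and ?G = "queer_gens n"
  assume g: "rtt_form n (twisted n h)"
  have "lin h (wmon u * r * wmon v) = 0" if uv: "set u \<subseteq> ?G" "set v \<subseteq> ?G" and r: "r \<in> queer_relators n" for u v r
    using r unfolding queer_relators_def
  proof (elim UnE CollectE exE conjE)
    fix i assume i: "i \<in> ?I" and r: "r = free_L i i * free_L (- i) (- i) - 1"
    have G: "(i, i) \<in> ?G" "(-i, -i) \<in> ?G" using i by (auto simp: queer_gens_def)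
    have "twisted n h (u @ (i, i) # (-i, -i) # v) = (-1) ^ pw v * twisted n h (u @ v)" by (rule rtt_form_cancel[OF g i])
    then have "sg (u @ (i, i) # (-i, -i) # v) * h (u @ (i, i) # (-i, -i) # v) = (-1) ^ pw v * (sg (u @ v) * h (u @ v))"
      using uv G by (simp add: twisted_def)
    also have "\<dots> = sg (u @ (i, i) # (-i, -i) # v) * h (u @ v)"
      using i by (simp add: sg_cancel index_nonzero)
    finally have "h (u @ (i, i) # (-i, -i) # v) = h (u @ v)"
      by (metis sg_square')
    then show ?thesis
      by (simp add: r lin_mon_left lin_mon_right free_L_mon algebra_simps flip: mon_append mon_Nil)
  next
    fix i j k l assume ij: "(i, j) \<in> ?G" and kl: "(k, l) \<in> ?G" and r: "r = queer_relator i j k l"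
    have "SR j l (\<lambda>a b. twisted n h (u @ [(i, a), (k, b)] @ v)) = SL i k (\<lambda>a b. twisted n h (u @ [(b, l), (a, j)] @ v))"
      using rtt_form_rtt[OF g, of i j k l u v] ij kl by (simp add: queer_gens_def)
    then show ?thesis using lin_relator[OF ij kl uv, of h] r by auto
  qed
  then show "annih n h" unfolding annih_def by (meson lin_ideal_eq_zero)
next
  let ?I = "queer_index n" and ?G = "queer_gens n"
  assume k: "annih n h"
  have uv0: "lin h (wmon u * r * wmon v) = 0" if "set u \<subseteq> ?G" "set v \<subseteq> ?G" "r \<in> queer_relators n" for u v r
    using k that unfolding annih_def by (meson Fc_mon ideal_mult_left ideal_mult_right ideal_relators)
  have "twisted n h (u @ [(i, i), (-i, -i)] @ v) = (-1) ^ pw v * twisted n h (u @ v)" if i: "i \<in> ?I" for u v i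
  proof (cases "set (u @ v) \<subseteq> ?G")
    case True
    have G: "(i, i) \<in> ?G" "(-i, -i) \<in> ?G" using i by (auto simp: queer_gens_def)
    have "free_L i i * free_L (- i) (- i) - 1 \<in> queer_relators n" using i by (auto simp: queer_relators_def)
    from uv0[OF _ _ this, of u v] True have "h (u @ (i, i) # (-i, -i) # v) = h (u @ v)"
      by (simp add: lin_mon_left lin_mon_right free_L_mon algebra_simps flip: mon_append mon_Nil)
    then show ?thesis using True G i by (simp add: twisted_def sg_cancel index_nonzero)
  qed (auto simp: twisted_def)
  moreover have "SR j l (\<lambda>a b. twisted n h (u @ [(i, a), (k, b)] @ v)) = SL i k (\<lambda>a b. twisted n h (u @ [(b, l), (a, j)] @ v))"
    if ix: "i \<in> ?I" "j \<in> ?I" "k \<in> ?I" "l \<in> ?I" for u v i j k l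
  proof (cases "set u \<subseteq> ?G \<and> set v \<subseteq> ?G")
    case uv: True
    show ?thesis
    proof (cases "i \<le> j \<and> k \<le> l")
      case True
      then have ij: "(i, j) \<in> ?G" and kl: "(k, l) \<in> ?G" using ix by (auto simp: queer_gens_def)
      then have "queer_relator i j k l \<in> queer_relators n" by (auto simp: queer_relators_def)
      then show ?thesis using lin_relator[OF ij kl, of u v h] uv uv0 by fastforce
    next
      case False
      then show ?thesis by (intro rtt_trivial) (auto simp: twisted_def queer_gens_def)
    qed
  qed (auto simp: twisted_def SL_def SR_def)
  ultimately show "rtt_form n (twisted n h)" unfolding rtt_form_def by (auto simp: twisted_def)
qed

lemma rtt_form_annih: "rtt_form n f \<Longrightarrow> annih n (\<lambda>w. sg w * f w)"
proof -
  assume g: "rtt_form n f"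
  have "twisted n (\<lambda>w. sg w * f w) = f" using rtt_form_gens[OF g] by (auto simp: twisted_def fun_eq_iff)
  then show ?thesis using g rtt_form_twisted_iff by metis
qed

section \<open>Separation of elements by functionals\<close>

interpretation fv: vector_space "scal :: cq \<Rightarrow> queer_free \<Rightarrow> queer_free"
  by (rule vector_space_scal)

lemma ideal_subspace: "fv.subspace (queer_ideal n)"
  by (auto simp: fv.subspace_def ideal_add ideal_scal)

text \<open>Over a field, a basis of the ideal stays independent when \<open>p\<close> is added, and
  a linear functional may be prescribed on it. Hence membership in the ideal can be tested by
  functionals.\<close>

lemma annih_separates:
  assumes "p \<notin> queer_ideal n"
  shows "\<exists>h. annih n h \<and> lin h p \<noteq> 0"
proof -
  interpret vp: vector_space_pair "scal :: cq \<Rightarrow> queer_free \<Rightarrow> queer_free" "(*) :: cq \<Rightarrow> cq \<Rightarrow> cq"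
    by unfold_locales (simp_all add: algebra_simps)
  obtain B where B: "B \<subseteq> queer_ideal n" "fv.independent B" "queer_ideal n \<subseteq> fv.span B"
    using fv.maximal_independent_subset by blast
  have sp: "fv.span B = queer_ideal n"
    using B(3) fv.span_minimal[OF B(1) ideal_subspace] by blast
  then have "fv.independent (insert p B)" using assms B(2) fv.independent_insertI by auto
  then obtain g :: "queer_free \<Rightarrow> cq" where g: "Vector_Spaces.linear scal (*) g" "\<forall>x \<in> insert p B. g x = of_bool (x = p)"
    using vp.linear_independent_extend[of "insert p B" "\<lambda>x. of_bool (x = p)"] by blast
  interpret g: Vector_Spaces.linear "scal :: cq \<Rightarrow> queer_free \<Rightarrow> queer_free" "(*)" g by (rule g(1))
  have lin: "lin (\<lambda>w. g (wmon w)) x = g x" for x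
    by (subst (2) mon_expand) (simp add: g.sum g.scale lin_def)
  have "g x = 0" if "x \<in> queer_ideal n" for x
    using that unfolding sp[symmetric] by (rule g.eq_0_on_span[rotated]) (use g(2) assms B(1) in auto)
  then have "annih n (\<lambda>w. g (wmon w))" by (simp add: annih_def lin)
  moreover have "lin (\<lambda>w. g (wmon w)) p \<noteq> 0" using g(2) by (simp add: lin)
  ultimately show ?thesis by blast
qed

lemma ideal_iff_annih: "p \<in> queer_ideal n \<longleftrightarrow> (\<forall>h. annih n h \<longrightarrow> lin h p = 0)"
  using annih_separates annih_def by blast

lemma annih_left: "annih n h \<Longrightarrow> set u \<subseteq> queer_gens n \<Longrightarrow> annih n (\<lambda>w. h (u @ w))"
  by (simp add: annih_def ideal_mult_left flip: lin_mon_left)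

lemma annih_right: "annih n h \<Longrightarrow> set u \<subseteq> queer_gens n \<Longrightarrow> annih n (\<lambda>w. h (w @ u))"
  by (simp add: annih_def ideal_mult_right flip: lin_mon_right)

lemma annih_graded: "annih n h \<Longrightarrow> annih n (\<lambda>w. \<gamma> (weight w) * h w)"
proof -
  have "twisted n (\<lambda>w. \<gamma> (weight w) * h w) = (\<lambda>w. \<gamma> (weight w) * twisted n h w)" by (simp add: twisted_def fun_eq_iff algebra_simps)
  then show "annih n h \<Longrightarrow> annih n (\<lambda>w. \<gamma> (weight w) * h w)" using rtt_form_graded[of n "twisted n h" \<gamma>] rtt_form_twisted_iff by metis
qed

text \<open>The convolution of two functionals, with the sign twist undone.\<close>

definition conv :: "nat \<Rightarrow> (wd \<Rightarrow> cq) \<Rightarrow> (wd \<Rightarrow> cq) \<Rightarrow> wd \<Rightarrow> cq" where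
  "conv n f h w = sg w * coprod n (\<lambda>u v. twisted n f u * twisted n h v) w"

lemma rtt_form_scale: "rtt_form n f \<Longrightarrow> rtt_form n (\<lambda>w. c * f w)"
  using rtt_form_graded[of n f "\<lambda>_. c"] by simp

lemma annih_conv:
  assumes "annih n f" "annih n h"
  shows "annih n (conv n f h)"
proof -
  have f: "rtt_form n (twisted n f)" and h: "rtt_form n (twisted n h)" using assms by (simp_all add: rtt_form_twisted_iff)
  have "rtt_form n (coprod n (\<lambda>u v. twisted n f u * twisted n h v))"
  proof (rule rtt_form_coprod)
    show "rtt_form n (\<lambda>u. twisted n f u * twisted n h v)" for v
      using rtt_form_scale[OF f, of "twisted n h v"] by (simp add: mult.commute)
    show "rtt_form n (\<lambda>v. twisted n f u * twisted n h v)" for u by (rule rtt_form_scale[OF h])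
  qed
  then show ?thesis using rtt_form_annih unfolding conv_def by blast
qed

section \<open>Words that are equal in the algebra\<close>

definition weq :: "nat \<Rightarrow> wd \<Rightarrow> wd \<Rightarrow> bool" where
  "weq n w w' \<longleftrightarrow> (\<forall>h. annih n h \<longrightarrow> h w = h w')"

lemma weq_ideal: "weq n w w' \<longleftrightarrow> wmon w - wmon w' \<in> queer_ideal n"
  by (auto simp: weq_def ideal_iff_annih)

lemma weq_refl [simp]: "weq n w w" and weq_trans [trans]: "weq n u v \<Longrightarrow> weq n v w \<Longrightarrow> weq n u w"
  and weq_sym: "weq n u v \<Longrightarrow> weq n v u"
  unfolding weq_def by metis+

lemma weq_app:
  assumes "weq n w w'" "set u \<subseteq> queer_gens n" "set v \<subseteq> queer_gens n"
  shows "weq n (u @ w @ v) (u @ w' @ v)"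
  using assms annih_left annih_right unfolding weq_def by (metis (no_types, lifting))

lemma weq_Cons: "weq n w w' \<Longrightarrow> p \<in> queer_gens n \<Longrightarrow> weq n (p # w) (p # w')"
  using weq_app[of n w w' "[p]" "[]"] by simp

lemma weq_left: "weq n w w' \<Longrightarrow> set u \<subseteq> queer_gens n \<Longrightarrow> weq n (u @ w) (u @ w')"
  using weq_app[of n w w' u "[]"] by simp

lemma weq_right: "weq n w w' \<Longrightarrow> set u \<subseteq> queer_gens n \<Longrightarrow> weq n (w @ u) (w' @ u)"
  using weq_app[of n w w' "[]" u] by simp

lemma annih_relator:
  assumes "annih n h" "(i, j) \<in> queer_gens n" "(k, l) \<in> queer_gens n"
  shows "(-1) ^ (parity i j * parity k l) * qvar powi phi j l * h [(i, j), (k, l)]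
      + of_bool (k \<le> j \<and> j < l) * of_int (theta i j k) * zq * h [(i, l), (k, j)]
      + of_bool (i \<le> -l \<and> -l < j \<and> j \<le> -k) * of_int (theta (-i) (-j) k) * zq * h [(i, -l), (k, -j)]
    = qvar powi phi i k * h [(k, l), (i, j)]
      + of_bool (k < i \<and> i \<le> l) * of_int (theta i j k) * zq * h [(i, l), (k, j)]
      + of_bool (-l \<le> i \<and> i < -k \<and> -k \<le> j) * of_int (theta (-i) (-j) k) * zq * h [(-i, l), (-k, j)]"
proof -
  have "queer_relator i j k l \<in> queer_ideal n"
    using assms by (intro ideal_relators) (auto simp: queer_relators_def)
  then have "lin h (queer_relator i j k l) = 0" using assms(1) by (simp add: annih_def)
  then show ?thesis unfolding queer_relator_def Let_def
    by (simp add: free_L_mon mult.assoc flip: mon_append zq_def)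
qed

lemma diag_gens: "(i, i) \<in> queer_gens n \<longleftrightarrow> i \<in> queer_index n"
  and odd_gens: "i \<in> {1..int n} \<Longrightarrow> (-i, i) \<in> queer_gens n"
  by (auto simp: queer_gens_def queer_index_def)

lemma weq_diag_commute: "i \<in> queer_index n \<Longrightarrow> j \<in> queer_index n \<Longrightarrow> weq n [(i, i), (j, j)] [(j, j), (i, i)]"
  unfolding weq_def
proof (intro allI impI)
  fix h assume ij: "i \<in> queer_index n" "j \<in> queer_index n" and "annih n h"
  have b: "(j \<le> i \<and> i < j) = False" "(i \<le> -j \<and> -j < i \<and> i \<le> -j) = False" "(j < i \<and> i \<le> j) = False"
    "(-j \<le> i \<and> i < -j \<and> -j \<le> i) = False" by auto
  have "parity i i = 0" using ij(1) index_nonzero by (auto simp: parity_def zero_less_mult_iff linorder_neq_iff)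
  then show "h [(i, i), (j, j)] = h [(j, j), (i, i)]"
    using annih_relator[OF \<open>annih n h\<close>, of i i j j] ij unfolding b by (simp add: diag_gens)
qed

lemma weq_diag_cancel: "i \<in> queer_index n \<Longrightarrow> weq n [(i, i), (-i, -i)] []"
proof -
  assume "i \<in> queer_index n"
  then have "free_L i i * free_L (- i) (- i) - 1 \<in> queer_ideal n"
    by (intro ideal_relators) (auto simp: queer_relators_def)
  then show ?thesis by (simp add: weq_ideal free_L_mon flip: mon_append mon_Nil)
qed

text \<open>If \<open>\<bar>j\<bar> = i\<close>, the two products enter with different powers of
  \<open>qvar\<close>. The one correction term that remains is a multiple of one of them and
  compensates the difference.\<close>

lemma weq_diag_odd: "i \<in> {1..int n} \<Longrightarrow> j \<in> queer_index n \<Longrightarrow> weq n [(j, j), (-i, i)] [(-i, i), (j, j)]"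
  unfolding weq_def
proof (intro allI impI)
  fix h assume ij: "i \<in> {1..int n}" "j \<in> queer_index n" and "annih n h"
  from annih_relator[OF this(3), of j j "-i" i] ij odd_gens diag_gens
  have r: "(-1) ^ (parity j j * parity (-i) i) * qvar powi phi j i * h [(j, j), (-i, i)]
      + of_bool (-i \<le> j \<and> j < i) * of_int (theta j j (-i)) * zq * h [(j, i), (-i, j)]
      + of_bool (j \<le> -i \<and> -i < j \<and> j \<le> - (-i)) * of_int (theta (-j) (-j) (-i)) * zq * h [(j, -i), (-i, -j)]
    = qvar powi phi j (-i) * h [(-i, i), (j, j)]
      + of_bool (-i < j \<and> j \<le> i) * of_int (theta j j (-i)) * zq * h [(j, i), (-i, j)]
      + of_bool (-i \<le> j \<and> j < - (-i) \<and> - (-i) \<le> j) * of_int (theta (-j) (-j) (-i)) * zq * h [(-j, i), (- (-i), j)]"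
    by simp
  have p: "parity j j = 0" and j0: "j \<noteq> 0" using ij index_nonzero by (auto simp: parity_def zero_less_mult_iff linorder_neq_iff)
  consider "j = i" | "j = -i" | "j \<noteq> i" "j \<noteq> -i" by blast
  then show "h [(j, j), (-i, i)] = h [(-i, i), (j, j)]"
  proof cases
    case 1
    then show ?thesis using r p ij by (simp add: phi_def theta_def zq_def field_simps)
  next
    case 2
    then show ?thesis using r p ij by (simp add: phi_def theta_def zq_def field_simps)
  next
    case 3
    then have "\<bar>j\<bar> \<noteq> \<bar>i\<bar>" and b: "(-i \<le> j \<and> j < i) = (-i < j \<and> j \<le> i)"
      "(j \<le> -i \<and> -i < j \<and> j \<le> - (-i)) = False" "(-i \<le> j \<and> j < - (-i) \<and> - (-i) \<le> j) = False" by auto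
    then show ?thesis using r p unfolding b by (simp add: phi_def)
  qed
qed

section \<open>Words in the Cartan part\<close>

definition block :: "int \<Rightarrow> int \<Rightarrow> wd" where
  "block i z = replicate (nat \<bar>z\<bar>) (if z \<ge> 0 then (i, i) else (-i, -i))"

definition blocks :: "int list \<Rightarrow> (int \<Rightarrow> int) \<Rightarrow> wd" where
  "blocks l g = concat (map (\<lambda>i. block i (g i)) l)"

abbreviation kw :: "nat \<Rightarrow> (int \<Rightarrow> int) \<Rightarrow> wd" where
  "kw n \<equiv> blocks [1..int n]"

text \<open>For positive \<open>i\<close>, the exponent of \<open>L_ii\<close> after all diagonal
  letters have been collected, \<open>L_{-i,-i}\<close> being its inverse.\<close>

definition cnt :: "wd \<Rightarrow> int \<Rightarrow> int" where
  "cnt t i = (\<Sum>(a, b) \<leftarrow> t. of_bool (a = b) * (of_bool (a = i) - of_bool (a = -i)))"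

definition zero_letter :: "nat \<Rightarrow> int \<times> int \<Rightarrow> bool" where
  "zero_letter n p \<longleftrightarrow> (case p of (a, b) \<Rightarrow> a = b \<and> a \<in> queer_index n \<or> a = -b \<and> b \<in> {1..int n})"

lemma zero_letter_gens: "zero_letter n p \<Longrightarrow> p \<in> queer_gens n"
  by (auto simp: zero_letter_def queer_gens_def queer_index_def)

lemma cnt_simps [simp]:
  "cnt [] = (\<lambda>i. 0)" "cnt (u @ v) = (\<lambda>i. cnt u i + cnt v i)"
  "cnt ((a, b) # t) = (\<lambda>i. of_bool (a = b) * (of_bool (a = i) - of_bool (a = -i)) + cnt t i)"
  by (auto simp: cnt_def fun_eq_iff)

lemma weq_diag_zero_commute:
  assumes "a \<in> queer_index n" "\<forall>p \<in> set t. zero_letter n p"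
  shows "weq n ((a, a) # t) (t @ [(a, a)])"
  using assms(2)
proof (induction t)
  case (Cons p t)
  have p: "zero_letter n p" and t: "\<forall>p \<in> set t. zero_letter n p" using Cons.prems by auto
  have "weq n [(a, a), p] [p, (a, a)]"
    using p weq_diag_commute[OF assms(1)] weq_diag_odd[OF _ assms(1)] by (auto simp: zero_letter_def)
  then have "weq n ([(a, a), p] @ t) ([p, (a, a)] @ t)"
    using t zero_letter_gens by (intro weq_right) auto
  also have "weq n ([p, (a, a)] @ t) (p # t @ [(a, a)])"
    using weq_Cons[OF Cons.IH[OF t] zero_letter_gens[OF p]] by simp
  finally show ?case by simp
qed simp

lemma zero_letter_block: "i \<in> {1..int n} \<Longrightarrow> p \<in> set (block i z) \<Longrightarrow> zero_letter n p"
  by (auto simp: block_def zero_letter_def queer_index_def split: if_splits)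

lemma zero_letter_blocks: "set l \<subseteq> {1..int n} \<Longrightarrow> p \<in> set (blocks l g) \<Longrightarrow> zero_letter n p"
  unfolding blocks_def by (auto intro: zero_letter_block)

lemma gens_blocks: "set l \<subseteq> {1..int n} \<Longrightarrow> set (blocks l g) \<subseteq> queer_gens n"
  using zero_letter_blocks zero_letter_gens by blast

lemma weq_block:
  assumes "a \<in> queer_index n"
  shows "weq n ((a, a) # block \<bar>a\<bar> z) (block \<bar>a\<bar> (z + sgn a))"
proof -
  have c: "weq n ((b, b) # (-b, -b) # replicate m (-b, -b)) (replicate m (-b, -b))" if "b \<in> queer_index n" for b m
  proof -
    have "set (replicate m (-b, -b)) \<subseteq> queer_gens n" using that by (cases m) (auto simp: diag_gens)
    then show ?thesis using weq_right[OF weq_diag_cancel[OF that]] by simp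
  qed
  have a0: "a \<noteq> 0" using assms index_nonzero by auto
  consider "sgn a = 1" "z \<ge> 0" | "sgn a = 1" "z < 0" | "sgn a = -1" "z > 0" | "sgn a = -1" "z \<le> 0"
  proof -
    have "sgn a = 1 \<or> sgn a = -1" using a0 by (auto simp: sgn_if)
    then show thesis using that by (meson not_le)
  qed
  then show ?thesis
  proof cases
    case 1
    then have "nat \<bar>z + 1\<bar> = Suc (nat \<bar>z\<bar>)" "\<bar>a\<bar> = a" by (auto simp: sgn_if split: if_splits)
    then show ?thesis using 1 by (simp add: block_def)
  next
    case 2
    then have "nat \<bar>z\<bar> = Suc (nat \<bar>z + 1\<bar>)" "\<bar>a\<bar> = a" by (auto simp: sgn_if split: if_splits)
    moreover have "block a (z + 1) = replicate (nat \<bar>z + 1\<bar>) (-a, -a)" using 2 by (auto simp: block_def)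
    moreover have "block a z = replicate (nat \<bar>z\<bar>) (-a, -a)" using 2 by (auto simp: block_def)
    ultimately show ?thesis using c[OF assms, of "nat \<bar>z + 1\<bar>"] 2(1) by (simp only: replicate_Suc)
  next
    case 3
    then have "nat \<bar>z\<bar> = Suc (nat \<bar>z - 1\<bar>)" "\<bar>a\<bar> = -a" by (auto simp: sgn_if split: if_splits)
    then show ?thesis using 3 c[OF assms, of "nat \<bar>z - 1\<bar>"] by (simp add: block_def)
  next
    case 4
    then have "nat \<bar>z - 1\<bar> = Suc (nat \<bar>z\<bar>)" "\<bar>a\<bar> = -a" by (auto simp: sgn_if split: if_splits)
    then show ?thesis using 4 by (auto simp: block_def)
  qed
qed

lemma weq_blocks:
  assumes "a \<in> queer_index n" "distinct l" "set l \<subseteq> {1..int n}" "\<bar>a\<bar> \<in> set l"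
  shows "weq n ((a, a) # blocks l g) (blocks l (g(\<bar>a\<bar> := g \<bar>a\<bar> + sgn a)))"
  using assms(2-4)
proof (induction l)
  case (Cons i l)
  let ?g = "g(\<bar>a\<bar> := g \<bar>a\<bar> + sgn a)"
  have gl: "set (blocks l g) \<subseteq> queer_gens n" using Cons.prems by (intro gens_blocks) auto
  have i: "\<forall>p \<in> set (block i (g i)). zero_letter n p" using Cons.prems zero_letter_block by auto
  show ?case
  proof (cases "\<bar>a\<bar> = i")
    case True
    then have e: "blocks l ?g = blocks l g" using Cons.prems unfolding blocks_def by (auto intro!: arg_cong[of _ _ concat])
    have "weq n (((a, a) # block \<bar>a\<bar> (g i)) @ blocks l g) (block \<bar>a\<bar> (g i + sgn a) @ blocks l g)"
      by (rule weq_right[OF weq_block[OF assms(1)] gl])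
    then show ?thesis using True e by (simp add: blocks_def)
  next
    case False
    have "weq n (((a, a) # block i (g i)) @ blocks l g) ((block i (g i) @ [(a, a)]) @ blocks l g)"
      by (rule weq_right[OF weq_diag_zero_commute[OF assms(1) i] gl])
    also have "weq n ((block i (g i) @ [(a, a)]) @ blocks l g) (block i (g i) @ blocks l ?g)"
    proof -
      have "weq n ((a, a) # blocks l g) (blocks l ?g)" using Cons.prems False by (intro Cons.IH) auto
      moreover have "set (block i (g i)) \<subseteq> queer_gens n" using i zero_letter_gens by blast
      ultimately show ?thesis using weq_left by fastforce
    qed
    finally show ?thesis using False by (simp add: blocks_def)
  qed
qed simp

lemma blocks_cong: "(\<And>i. i \<in> set l \<Longrightarrow> g i = g' i) \<Longrightarrow> blocks l g = blocks l g'"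
  unfolding blocks_def by (auto intro!: arg_cong[of _ _ concat])

text \<open>Diagonal letters commute with all letters of the Cartan part and can be gathered at the
  right end. The odd letters keep their order, so no signs or corrections arise.\<close>

lemma weq_normal_form:
  assumes "\<forall>p \<in> set t. zero_letter n p"
  shows "weq n t (filter (\<lambda>(a, b). a \<noteq> b) t @ kw n (cnt t))"
  using assms
proof (induction t)
  case Nil
  have "blocks l (\<lambda>i. 0) = []" for l by (induction l) (auto simp: blocks_def block_def)
  then show ?case by simp
next
  case (Cons p t)
  obtain a b where p: "p = (a, b)" by force
  let ?o = "filter (\<lambda>(a, b). a \<noteq> b) t"
  have pl: "zero_letter n p" and t: "\<forall>p \<in> set t. zero_letter n p" using Cons.prems by auto
  have ih: "weq n (p # t) (p # ?o @ kw n (cnt t))"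
    by (rule weq_Cons[OF Cons.IH[OF t] zero_letter_gens[OF pl]])
  show ?case
  proof (cases "a = b")
    case False
    then have "cnt (p # t) = cnt t" by (simp add: p)
    then show ?thesis using ih False by (simp add: p)
  next
    case True
    then have a: "a \<in> queer_index n" using pl by (auto simp: zero_letter_def p queer_index_def)
    have "weq n (p # ?o @ kw n (cnt t)) ((?o @ [p]) @ kw n (cnt t))"
      using weq_right[OF weq_diag_zero_commute[OF a, of ?o], of "kw n (cnt t)"] t True gens_blocks[of "[1..int n]" n "cnt t"]
      by (auto simp: p)
    also have "weq n ((?o @ [p]) @ kw n (cnt t)) (?o @ kw n ((cnt t)(\<bar>a\<bar> := cnt t \<bar>a\<bar> + sgn a)))"
    proof -
      have "weq n (p # kw n (cnt t)) (kw n ((cnt t)(\<bar>a\<bar> := cnt t \<bar>a\<bar> + sgn a)))"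
      proof -
        have "\<bar>a\<bar> \<in> set [1..int n]" using a by (auto simp: queer_index_def)
        then show ?thesis unfolding p True[symmetric] by (intro weq_blocks[OF a]) auto
      qed
      from weq_left[OF this, of ?o] show ?thesis using t zero_letter_gens by auto
    qed
    also have "kw n ((cnt t)(\<bar>a\<bar> := cnt t \<bar>a\<bar> + sgn a)) = kw n (cnt (p # t))"
      using True a index_nonzero by (intro blocks_cong) (auto simp: p queer_index_def sgn_if)
    finally have *: "weq n (p # ?o @ kw n (cnt t)) (?o @ kw n (cnt (p # t)))" .
    have "filter (\<lambda>(a, b). a \<noteq> b) (p # t) = ?o" using True by (simp add: p)
    then show ?thesis using weq_trans[OF ih *] by (simp only:)
  qed
qed

lemma cnt_block: "i > 0 \<Longrightarrow> j > 0 \<Longrightarrow> cnt (block j z) i = of_bool (i = j) * z"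
proof -
  have "cnt (replicate m (a, a)) i = int m * (of_bool (a = i) - of_bool (a = -i))" for m a
    by (induction m) (auto simp: algebra_simps)
  then show "i > 0 \<Longrightarrow> j > 0 \<Longrightarrow> ?thesis" by (auto simp: block_def)
qed

lemma cnt_blocks: "distinct l \<Longrightarrow> \<forall>j \<in> set l. j > 0 \<Longrightarrow> i > 0 \<Longrightarrow> cnt (blocks l g) i = of_bool (i \<in> set l) * g i"
proof (induction l)
  case (Cons j l)
  have "blocks (j # l) g = block j (g j) @ blocks l g" by (simp add: blocks_def)
  then show ?case using Cons by (auto simp: cnt_block)
qed (simp add: blocks_def)

lemma cnt_kw [simp]: "i \<in> {1..int n} \<Longrightarrow> cnt (kw n g) i = g i"
  by (subst cnt_blocks) auto

lemma cnt_odd1: "distinct l \<Longrightarrow> \<forall>j \<in> set l. j > 0 \<Longrightarrow> i > 0 \<Longrightarrow> cnt (odd1 T l) i = - of_bool (i \<in> T \<and> i \<in> set l)"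
  by (induction l) (auto simp: odd1_def)

lemma cnt_odd2: "distinct l \<Longrightarrow> \<forall>j \<in> set l. j > 0 \<Longrightarrow> i > 0 \<Longrightarrow> cnt (odd2 T l) i = of_bool (i \<notin> T \<and> i \<in> set l)"
  by (induction l) (auto simp: odd2_def)

text \<open>Up to a scalar, the product of the \<open>k_bar n l\<close>, \<open>l \<in> S\<close>, and of \<open>q_pow n g\<close>.\<close>

definition yw :: "nat \<Rightarrow> int set \<Rightarrow> (int \<Rightarrow> int) \<Rightarrow> wd" where
  "yw n S g = odd_word (sorted_list_of_set S) @ kw n g"

definition row_diag :: "wd \<Rightarrow> wd" where
  "row_diag w = map (\<lambda>(i, j). (i, i)) w"

definition col_diag :: "wd \<Rightarrow> wd" where
  "col_diag w = map (\<lambda>(i, j). (j, j)) w"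

text \<open>
  The Cartan exponents, and the sign, of the summand of the coproduct of \<open>x y w\<close> in which the odd letters with
  index in \<open>T\<close> go to the right factor.
\<close>

definition G1 :: "nat \<Rightarrow> int set \<Rightarrow> (int \<Rightarrow> int) \<Rightarrow> wd \<Rightarrow> int \<Rightarrow> int" where
  "G1 n T g w = (\<lambda>i \<in> {1..int n}. g i - of_bool (i \<in> T) + cnt (row_diag w) i)"

definition G2 :: "nat \<Rightarrow> int set \<Rightarrow> (int \<Rightarrow> int) \<Rightarrow> wd \<Rightarrow> int \<Rightarrow> int" where
  "G2 n T g x = (\<lambda>i \<in> {1..int n}. g i + of_bool (i \<in> T) + cnt (col_diag x) i)"

definition split_sign :: "nat \<Rightarrow> wd \<Rightarrow> int set \<Rightarrow> int set \<Rightarrow> (int \<Rightarrow> int) \<Rightarrow> wd \<Rightarrow> cq" where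
  "split_sign n x S T g w = (let l = sorted_list_of_set S in
     sg (x @ odd_word l @ kw n g @ w) * sg (x @ odd1 T l @ kw n g @ row_diag w) * sg (col_diag x @ odd2 T l @ kw n g @ w))"

section \<open>Convolution evaluated at a triangular product\<close>

definition minus_words :: "nat \<Rightarrow> wd set" where
  "minus_words n = {x. set x \<subseteq> queer_gens n \<and> (\<forall>p \<in> set x. minus_letter p)}"

definition plus_words :: "nat \<Rightarrow> wd set" where
  "plus_words n = {x. set x \<subseteq> queer_gens n \<and> (\<forall>p \<in> set x. plus_letter p)}"

lemma sg_nonzero [simp]: "sg w \<noteq> 0"
  using sg_square[of w] by auto

lemma split_sign_nonzero [simp]: "split_sign n x S T g w \<noteq> 0"
  by (simp add: split_sign_def Let_def)

lemma row_diag_blocks: "row_diag (blocks l g) = blocks l g"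
  by (induction l) (auto simp: row_diag_def blocks_def block_def)

lemma filter_odd1: "filter (\<lambda>(a, b). a \<noteq> b) (odd1 T l) = odd_word (filter (\<lambda>i. i \<notin> T) l)" if "\<forall>i \<in> set l. i > 0"
  using that by (induction l) (auto simp: odd1_def)

lemma filter_odd2: "filter (\<lambda>(a, b). a \<noteq> b) (odd2 T l) = odd_word (filter (\<lambda>i. i \<in> T) l)" if "\<forall>i \<in> set l. i > 0"
  using that by (induction l) (auto simp: odd2_def)

lemma filter_sorted_list_of_set:
  "finite S \<Longrightarrow> filter P (sorted_list_of_set S) = sorted_list_of_set {x \<in> S. P x}"
  by (rule sorted_distinct_set_unique) (auto simp: sorted_wrt_filter)

lemma filter_diag: "\<forall>p \<in> set r. fst p = snd p \<Longrightarrow> filter (\<lambda>(a, b). a \<noteq> b) r = []"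
  by (auto simp: filter_empty_conv)

lemma diag_blocks: "p \<in> set (blocks l g) \<Longrightarrow> fst p = snd p"
  by (auto simp: blocks_def block_def split: if_splits)

lemma zero_letter_odd: "\<forall>i \<in> set l. i \<in> {1..int n} \<Longrightarrow> p \<in> set (odd1 T l) \<union> set (odd2 T l) \<Longrightarrow> zero_letter n p"
  by (auto simp: odd1_def odd2_def zero_letter_def queer_index_def split: if_splits)

lemma zero_letter_row: "set w \<subseteq> queer_gens n \<Longrightarrow> p \<in> set (row_diag w) \<union> set (col_diag w) \<Longrightarrow> zero_letter n p"
  by (auto simp: row_diag_def col_diag_def zero_letter_def queer_gens_def)

text \<open>This is \<open>coprod_triangular\<close> with both factors brought into normal form: the
  diagonal letters that \<open>w\<close> leaves on the left, \<open>x\<close> on the right and the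
  odd letters on both sides are absorbed into the exponents \<open>G1\<close> and
  \<open>G2\<close>.\<close>

theorem conv_triangular:
  assumes f: "annih n f" "\<And>u. f u \<noteq> 0 \<Longrightarrow> int (length x) \<le> height u" and h: "annih n h"
    and x: "x \<in> minus_words n" and S: "S \<subseteq> {1..int n}" and w: "w \<in> plus_words n"
  shows "conv n f h (x @ yw n S g @ w) =
    (\<Sum>T \<in> Pow S. split_sign n x S T g w * f (x @ yw n (S - T) (G1 n T g w)) * h (yw n T (G2 n (S - T) g x) @ w))"
proof -
  let ?l = "sorted_list_of_set S" and ?G = "queer_gens n" and ?f = "\<lambda>(a, b). a \<noteq> (b :: int)"
  have fin: "finite S" using S finite_subset by blast
  have l: "distinct ?l" "set ?l \<subseteq> {1..int n}" and lpos: "\<forall>i \<in> set ?l. i > 0" "\<forall>i \<in> set ?l. i \<in> {1..int n}"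
    using fin S by auto
  have xg: "set x \<subseteq> ?G" and wg: "set w \<subseteq> ?G" using x w by (auto simp: minus_words_def plus_words_def)
  have kg: "set (kw n g) \<subseteq> ?G" by (rule gens_blocks) simp
  have og: "set (odd1 T ?l) \<subseteq> ?G" "set (odd2 T ?l) \<subseteq> ?G" for T
    using zero_letter_odd[OF lpos(2)] zero_letter_gens by blast+
  have o0: "set (odd_word ?l) \<subseteq> ?G" using lpos(2) odd_gens by auto
  have weight: "set (row_diag w) \<subseteq> ?G" "set (col_diag x) \<subseteq> ?G"
    using zero_letter_row[OF wg] zero_letter_row[OF xg] zero_letter_gens by blast+
  let ?r = "kw n g @ w"
  have r: "\<forall>(i, j) \<in> set ?r. i = j \<or> i < 0 \<and> \<bar>j\<bar> < \<bar>i\<bar>"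
    using w by (auto simp: plus_words_def plus_letter_def dest!: diag_blocks)
  have rd: "map (\<lambda>(i, j). (i, i)) ?r = kw n g @ row_diag w"
    using row_diag_blocks[of "[1..int n]" g] by (simp add: row_diag_def)
  have 1: "weq n (x @ odd1 T ?l @ kw n g @ row_diag w) (x @ yw n (S - T) (G1 n T g w))" if T: "T \<subseteq> S" for T
  proof -
    let ?t = "odd1 T ?l @ kw n g @ row_diag w"
    have "weq n ?t (filter ?f ?t @ kw n (cnt ?t))"
      using zero_letter_odd[OF lpos(2)] zero_letter_row[OF wg] zero_letter_blocks[of "[1..int n]" n]
      by (intro weq_normal_form) auto
    also have "filter ?f ?t = odd_word (sorted_list_of_set (S - T))"
    proof -
      have "filter ?f (kw n g @ row_diag w) = []"
        by (rule filter_diag) (auto simp: row_diag_def dest: diag_blocks)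
      then show ?thesis
        using filter_odd1[OF lpos(1)] filter_sorted_list_of_set[OF fin, of "\<lambda>i. i \<notin> T"] by (simp add: set_diff_eq)
    qed
    also have "kw n (cnt ?t) = kw n (G1 n T g w)"
      using l lpos fin S T by (intro blocks_cong) (auto simp: G1_def cnt_odd1)
    finally show ?thesis by (intro weq_left xg) (simp add: yw_def)
  qed
  have 2: "weq n (col_diag x @ odd2 T ?l @ kw n g @ w) (yw n T (G2 n (S - T) g x) @ w)" if T: "T \<subseteq> S" for T
  proof -
    let ?t = "col_diag x @ odd2 T ?l @ kw n g"
    have "weq n ?t (filter ?f ?t @ kw n (cnt ?t))"
      using zero_letter_odd[OF lpos(2)] zero_letter_row[OF xg] zero_letter_blocks[of "[1..int n]" n]
      by (intro weq_normal_form) auto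
    also have "filter ?f ?t = odd_word (sorted_list_of_set T)"
    proof -
      have "{i \<in> S. i \<in> T} = T" using T by auto
      moreover have "filter ?f (col_diag x) = []" "filter ?f (kw n g) = []"
        by (rule filter_diag, auto simp: col_diag_def dest: diag_blocks)+
      ultimately show ?thesis
        using filter_odd2[OF lpos(1)] filter_sorted_list_of_set[OF fin, of "\<lambda>i. i \<in> T"] by simp
    qed
    also have "kw n (cnt ?t) = kw n (G2 n (S - T) g x)"
      using l lpos fin S by (intro blocks_cong) (auto simp: G2_def cnt_odd2)
    finally have "weq n (?t @ w) (yw n T (G2 n (S - T) g x) @ w)" by (intro weq_right wg) (simp add: yw_def)
    then show ?thesis by simp
  qed
  have f': "twisted n f u = sg u * f u" "twisted n h u = sg u * h u" if "set u \<subseteq> ?G" for u using that by (simp_all add: twisted_def)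
  have "conv n f h (x @ yw n S g @ w) = sg (x @ odd_word ?l @ ?r) * coprod n (\<lambda>u v. twisted n f u * twisted n h v) (x @ odd_word ?l @ ?r)"
    by (simp add: conv_def yw_def)
  also have "coprod n (\<lambda>u v. twisted n f u * twisted n h v) (x @ odd_word ?l @ ?r) =
    (\<Sum>T \<in> Pow (set ?l). twisted n f (x @ odd1 T ?l @ map (\<lambda>(i, j). (i, i)) ?r) * twisted n h (map (\<lambda>(i, j). (j, j)) x @ odd2 T ?l @ ?r))"
  proof (rule coprod_triangular)
    show "twisted n f u \<noteq> 0 \<Longrightarrow> int (length x) \<le> height u" for u using f(2) by (auto simp: twisted_def)
  qed (use f h x l r wg kg in \<open>auto simp: rtt_form_twisted_iff minus_words_def\<close>)
  also have "\<dots> = (\<Sum>T \<in> Pow S. sg (x @ odd1 T ?l @ kw n g @ row_diag w) * sg (col_diag x @ odd2 T ?l @ ?r) *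
     (f (x @ yw n (S - T) (G1 n T g w)) * h (yw n T (G2 n (S - T) g x) @ w)))"
  proof (rule sum.cong)
    fix T assume "T \<in> Pow S"
    then have T: "T \<subseteq> S" by simp
    have "f (x @ odd1 T ?l @ kw n g @ row_diag w) = f (x @ yw n (S - T) (G1 n T g w))" using 1[OF T] f(1) by (simp add: weq_def)
    moreover have "h (col_diag x @ odd2 T ?l @ ?r) = h (yw n T (G2 n (S - T) g x) @ w)" using 2[OF T] h by (simp add: weq_def)
    ultimately show "twisted n f (x @ odd1 T ?l @ map (\<lambda>(i, j). (i, i)) ?r) * twisted n h (map (\<lambda>(i, j). (j, j)) x @ odd2 T ?l @ ?r) =
      sg (x @ odd1 T ?l @ kw n g @ row_diag w) * sg (col_diag x @ odd2 T ?l @ ?r) *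
     (f (x @ yw n (S - T) (G1 n T g w)) * h (yw n T (G2 n (S - T) g x) @ w))"
      unfolding rd col_diag_def[symmetric] using xg og kg weight wg by (simp add: f')
  qed (use fin in simp)
  finally show ?thesis by (simp add: split_sign_def Let_def sum_distrib_left mult.assoc)
qed

lemma conv_low:
  assumes f: "annih n f" "\<And>u. f u \<noteq> 0 \<Longrightarrow> int (length x) < height u" and h: "annih n h"
    and x: "x \<in> minus_words n" and S: "S \<subseteq> {1..int n}" and w: "w \<in> plus_words n"
  shows "conv n f h (x @ yw n S g @ w) = 0"
proof -
  have "finite S" using S finite_subset by blast
  have "coprod n (\<lambda>u v. twisted n f u * twisted n h v) (x @ (yw n S g @ w)) = 0"
  proof (rule coprod_high)
    show "twisted n f u * twisted n h v \<noteq> 0 \<Longrightarrow> set u \<subseteq> queer_gens n \<and> set v \<subseteq> queer_gens n \<and> int (length x) < height u" for u v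
      using f(2) by (auto simp: twisted_def)
    show "\<forall>p \<in> set x. minus_letter p" using x by (simp add: minus_words_def)
    show "\<forall>p \<in> set (yw n S g @ w). nonpos_letter p"
      using w S \<open>finite S\<close> by (auto simp: yw_def plus_words_def plus_letter_def nonpos_letter_def dest!: diag_blocks)
  qed
  then show ?thesis by (simp add: conv_def)
qed

section \<open>Linear independence\<close>

lemma qvar_powi_eq_1: "qvar powi k = 1 \<Longrightarrow> k = 0"
proof -
  have p: "m = 0" if "qvar ^ m = 1" for m
  proof -
    have "to_fract ([:0, 1:] ^ m) = qvar ^ m"
      by (induction m) (simp_all only: qvar_def power_0 power_Suc to_fract_1 to_fract_mult)
    then have "to_fract ([:0, 1:] ^ m) = to_fract (1 :: complex poly)" using that by simp
    then have "[:0, 1:] ^ m = (1 :: complex poly)" by (simp only: to_fract_eq_iff)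
    then have "degree ([:0, 1:] ^ m :: complex poly) = 0" by simp
    then show ?thesis by (simp add: degree_power_eq)
  qed
  assume "qvar powi k = 1"
  then show ?thesis using p[of "nat k"] p[of "nat (- k)"] by (cases "k \<ge> 0") (auto simp: power_int_def power_inverse)
qed

lemma qvar_powi_inject: "qvar powi a = qvar powi b \<longleftrightarrow> a = b"
proof
  assume "qvar powi a = qvar powi b"
  then have "qvar powi (a - b) = 1" by (simp add: power_int_diff)
  then show "a = b" using qvar_powi_eq_1 by fastforce
qed simp

lemma zq_nonzero [simp]: "zq \<noteq> 0"
  using qvar_powi_inject[of 1 "-1"] by (simp add: zq_def power_int_minus)

text \<open>Linear independence of the family \<open>f\<close> in the algebra: by
  \<open>ideal_iff_annih\<close> a combination of words lies in the ideal exactly when all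
  functionals kill it.\<close>

definition indep :: "nat \<Rightarrow> 'a set \<Rightarrow> ('a \<Rightarrow> wd) \<Rightarrow> bool" where
  "indep n A f \<longleftrightarrow> (\<forall>J c. finite J \<longrightarrow> J \<subseteq> A \<longrightarrow> (\<forall>h. annih n h \<longrightarrow> (\<Sum>a \<in> J. c a * h (f a)) = 0) \<longrightarrow> (\<forall>a \<in> J. c a = 0))"

text \<open>If the terms of a relation repeat members of an independent family, the coefficients at
  equal members add up to zero. In the applications \<open>d\<close> contains values of the other
  functional of a convolution, so a new relation results.\<close>

lemma indep_regroup:
  assumes "indep n A f" "finite K" "t ` K \<subseteq> A" "\<And>h. annih n h \<Longrightarrow> (\<Sum>k \<in> K. d k * h (f (t k))) = 0"
  shows "(\<Sum>k \<in> {k \<in> K. t k = a}. d k) = 0"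
proof (cases "a \<in> t ` K")
  case True
  have "(\<Sum>b \<in> t ` K. (\<Sum>k \<in> {k \<in> K. t k = b}. d k) * h (f b)) = 0" if "annih n h" for h
  proof -
    have "(\<Sum>b \<in> t ` K. (\<Sum>k \<in> {k \<in> K. t k = b}. d k) * h (f b)) = (\<Sum>b \<in> t ` K. \<Sum>k \<in> {k \<in> K. t k = b}. d k * h (f (t k)))"
      by (intro sum.cong refl) (auto simp: sum_distrib_right intro!: sum.cong)
    also have "\<dots> = (\<Sum>k \<in> K. d k * h (f (t k)))" by (rule sum.image_gen[symmetric]) (rule assms(2))
    finally show ?thesis using assms(4)[OF that] by simp
  qed
  then have "\<forall>b \<in> t ` K. (\<Sum>k \<in> {k \<in> K. t k = b}. d k) = 0"
    using assms(1)[unfolded indep_def, rule_format, of "t ` K" "\<lambda>b. \<Sum>k \<in> {k \<in> K. t k = b}. d k"] assms(2,3) by blast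
  then show ?thesis using True by blast
next
  case False
  then have *: "{k \<in> K. t k = a} = {}" by auto
  show ?thesis unfolding * by simp
qed

text \<open>
  Dedekind's independence of characters.  Only the exponents \<open>m\<close> in a set closed under adding unit vectors are
  needed, since multiplying by one coordinate character eliminates an element of \<open>J\<close>.
\<close>

lemma characters_independent:
  fixes M :: "(int \<Rightarrow> int) set"
  assumes "finite J" "finite D" "M \<noteq> {}" "\<And>m j. m \<in> M \<Longrightarrow> j \<in> D \<Longrightarrow> m(j := m j + 1) \<in> M"
    and "\<And>g g'. g \<in> J \<Longrightarrow> g' \<in> J \<Longrightarrow> g \<noteq> g' \<Longrightarrow> \<exists>j \<in> D. g j \<noteq> g' j"
    and "\<And>m. m \<in> M \<Longrightarrow> (\<Sum>g \<in> J. c g * qvar powi (\<Sum>i \<in> D. m i * g i)) = 0"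
  shows "\<forall>g \<in> J. c g = 0"
  using assms(1,5,6)
proof (induction J arbitrary: c)
  case (insert g0 J)
  have J: "c g = 0" if g: "g \<in> J" for g
  proof -
    obtain j where j: "j \<in> D" "g j \<noteq> g0 j" using insert.prems(1)[of g g0] insert.hyps g by auto
    have "\<forall>g \<in> J. c g * (qvar powi g j - qvar powi g0 j) = 0"
    proof (rule insert.IH)
      fix m assume m: "m \<in> M"
      let ?e = "\<lambda>g. \<Sum>i \<in> D. m i * g i"
      have e: "(\<Sum>i \<in> D. (m(j := m j + 1)) i * g i) = ?e g + g j" for g
      proof -
        have "(\<Sum>i \<in> D. (m(j := m j + 1)) i * g i) = (\<Sum>i \<in> D. m i * g i + (if i = j then g j else 0))"
          by (intro sum.cong) (auto simp: algebra_simps)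
        then show ?thesis using j(1) assms(2) by (simp add: sum.distrib)
      qed
      have 1: "c g0 * (qvar powi ?e g0 * qvar powi g0 j) + (\<Sum>g \<in> J. c g * (qvar powi ?e g * qvar powi g j)) = 0"
        using insert.prems(2)[OF assms(4)[OF m j(1)]] insert.hyps unfolding e by (simp add: power_int_add)
      have 2: "c g0 * qvar powi ?e g0 + (\<Sum>g \<in> J. c g * qvar powi ?e g) = 0"
        using insert.prems(2)[OF m] insert.hyps by simp
      have 3: "(\<Sum>g \<in> J. c g * (qvar powi ?e g * qvar powi g j)) = - (c g0 * (qvar powi ?e g0 * qvar powi g0 j))"
        using 1 by (simp only: add_eq_0_iff)
      have 4: "(\<Sum>g \<in> J. c g * qvar powi ?e g) = - (c g0 * qvar powi ?e g0)"
        using 2 by (simp only: add_eq_0_iff)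
      have "(\<Sum>g \<in> J. c g * (qvar powi g j - qvar powi g0 j) * qvar powi ?e g) =
        (\<Sum>g \<in> J. c g * (qvar powi ?e g * qvar powi g j)) - qvar powi g0 j * (\<Sum>g \<in> J. c g * qvar powi ?e g)"
        by (simp add: sum_distrib_left sum_subtractf algebra_simps)
      then show "(\<Sum>g \<in> J. c g * (qvar powi g j - qvar powi g0 j) * qvar powi ?e g) = 0"
        unfolding 3 4 by (simp add: algebra_simps)
    qed (use insert.prems in auto)
    then show ?thesis using g j by (auto simp: qvar_powi_inject)
  qed
  obtain m where "m \<in> M" using assms(3) by blast
  from insert.prems(2)[OF this] insert.hyps J have "c g0 = 0" by simp
  with J show ?case by simp
qed simp

section \<open>Characters of the Cartan part\<close>

lemma weight_odd: "\<forall>i \<in> set l. i > 0 \<Longrightarrow> weight (odd_word l) = (\<lambda>f. 0)"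
  by (induction l) auto

lemma weight_diag: "\<forall>p \<in> set w. fst p = snd p \<Longrightarrow> weight w = (\<lambda>f. 0)"
  by (induction w) auto

lemma weight_yw: "S \<subseteq> {1..int n} \<Longrightarrow> weight (yw n S g) = (\<lambda>f. 0)"
proof -
  assume S: "S \<subseteq> {1..int n}"
  then have "finite S" using finite_subset by blast
  moreover have "\<forall>i \<in> S. i > 0" using S by force
  ultimately show ?thesis using weight_odd[of "sorted_list_of_set S"] weight_diag[of "kw n g"] diag_blocks[of _ "[1..int n]" g]
    by (auto simp: yw_def)
qed

lemma even_pw_diag: "\<forall>p \<in> set w. fst p = snd p \<Longrightarrow> even (pw w)"
  by (induction w) auto

lemma sg_diag: "\<forall>p \<in> set w. fst p = snd p \<Longrightarrow> sg w = 1"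
proof (induction w)
  case (Cons p w)
  obtain a where p: "p = (a, a)" using Cons.prems by (cases p) auto
  have "even (neg a * (neg a + 1) + neg a * pw w)" using even_pw_diag[of w] Cons.prems by (auto simp: neg_def)
  then show ?case using Cons by (simp add: p)
qed simp

lemma sg_kw: "sg (u @ kw n g) = sg u"
proof -
  have d: "\<forall>p \<in> set (kw n g). fst p = snd p" using diag_blocks by blast
  show ?thesis using sg_diag[OF d] even_pw_diag[OF d] by (simp add: sg_append minus_one_power_iff)
qed

text \<open>Diagonal words are even, so \<open>g\<close> does not influence the sign. This makes the
  constant in \<open>character_type_conv\<close> independent of \<open>g\<close>.\<close>

lemma split_sign_kw: "split_sign n [] S T g [] = split_sign n [] S T (\<lambda>_. 0) []"
  by (simp add: split_sign_def Let_def col_diag_def row_diag_def sg_kw)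

lemma vec_odd: "i > 0 \<Longrightarrow> s \<noteq> 0 \<Longrightarrow> vec s t ((-i, i) # w) = of_bool (\<bar>s\<bar> = i) * zq * vec (-s) t w"
  by (auto simp: SL_def Ucoef_def Vcoef_def neg_def)

lemma vec_diag_zero: "s \<noteq> t \<Longrightarrow> \<forall>p \<in> set w. fst p = snd p \<Longrightarrow> vec s t w = 0"
proof (induction w)
  case (Cons p w)
  obtain a where "p = (a, a)" using Cons.prems by (cases p) auto
  then show ?case using Cons by (simp only: vec_diag) simp
qed simp

lemma vec_kw:
  assumes "j \<in> {1..int n}"
  shows "vec j j (kw n g) = qvar powi g j"
proof -
  have b: "vec j t (block i z @ w) = qvar powi (of_bool (i = j) * z) * vec j t w" if "i > 0" for i z t w
  proof -
    have "vec j t (replicate m (a, a) @ w) = (qvar powi phi j a) ^ m * vec j t w" for m a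
    proof (induction m)
      case (Suc m)
      have "vec j t (replicate (Suc m) (a, a) @ w) = vec j t ((a, a) # replicate m (a, a) @ w)" by simp
      also have "\<dots> = Acoef j a * vec j t (replicate m (a, a) @ w)" by (rule vec_diag)
      finally show ?case using Suc assms by (simp add: Acoef_def neg_def)
    qed simp
    then show ?thesis using that assms
      by (auto simp: block_def phi_def power_int_def)
  qed
  have "vec j j (blocks l g) = qvar powi (of_bool (j \<in> set l) * g j)" if "distinct l" "\<forall>i \<in> set l. i > 0" for l
    using that
  proof (induction l)
    case (Cons i l)
    have "blocks (i # l) g = block i (g i) @ blocks l g" by (simp add: blocks_def)
    then show ?case using Cons b[of i j "g i" "blocks l g"] by auto
  qed (simp add: blocks_def)
  from this[of "[1..int n]"] show ?thesis using assms by simp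
qed

text \<open>An odd letter \<open>(-i, i)\<close> kills all states except \<open>i\<close> and
  \<open>-i\<close> and exchanges these two. Two different odd letters therefore act by zero, the
  entry \<open>(j, j)\<close> detects the empty odd part, and the entry \<open>(-j, j)\<close>
  detects \<open>{j}\<close>.\<close>

lemma vec_yw:
  assumes S: "S \<subseteq> {1..int n}" and j: "j \<in> {1..int n}"
  shows "vec j j (yw n S g) = of_bool (S = {}) * qvar powi g j"
    "vec (-j) j (yw n S g) = of_bool (S = {j}) * zq * qvar powi g j"
proof -
  have fin: "finite S" using S finite_subset by blast
  let ?l = "sorted_list_of_set S"
  have d: "\<forall>p \<in> set (kw n g). fst p = snd p" using diag_blocks by blast
  have l: "\<forall>i \<in> set ?l. i > 0" "distinct ?l" "set ?l = S" using S fin by auto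
  have 0: "vec s j (odd_word (i # i' # l') @ kw n g) = 0" if "i > 0" "i' > 0" "i \<noteq> i'" "s \<noteq> 0" for s i i' l'
    using that vec_odd[of i s j] vec_odd[of i' "-s" j] by (simp del: vec.simps)
  have 1: "vec s j (odd_word [i] @ kw n g) = of_bool (\<bar>s\<bar> = i) * zq * vec (-s) j (kw n g)" if "i > 0" "s \<noteq> 0" for s i
    using that vec_odd by (simp del: vec.simps)
  have k: "vec (-j) j (kw n g) = 0" using vec_diag_zero[OF _ d, of "-j" j] j by simp
  consider "?l = []" "S = {}" | i where "?l = [i]" "S = {i}" "i > 0"
    | i i' l' where "?l = i # i' # l'" "i > 0" "i' > 0" "i \<noteq> i'" "S \<noteq> {}" "S \<noteq> {j}"
  proof (cases ?l)
    case Nil then show ?thesis using that(1) fin by simp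
  next
    case (Cons i l1)
    then show ?thesis
    proof (cases l1)
      case Nil
      then show ?thesis using that(2)[of i] Cons l by auto
    next
      case (Cons i' l')
      have "i \<in> S" "i' \<in> S" "i \<noteq> i'" using \<open>?l = i # l1\<close> Cons l by auto
      then show ?thesis using that(3)[of i i' l'] \<open>?l = i # l1\<close> Cons l by auto
    qed
  qed
  then have "vec j j (yw n S g) = of_bool (S = {}) * qvar powi g j \<and> vec (-j) j (yw n S g) = of_bool (S = {j}) * zq * qvar powi g j"
  proof cases
    case 1
    then show ?thesis using vec_kw[OF j] k by (simp add: yw_def)
  next
    case (2 i)
    then show ?thesis using 1[of i j] 1[of i "-j"] vec_kw[OF j] k j by (auto simp: yw_def simp del: vec.simps)
  next
    case (3 i i' l')
    then show ?thesis using 0[of i i' j l'] 0[of i i' "-j" l'] j by (simp add: yw_def del: vec.simps)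
  qed
  then show "vec j j (yw n S g) = of_bool (S = {}) * qvar powi g j"
    "vec (-j) j (yw n S g) = of_bool (S = {j}) * zq * qvar powi g j" by auto
qed

lemma yw_gens: "S \<subseteq> {1..int n} \<Longrightarrow> set (yw n S g) \<subseteq> queer_gens n"
proof -
  assume S: "S \<subseteq> {1..int n}"
  then have "finite S" using finite_subset by blast
  then show ?thesis using S gens_blocks[of "[1..int n]" n g] odd_gens by (auto simp: yw_def)
qed

lemma sg_yw: "sg (yw n S g) = 1" if "S \<subseteq> {1..int n}"
proof -
  have "\<forall>i \<in> set l. i > 0 \<Longrightarrow> sg (odd_word l) = 1" for l by (induction l) (auto simp: neg_def)
  moreover have "finite S" using that finite_subset by blast
  moreover have "\<forall>i \<in> S. i > 0" using that by force
  ultimately show ?thesis by (simp add: yw_def sg_kw)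
qed

text \<open>
  On the Cartan words, \<open>h\<close> is concentrated on the odd part \<open>S0\<close> and is there a character of the even part.
\<close>

definition character_type :: "nat \<Rightarrow> int set \<Rightarrow> (int \<Rightarrow> int) \<Rightarrow> (wd \<Rightarrow> cq) \<Rightarrow> bool" where
  "character_type n S0 m h \<longleftrightarrow> annih n h \<and> (\<exists>c. c \<noteq> 0 \<and> (\<forall>S g. S \<subseteq> {1..int n} \<longrightarrow>
     h (yw n S g) = of_bool (S = S0) * (c * qvar powi (\<Sum>i \<in> {1..int n}. m i * g i))))"

lemma character_type_counit: "\<exists>h. character_type n {} (\<lambda>i. 0) h"
proof -
  have "counit n (yw n S g) = of_bool (S = {})" if S: "S \<subseteq> {1..int n}" for S g
  proof -
    have fin: "finite S" using S finite_subset by blast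
    show ?thesis
    proof (cases "S = {}")
      case True
      have "\<forall>(i, j) \<in> set (kw n g). i = j \<and> i \<in> queer_index n"
        using diag_blocks[of _ "[1..int n]" g] gens_blocks[of "[1..int n]" n g] by (fastforce simp: queer_gens_def)
      then show ?thesis using True by (simp add: counit_def yw_def)
    next
      case False
      then obtain i where i: "i \<in> S" by blast
      then have "(-i, i) \<in> set (yw n S g)" using fin by (auto simp: yw_def)
      moreover have "-i \<noteq> i" using i S by auto
      ultimately have "\<not> (\<forall>(a, b) \<in> set (yw n S g). a = b \<and> a \<in> queer_index n)"
        by (auto intro!: bexI[of _ "(-i, i)"])
      then have "counit n (yw n S g) = 0" by (simp add: counit_def)
      then show ?thesis using False by simp
    qed
  qed
  then have "character_type n {} (\<lambda>i. 0) (\<lambda>w. sg w * counit n w)"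
    unfolding character_type_def using rtt_form_annih[OF rtt_form_counit] by (auto simp: sg_yw intro!: exI[of _ 1])
  then show ?thesis by blast
qed

lemma character_type_vec:
  assumes j: "j \<in> {1..int n}"
  shows "\<exists>h. character_type n {} (\<lambda>i. of_bool (i = j)) h" "\<exists>h. character_type n {j} (\<lambda>i. of_bool (i = j)) h"
proof -
  have e: "(\<Sum>i \<in> {1..int n}. of_bool (i = j) * g i) = g j" for g :: "int \<Rightarrow> int"
  proof -
    have "(\<Sum>i \<in> {1..int n}. of_bool (i = j) * g i) = (\<Sum>i \<in> {1..int n}. if i = j then g i else 0)"
      by (intro sum.cong) auto
    then show ?thesis using j by simp
  qed
  have "character_type n {} (\<lambda>i. of_bool (i = j)) (\<lambda>w. sg w * vec_rep n j j w)"
    unfolding character_type_def e using rtt_form_annih[OF rtt_form_vec_rep[of j j n]] j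
    by (auto simp: sg_yw vec_rep_def yw_gens vec_yw intro!: exI[of _ 1])
  then show "\<exists>h. character_type n {} (\<lambda>i. of_bool (i = j)) h" by blast
  have "character_type n {j} (\<lambda>i. of_bool (i = j)) (\<lambda>w. sg w * vec_rep n (-j) j w)"
    unfolding character_type_def e using rtt_form_annih[OF rtt_form_vec_rep[of "-j" j n]] j
    by (auto simp: sg_yw vec_rep_def yw_gens vec_yw intro!: exI[of _ zq])
  then show "\<exists>h. character_type n {j} (\<lambda>i. of_bool (i = j)) h" by blast
qed

text \<open>With \<open>f\<close> cut off to height zero, \<open>conv_triangular\<close> applies
  with empty \<open>x\<close> and \<open>w\<close>. Of the subsets \<open>T\<close> only
  \<open>S2\<close> survives, and the two characters multiply.\<close>

lemma character_type_conv:
  assumes f: "character_type n S1 m1 f" and h: "character_type n S2 m2 h" and S: "S1 \<inter> S2 = {}" "S1 \<union> S2 \<subseteq> {1..int n}"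
  shows "\<exists>h. character_type n (S1 \<union> S2) (\<lambda>i. m1 i + m2 i) h"
proof -
  let ?D = "{1..int n}"
  obtain c1 where c1: "c1 \<noteq> 0" and f1: "\<And>S g. S \<subseteq> ?D \<Longrightarrow> f (yw n S g) = of_bool (S = S1) * (c1 * qvar powi (\<Sum>i \<in> ?D. m1 i * g i))"
    using f by (auto simp: character_type_def)
  obtain c2 where c2: "c2 \<noteq> 0" and h2: "\<And>S g. S \<subseteq> ?D \<Longrightarrow> h (yw n S g) = of_bool (S = S2) * (c2 * qvar powi (\<Sum>i \<in> ?D. m2 i * g i))"
    using h by (auto simp: character_type_def)
  define f0 where "f0 w = of_bool (height w = 0) * f w" for w
  have kf: "annih n f0" unfolding f0_def using f annih_graded[of n f "\<lambda>d. of_bool (d (\<lambda>a. a) = 0)"] by (simp add: character_type_def)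
  have kh: "annih n h" using h by (simp add: character_type_def)
  \<comment> \<open>The power of \<open>qvar\<close> comes from the diagonal letters that the odd
    letters leave behind: \<open>G1\<close> lowers the exponents on \<open>S2\<close>, and
    \<open>G2\<close> raises them on \<open>S1\<close>.\<close>
  define c where "c = split_sign n [] (S1 \<union> S2) S2 (\<lambda>_. 0) [] * c1 * c2 *
     qvar powi (\<Sum>i \<in> ?D. m2 i * of_bool (i \<in> S1) - m1 i * of_bool (i \<in> S2))"
  have "conv n f0 h (yw n S g) = of_bool (S = S1 \<union> S2) * (c * qvar powi (\<Sum>i \<in> ?D. (m1 i + m2 i) * g i))"
    if SD: "S \<subseteq> ?D" for S g
  proof -
    have fin: "finite S" using SD finite_subset by blast
    have trm: "f0 ([] @ yw n (S - T) (G1 n T g [])) * h (yw n T (G2 n (S - T) g []) @ []) =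
      (if T = S2 \<and> S = S1 \<union> S2 then c1 * c2 * qvar powi (\<Sum>i \<in> ?D. m2 i * of_bool (i \<in> S1) - m1 i * of_bool (i \<in> S2))
         * qvar powi (\<Sum>i \<in> ?D. (m1 i + m2 i) * g i) else 0)" if T: "T \<subseteq> S" for T
    proof -
      have ST: "S - T \<subseteq> ?D" "T \<subseteq> ?D" using T SD by auto
      show ?thesis
      proof (cases "T = S2 \<and> S = S1 \<union> S2")
        case True
        then have "S - T = S1" using S by auto
        have "(\<Sum>i \<in> ?D. m1 i * G1 n T g [] i) + (\<Sum>i \<in> ?D. m2 i * G2 n (S - T) g [] i) =
          (\<Sum>i \<in> ?D. m2 i * of_bool (i \<in> S1) - m1 i * of_bool (i \<in> S2)) + (\<Sum>i \<in> ?D. (m1 i + m2 i) * g i)"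
          unfolding sum.distrib[symmetric] G1_def G2_def row_diag_def col_diag_def \<open>S - T = S1\<close>
          by (intro sum.cong) (use True in \<open>auto simp: algebra_simps\<close>)
        from arg_cong[OF this, of "\<lambda>e. qvar powi e"] show ?thesis
          using True \<open>S - T = S1\<close> ST by (simp add: f0_def weight_yw f1 h2 power_int_add)
      next
        case False
        have "of_bool (S - T = S1) * (of_bool (T = S2) :: cq) = 0" using False T by auto
        moreover have "f0 ([] @ yw n (S - T) (G1 n T g [])) * h (yw n T (G2 n (S - T) g []) @ []) =
          (of_bool (S - T = S1) * of_bool (T = S2)) * (c1 * qvar powi (\<Sum>i \<in> ?D. m1 i * G1 n T g [] i) * (c2 * qvar powi (\<Sum>i \<in> ?D. m2 i * G2 n (S - T) g [] i)))"
          using ST by (simp add: f0_def weight_yw f1 h2)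
        ultimately show ?thesis using False by (simp only: mult_zero_left) simp
      qed
    qed
    have "conv n f0 h ([] @ yw n S g @ []) =
      (\<Sum>T \<in> Pow S. split_sign n [] S T g [] * f0 ([] @ yw n (S - T) (G1 n T g [])) * h (yw n T (G2 n (S - T) g []) @ []))"
      by (rule conv_triangular[OF kf _ kh]) (use SD in \<open>auto simp: f0_def minus_words_def plus_words_def\<close>)
    also have "\<dots> = (\<Sum>T \<in> Pow S. if T = S2 then (if S = S1 \<union> S2 then c * qvar powi (\<Sum>i \<in> ?D. (m1 i + m2 i) * g i) else 0) else 0)"
    proof (intro sum.cong refl)
      fix T assume "T \<in> Pow S"
      then have T: "T \<subseteq> S" by simp
      show "split_sign n [] S T g [] * f0 ([] @ yw n (S - T) (G1 n T g [])) * h (yw n T (G2 n (S - T) g []) @ []) =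
        (if T = S2 then (if S = S1 \<union> S2 then c * qvar powi (\<Sum>i \<in> ?D. (m1 i + m2 i) * g i) else 0) else 0)"
        unfolding mult.assoc[of "split_sign n [] S T g []"] trm[OF T] c_def using split_sign_kw[of n S T g] by (simp add: mult.assoc)
    qed
    also have "\<dots> = of_bool (S = S1 \<union> S2) * (c * qvar powi (\<Sum>i \<in> ?D. (m1 i + m2 i) * g i))"
      using fin by auto
    finally show ?thesis by simp
  qed
  moreover have "c \<noteq> 0" using c1 c2 by (simp add: c_def)
  ultimately have "character_type n (S1 \<union> S2) (\<lambda>i. m1 i + m2 i) (conv n f0 h)"
    unfolding character_type_def using annih_conv[OF kf kh] by blast
  then show ?thesis by blast
qed

lemma character_type_exists: "S \<subseteq> {1..int n} \<Longrightarrow> \<exists>m h. character_type n S m h"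
proof -
  assume S: "S \<subseteq> {1..int n}"
  then have "finite S" using finite_subset by blast
  then show ?thesis using S
  proof (induction S)
    case empty
    then show ?case using character_type_counit by blast
  next
    case (insert j S)
    obtain m h where "character_type n S m h" using insert by auto
    moreover obtain h' where "character_type n {j} (\<lambda>i. of_bool (i = j)) h'" using character_type_vec(2)[of j n] insert.prems by auto
    ultimately have "\<exists>h. character_type n ({j} \<union> S) (\<lambda>i. of_bool (i = j) + m i) h"
      using insert by (intro character_type_conv) auto
    then show ?case by auto
  qed
qed

definition zero_index :: "nat \<Rightarrow> (int set \<times> (int \<Rightarrow> int)) set" where
  "zero_index n = {(S, g). S \<subseteq> {1..int n} \<and> g \<in> P_dual n}"

text \<open>Functionals of type \<open>S0\<close> see only the terms with that odd part. Convolution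
  with diagonal entries of the vector representation adds unit vectors to the exponents
  \<open>m\<close> that occur, so \<open>characters_independent\<close> separates the remaining even
  parts.\<close>

theorem zero_indep: "indep n (zero_index n) (\<lambda>(S, g). yw n S g)"
  unfolding indep_def
proof (intro allI impI)
  fix J :: "(int set \<times> (int \<Rightarrow> int)) set" and c
  assume J: "finite J" "J \<subseteq> zero_index n"
    and z: "\<forall>h. annih n h \<longrightarrow> (\<Sum>a \<in> J. c a * h (case a of (S, g) \<Rightarrow> yw n S g)) = 0"
  let ?D = "{1..int n}"
  show "\<forall>a \<in> J. c a = 0"
  proof (clarify)
    fix S0 g0 assume 0: "(S0, g0) \<in> J"
    have S0: "S0 \<subseteq> ?D" using 0 J by (auto simp: zero_index_def)
    let ?J = "{g. (S0, g) \<in> J}"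
    have "\<forall>g \<in> ?J. c (S0, g) = 0"
    proof (rule characters_independent[where M = "{m. \<exists>h. character_type n S0 m h}" and D = ?D])
      have "?J \<subseteq> snd ` J" by (auto intro: rev_image_eqI)
      then show "finite ?J" using J(1) finite_surj by blast
      show "{m. \<exists>h. character_type n S0 m h} \<noteq> {}" using character_type_exists[OF S0] by blast
      show "\<exists>j \<in> ?D. g j \<noteq> g' j" if "g \<in> ?J" "g' \<in> ?J" "g \<noteq> g'" for g g'
      proof (rule ccontr)
        assume "\<not> ?thesis"
        moreover have "g \<in> P_dual n" "g' \<in> P_dual n" using that J(2) by (auto simp: zero_index_def)
        ultimately have "g = g'" unfolding P_dual_def by (meson PiE_ext)
        then show False using that(3) by simp
      qed
      show "m(j := m j + 1) \<in> {m. \<exists>h. character_type n S0 m h}" if m: "m \<in> {m. \<exists>h. character_type n S0 m h}" and j: "j \<in> ?D" for m j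
      proof -
        have *: "(\<lambda>i. m i + of_bool (i = j)) = m(j := m j + 1)" by auto
        obtain h h' where "character_type n S0 m h" "character_type n {} (\<lambda>i. of_bool (i = j)) h'" using m character_type_vec(1)[OF j] by blast
        then have "\<exists>h. character_type n (S0 \<union> {}) (\<lambda>i. m i + of_bool (i = j)) h" using S0 by (intro character_type_conv) auto
        then show ?thesis unfolding * by simp
      qed
      show "(\<Sum>g \<in> ?J. c (S0, g) * qvar powi (\<Sum>i \<in> ?D. m i * g i)) = 0" if "m \<in> {m. \<exists>h. character_type n S0 m h}" for m
      proof -
        from that obtain h where ft: "character_type n S0 m h" by blast
        then have k: "annih n h" by (simp add: character_type_def)
        obtain d where d: "d \<noteq> 0"
          and h: "\<And>S g. S \<subseteq> ?D \<Longrightarrow> h (yw n S g) = of_bool (S = S0) * (d * qvar powi (\<Sum>i \<in> ?D. m i * g i))"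
          using ft by (auto simp: character_type_def)
        have "0 = (\<Sum>a \<in> J. c a * h (case a of (S, g) \<Rightarrow> yw n S g))" using z k by simp
        also have "\<dots> = (\<Sum>a \<in> J. if fst a = S0 then c (S0, snd a) * (d * qvar powi (\<Sum>i \<in> ?D. m i * snd a i)) else 0)"
          using J(2) by (intro sum.cong) (auto simp: zero_index_def h)
        also have "\<dots> = (\<Sum>a \<in> {a \<in> J. fst a = S0}. c (S0, snd a) * (d * qvar powi (\<Sum>i \<in> ?D. m i * snd a i)))"
          using J(1) by (simp add: sum.inter_filter)
        also have "\<dots> = (\<Sum>g \<in> ?J. c (S0, g) * (d * qvar powi (\<Sum>i \<in> ?D. m i * g i)))"
          by (rule sum.reindex_bij_witness[of _ "\<lambda>g. (S0, g)" snd]) auto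
        also have "\<dots> = d * (\<Sum>g \<in> ?J. c (S0, g) * qvar powi (\<Sum>i \<in> ?D. m i * g i))"
          by (simp add: sum_distrib_left algebra_simps)
        finally show ?thesis using d by simp
      qed
    qed simp
    then show "c (S0, g0) = 0" using 0 by blast
  qed
qed

section \<open>Independence of products of two and of three factors\<close>

lemma finite_arg_max:
  assumes "finite A" "A \<noteq> {}"
  shows "\<exists>a \<in> A. \<forall>b \<in> A. (f b :: nat) \<le> f a"
proof -
  have "Max (f ` A) \<in> f ` A" using assms by (intro Max_in) auto
  then obtain a where "a \<in> A" "f a = Max (f ` A)" by auto
  then show ?thesis using assms by (intro bexI[of _ a]) auto
qed

text \<open>The indicator of \<open>m \<ge> i\<close> has its only jump at \<open>i\<close>, so
  pairing the weight with it counts the letters whose column is \<open>i\<close>. Hence the diagonal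
  letters left behind depend on \<open>x\<close> only through its weight, which is what
  \<open>G2_inject\<close> rests on.\<close>

lemma cnt_col_diag: "x \<in> minus_words n \<Longrightarrow> cnt (col_diag x) i = weight x (\<lambda>m. of_bool (m \<ge> i))" if "i > 0"
  using that by (induction x) (auto simp: minus_words_def minus_letter_def col_diag_def)

lemma cnt_row_diag: "w \<in> plus_words n \<Longrightarrow> cnt (row_diag w) i = weight w (\<lambda>m. of_bool (m \<ge> i))" if "i > 0"
  using that by (induction w) (auto simp: plus_words_def plus_letter_def row_diag_def)

lemma height_minus: "x \<in> minus_words n \<Longrightarrow> height x = int (length x)"
  by (induction x) (auto simp: minus_words_def minus_letter_def)

lemma G1_P [simp]: "G1 n T g w \<in> P_dual n" and G2_P [simp]: "G2 n T g x \<in> P_dual n"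
  by (auto simp: G1_def G2_def P_dual_def)

lemma P_dual_eqI: "g \<in> P_dual n \<Longrightarrow> g' \<in> P_dual n \<Longrightarrow> (\<And>i. i \<in> {1..int n} \<Longrightarrow> g i = g' i) \<Longrightarrow> g = g'"
  unfolding P_dual_def by (meson PiE_ext)

lemma G1_inject:
  assumes "G1 n T g w = G1 n T g' w'" "g \<in> P_dual n" "g' \<in> P_dual n" "w \<in> plus_words n" "w' \<in> plus_words n" "weight w = weight w'"
  shows "g = g'"
proof (rule P_dual_eqI[OF assms(2,3)])
  fix i assume i: "i \<in> {1..int n}"
  then have "cnt (row_diag w) i = cnt (row_diag w') i" using assms by (simp add: cnt_row_diag)
  then show "g i = g' i" using fun_cong[OF assms(1), of i] i by (simp add: G1_def)
qed

lemma G2_inject: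
  assumes "G2 n T g x = G2 n T g' x'" "g \<in> P_dual n" "g' \<in> P_dual n" "x \<in> minus_words n" "x' \<in> minus_words n" "weight x = weight x'"
  shows "g = g'"
proof (rule P_dual_eqI[OF assms(2,3)])
  fix i assume i: "i \<in> {1..int n}"
  then have "cnt (col_diag x) i = cnt (col_diag x') i" using assms by (simp add: cnt_col_diag)
  then show "g i = g' i" using fun_cong[OF assms(1), of i] i by (simp add: G2_def)
qed

lemma weq_kw_inverse: "weq n (kw n g @ kw n (\<lambda>i. - g i)) []" "weq n (kw n (\<lambda>i. - g i) @ kw n g) []"
proof -
  have z: "\<forall>p \<in> set (kw n g @ kw n g'). zero_letter n p" for g g'
    using zero_letter_blocks[of "[1..int n]" n] by auto
  have d: "filter (\<lambda>(a, b). a \<noteq> b) (kw n g @ kw n g') = []" for g g'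
    by (rule filter_diag) (auto dest: diag_blocks)
  have 0: "blocks l (\<lambda>i. 0) = []" for l by (induction l) (auto simp: blocks_def block_def)
  have "kw n (cnt (kw n g @ kw n (\<lambda>i. - g i))) = kw n (\<lambda>i. 0)" "kw n (cnt (kw n (\<lambda>i. - g i) @ kw n g)) = kw n (\<lambda>i. 0)"
    by (rule blocks_cong, simp)+
  then show "weq n (kw n g @ kw n (\<lambda>i. - g i)) []" "weq n (kw n (\<lambda>i. - g i) @ kw n g) []"
    using weq_normal_form[OF z[of g "\<lambda>i. - g i"]] weq_normal_form[OF z[of "\<lambda>i. - g i" g]] unfolding d 0 by (simp_all add: 0)
qed

lemma kw_gens: "set (kw n g) \<subseteq> queer_gens n"
  by (rule gens_blocks) simp

lemma yw_empty [simp]: "yw n {} g = kw n g"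
  by (simp add: yw_def)

lemma Nil_words [simp]: "[] \<in> minus_words n" "[] \<in> plus_words n"
  by (simp_all add: minus_words_def plus_words_def)

text \<open>
  Among the words of a fixed weight take \<open>S\<close> of maximal size and put all odd letters into the right factor:
  independence in \<open>U\<^sup>0\<close> then leaves a dependence between elements of \<open>B\<close>, up to a unit on the right.
\<close>

theorem left_indep:
  assumes B: "B \<subseteq> minus_words n" "indep n B (\<lambda>x. x)"
  shows "indep n (B \<times> zero_index n) (\<lambda>(x, S, g). x @ yw n S g)"
  unfolding indep_def
proof (intro allI impI, rule ccontr)
  fix J :: "(wd \<times> int set \<times> (int \<Rightarrow> int)) set" and c
  assume J: "finite J" "J \<subseteq> B \<times> zero_index n"
    and z: "\<forall>h. annih n h \<longrightarrow> (\<Sum>a \<in> J. c a * h (case a of (x, S, g) \<Rightarrow> x @ yw n S g)) = 0"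
    and "\<not> (\<forall>a \<in> J. c a = 0)"
  then obtain a1 where a1: "a1 \<in> J" "c a1 \<noteq> 0" by auto
  define J1 where "J1 = {a \<in> J. c a \<noteq> 0 \<and> weight (fst a) = weight (fst a1)}"
  have "a1 \<in> J1" and fJ1: "finite J1" using J(1) a1 by (simp_all add: J1_def)
  then have "J1 \<noteq> {}" by blast
  from finite_arg_max[OF fJ1 this, of "\<lambda>a. card (fst (snd a))"]
  obtain x0 S0 g0 where a0: "(x0, S0, g0) \<in> J1" and mx: "\<And>x S g. (x, S, g) \<in> J1 \<Longrightarrow> card S \<le> card S0"
    by (metis fst_conv prod_cases3 snd_conv)
  define \<nu> where "\<nu> = weight (fst a1)"
  have J1: "x \<in> B" "x \<in> minus_words n" "S \<subseteq> {1..int n}" "finite S" "g \<in> P_dual n" "weight x = \<nu>" "c (x, S, g) \<noteq> 0"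
    if "(x, S, g) \<in> J1" for x S g
  proof -
    show S: "x \<in> B" "S \<subseteq> {1..int n}" "g \<in> P_dual n" "weight x = \<nu>" "c (x, S, g) \<noteq> 0"
      using that J(2) by (auto simp: J1_def \<nu>_def zero_index_def)
    show "x \<in> minus_words n" using S B by auto
    show "finite S" using S finite_subset by blast
  qed
  \<comment> \<open>One summand for each term and each subset of its odd letters that goes to the
    right; \<open>t\<close> is its right factor and \<open>d\<close> is everything else.\<close>
  define K where "K = (SIGMA a:J1. Pow (fst (snd a)))"
  define t where "t k = (case k of ((x, S, g), T) \<Rightarrow> (T, G2 n (S - T) g x))" for k :: "(wd \<times> int set \<times> (int \<Rightarrow> int)) \<times> int set"
  define d where "d f k = (case k of ((x, S, g), T) \<Rightarrow> c (x, S, g) * split_sign n x S T g [] * f (x @ yw n (S - T) (G1 n T g [])))"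
    for f :: "wd \<Rightarrow> cq" and k :: "(wd \<times> int set \<times> (int \<Rightarrow> int)) \<times> int set"
  have fK: "finite K" unfolding K_def using fJ1 J1(4) by (intro finite_SigmaI) auto
  define X1 where "X1 = {x. (x, S0, g0) \<in> J1}"
  have "finite X1" unfolding X1_def using fJ1 by (rule finite_surj[of J1 _ fst]) (auto intro: rev_image_eqI)
  \<comment> \<open>A right factor with odd part \<open>S0\<close> requires
    \<open>S0 \<subseteq> S\<close>, and maximality gives \<open>S = S0\<close>. As all weights
    agree, equal exponents of the right factor then give \<open>g = g0\<close>, and only
    \<open>x\<close> still varies.\<close>
  have e: "{k \<in> K. t k = (S0, G2 n {} g0 x0)} = (\<lambda>x. ((x, S0, g0), S0)) ` X1"
  proof (intro equalityI subsetI)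
    fix k assume "k \<in> {k \<in> K. t k = (S0, G2 n {} g0 x0)}"
    then obtain x S g where k: "k = ((x, S, g), S0)" "(x, S, g) \<in> J1" "S0 \<subseteq> S" "G2 n (S - S0) g x = G2 n {} g0 x0"
      by (auto simp: K_def t_def)
    have "S = S0" using k(3) mx[OF k(2)] J1(4)[OF k(2)] by (metis card_seteq)
    moreover have "g = g0" using k(4) \<open>S = S0\<close> J1[OF k(2)] J1[OF a0] by (intro G2_inject[of n "{}" g x g0 x0]) auto
    ultimately show "k \<in> (\<lambda>x. ((x, S0, g0), S0)) ` X1" using k by (auto simp: X1_def)
  next
    fix k assume "k \<in> (\<lambda>x. ((x, S0, g0), S0)) ` X1"
    then obtain x where k: "k = ((x, S0, g0), S0)" "(x, S0, g0) \<in> J1" by (auto simp: X1_def)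
    have "G2 n {} g0 x = G2 n {} g0 x0"
      using J1(2,6)[OF k(2)] J1(2,6)[OF a0] by (auto simp: G2_def cnt_col_diag)
    then show "k \<in> {k \<in> K. t k = (S0, G2 n {} g0 x0)}" using k by (auto simp: K_def t_def)
  qed
  have main: "(\<Sum>x \<in> X1. c (x, S0, g0) * split_sign n x S0 S0 g0 [] * f (x @ kw n (G1 n S0 g0 []))) = 0" if f: "annih n f" for f
  proof -
    have "(\<Sum>k \<in> {k \<in> K. t k = (S0, G2 n {} g0 x0)}. d f k) = 0"
    proof (rule indep_regroup[OF zero_indep fK])
      show "t ` K \<subseteq> zero_index n" using J1(3) by (fastforce simp: K_def t_def zero_index_def)
      fix h assume h: "annih n h"
      define f' where "f' u = of_bool (weight u = \<nu>) * f u" for u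
      have f': "annih n f'" unfolding f'_def by (rule annih_graded[OF f])
      \<comment> \<open>The cut-off of \<open>f\<close> keeps all of \<open>x\<close> on the left;
        this second cut-off, of the convolution itself, removes the terms of \<open>J\<close> whose
        \<open>x\<close> has another weight.\<close>
      have annih: "annih n (\<lambda>w. of_bool (weight w = \<nu>) * conv n f' h w)" by (rule annih_graded[OF annih_conv[OF f' h]])
      have coprod: "conv n f' h (x @ yw n S g) = (\<Sum>T \<in> Pow S. split_sign n x S T g [] * f (x @ yw n (S - T) (G1 n T g [])) * h (yw n T (G2 n (S - T) g x)))"
        if a: "(x, S, g) \<in> J1" for x S g
      proof -
        have "conv n f' h (x @ yw n S g @ []) = (\<Sum>T \<in> Pow S. split_sign n x S T g [] * f' (x @ yw n (S - T) (G1 n T g [])) * h (yw n T (G2 n (S - T) g x) @ []))"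
        proof (rule conv_triangular[OF f' _ h])
          fix u assume "f' u \<noteq> 0"
          then have "weight u = weight x" using J1(6)[OF a] by (simp add: f'_def)
          then show "int (length x) \<le> height u" using height_minus[OF J1(2)[OF a]] by simp
        qed (use J1[OF a] in auto)
        also have "\<dots> = (\<Sum>T \<in> Pow S. split_sign n x S T g [] * f (x @ yw n (S - T) (G1 n T g [])) * h (yw n T (G2 n (S - T) g x)))"
        proof (rule sum.cong[OF refl])
          fix T
          have "S - T \<subseteq> {1..int n}" using J1(3)[OF a] by auto
          then show "split_sign n x S T g [] * f' (x @ yw n (S - T) (G1 n T g [])) * h (yw n T (G2 n (S - T) g x) @ []) =
            split_sign n x S T g [] * f (x @ yw n (S - T) (G1 n T g [])) * h (yw n T (G2 n (S - T) g x))"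
            using J1(6)[OF a] by (simp add: f'_def weight_yw)
        qed
        finally show ?thesis by simp
      qed
      have "(\<Sum>k \<in> K. d f k * h (case t k of (S, g) \<Rightarrow> yw n S g)) =
        (\<Sum>a \<in> J1. \<Sum>T \<in> Pow (fst (snd a)). d f (a, T) * h (case t (a, T) of (S, g) \<Rightarrow> yw n S g))"
        unfolding K_def using fJ1 J1(4) by (subst sum.Sigma) auto
      also have "\<dots> = (\<Sum>a \<in> J1. c a * conv n f' h (case a of (x, S, g) \<Rightarrow> x @ yw n S g))"
      proof (rule sum.cong[OF refl], clarify)
        fix x S g assume a: "(x, S, g) \<in> J1"
        show "(\<Sum>T \<in> Pow (fst (snd (x, S, g))). d f ((x, S, g), T) * h (case t ((x, S, g), T) of (S, g) \<Rightarrow> yw n S g)) =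
          c (x, S, g) * conv n f' h (x @ yw n S g)"
          unfolding coprod[OF a] by (simp add: d_def t_def sum_distrib_left mult.assoc)
      qed
      also have "\<dots> = (\<Sum>a \<in> J. c a * (of_bool (weight (case a of (x, S, g) \<Rightarrow> x @ yw n S g) = \<nu>) * conv n f' h (case a of (x, S, g) \<Rightarrow> x @ yw n S g)))"
      proof (rule sum.mono_neutral_cong_left)
        show "\<forall>a \<in> J - J1. c a * (of_bool (weight (case a of (x, S, g) \<Rightarrow> x @ yw n S g) = \<nu>) * conv n f' h (case a of (x, S, g) \<Rightarrow> x @ yw n S g)) = 0"
          using J(2) by (auto simp: J1_def \<nu>_def zero_index_def weight_yw)
      next
        fix a assume "a \<in> J1"
        moreover obtain x S g where "a = (x, S, g)" using prod_cases3 by blast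
        ultimately show "c a * conv n f' h (case a of (x, S, g) \<Rightarrow> x @ yw n S g) =
          c a * (of_bool (weight (case a of (x, S, g) \<Rightarrow> x @ yw n S g) = \<nu>) * conv n f' h (case a of (x, S, g) \<Rightarrow> x @ yw n S g))"
          using J1(3,6) by (simp add: weight_yw)
      qed (use J(1) in \<open>auto simp: J1_def\<close>)
      also have "\<dots> = 0" using z annih by blast
      finally show "(\<Sum>k \<in> K. d f k * h (case t k of (S, g) \<Rightarrow> yw n S g)) = 0" .
    qed
    then show ?thesis unfolding e by (subst (asm) sum.reindex) (auto simp: inj_on_def d_def)
  qed
  have "(\<Sum>x \<in> X1. (c (x, S0, g0) * split_sign n x S0 S0 g0 []) * f x) = 0" if f: "annih n f" for f
  proof -
    \<comment> \<open>All left factors end in the same Cartan word, which is cancelled by its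
      inverse.\<close>
    let ?g = "G1 n S0 g0 []"
    have "f (x @ kw n ?g @ kw n (\<lambda>i. - ?g i)) = f x" if x: "x \<in> X1" for x
    proof -
      have "set x \<subseteq> queer_gens n" using x J1(2) by (auto simp: X1_def minus_words_def)
      from weq_left[OF weq_kw_inverse(1) this, of ?g] show ?thesis using f by (simp add: weq_def)
    qed
    moreover have "annih n (\<lambda>u. f (u @ kw n (\<lambda>i. - ?g i)))" by (rule annih_right[OF f kw_gens])
    from main[OF this] have "(\<Sum>x \<in> X1. c (x, S0, g0) * split_sign n x S0 S0 g0 [] * f (x @ kw n ?g @ kw n (\<lambda>i. - ?g i))) = 0" by simp
    ultimately show ?thesis by simp
  qed
  moreover have "X1 \<subseteq> B" using J1(1) by (auto simp: X1_def)
  ultimately have "\<forall>x \<in> X1. c (x, S0, g0) * split_sign n x S0 S0 g0 [] = 0"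
    using B(2)[unfolded indep_def, rule_format, of X1 "\<lambda>x. c (x, S0, g0) * split_sign n x S0 S0 g0 []"] \<open>finite X1\<close> by blast
  then show False using a0 J1(7) by (auto simp: X1_def)
qed

text \<open>The mirror image of \<open>left_indep\<close>. With \<open>f\<close> cut off to height
  zero there is no minus part; for \<open>S\<close> of maximal size the left factor can carry the
  odd part \<open>S0\<close> only if \<open>S = S0\<close> and all odd letters stay on the left.
  What remains on the right is a word of \<open>W\<close>, up to a Cartan unit on its left.\<close>

theorem right_indep:
  assumes W: "W \<subseteq> plus_words n" "indep n W (\<lambda>w. w)"
  shows "indep n (zero_index n \<times> W) (\<lambda>((S, g), w). yw n S g @ w)"
  unfolding indep_def
proof (intro allI impI, rule ccontr)
  fix J :: "((int set \<times> (int \<Rightarrow> int)) \<times> wd) set" and c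
  assume J: "finite J" "J \<subseteq> zero_index n \<times> W"
    and z: "\<forall>h. annih n h \<longrightarrow> (\<Sum>a \<in> J. c a * h ((\<lambda>((S, g), w). yw n S g @ w) a)) = 0"
    and "\<not> (\<forall>a \<in> J. c a = 0)"
  then obtain a1 where a1: "a1 \<in> J" "c a1 \<noteq> 0" by auto
  define J1 where "J1 = {a \<in> J. c a \<noteq> 0 \<and> weight (snd a) = weight (snd a1)}"
  have "a1 \<in> J1" and fJ1: "finite J1" using J(1) a1 by (simp_all add: J1_def)
  then have "J1 \<noteq> {}" by blast
  from finite_arg_max[OF fJ1 this, of "\<lambda>a. card (fst (fst a))"]
  obtain S0 g0 w0 where a0: "((S0, g0), w0) \<in> J1" and mx: "\<And>w S g. ((S, g), w) \<in> J1 \<Longrightarrow> card S \<le> card S0"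
    by (metis fst_conv surj_pair)
  define \<nu> where "\<nu> = weight (snd a1)"
  have J1: "w \<in> W" "w \<in> plus_words n" "S \<subseteq> {1..int n}" "finite S" "g \<in> P_dual n" "weight w = \<nu>" "c ((S, g), w) \<noteq> 0"
    if "((S, g), w) \<in> J1" for w S g
  proof -
    show S: "w \<in> W" "S \<subseteq> {1..int n}" "g \<in> P_dual n" "weight w = \<nu>" "c ((S, g), w) \<noteq> 0"
      using that J(2) by (auto simp: J1_def \<nu>_def zero_index_def)
    show "w \<in> plus_words n" using S W by auto
    show "finite S" using S finite_subset by blast
  qed
  define K where "K = (SIGMA a:J1. Pow (fst (fst a)))"
  define t where "t k = (case k of (((S, g), w), T) \<Rightarrow> (S - T, G1 n T g w))" for k :: "((int set \<times> (int \<Rightarrow> int)) \<times> wd) \<times> int set"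
  define d where "d h k = (case k of (((S, g), w), T) \<Rightarrow> c ((S, g), w) * split_sign n [] S T g w * h (yw n T (G2 n (S - T) g []) @ w))"
    for h :: "wd \<Rightarrow> cq" and k :: "((int set \<times> (int \<Rightarrow> int)) \<times> wd) \<times> int set"
  have fK: "finite K" unfolding K_def using fJ1 J1(4) by (intro finite_SigmaI) auto
  define W1 where "W1 = {w. ((S0, g0), w) \<in> J1}"
  have "finite W1" unfolding W1_def using fJ1 by (rule finite_surj[of J1 _ snd]) (auto intro: rev_image_eqI)
  have e: "{k \<in> K. t k = (S0, G1 n {} g0 w0)} = (\<lambda>w. (((S0, g0), w), {} :: int set)) ` W1"
  proof (intro equalityI subsetI)
    fix k assume "k \<in> {k \<in> K. t k = (S0, G1 n {} g0 w0)}"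
    then obtain w S g T where k: "k = (((S, g), w), T)" "((S, g), w) \<in> J1" "T \<subseteq> S" "S - T = S0" "G1 n T g w = G1 n {} g0 w0"
      by (auto simp: K_def t_def)
    have "S0 = S" using k(4) mx[OF k(2)] J1(4)[OF k(2)] card_seteq[of S S0] by auto
    then have "T = {}" using k by auto
    moreover have "g = g0" using k(5) \<open>T = {}\<close> J1[OF k(2)] J1[OF a0] by (intro G1_inject[of n "{}" g w g0 w0]) auto
    ultimately show "k \<in> (\<lambda>w. (((S0, g0), w), {} :: int set)) ` W1" using k \<open>S0 = S\<close> by (auto simp: W1_def)
  next
    fix k assume "k \<in> (\<lambda>w. (((S0, g0), w), {} :: int set)) ` W1"
    then obtain w where k: "k = (((S0, g0), w), {})" "((S0, g0), w) \<in> J1" by (auto simp: W1_def)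
    have "G1 n {} g0 w = G1 n {} g0 w0"
      using J1(2,6)[OF k(2)] J1(2,6)[OF a0] by (auto simp: G1_def cnt_row_diag)
    then show "k \<in> {k \<in> K. t k = (S0, G1 n {} g0 w0)}" using k by (auto simp: K_def t_def)
  qed
  have main: "(\<Sum>w \<in> W1. c ((S0, g0), w) * split_sign n [] S0 {} g0 w * h (kw n (G2 n S0 g0 []) @ w)) = 0" if h: "annih n h" for h
  proof -
    have "(\<Sum>k \<in> {k \<in> K. t k = (S0, G1 n {} g0 w0)}. d h k) = 0"
    proof (rule indep_regroup[OF zero_indep fK])
      show "t ` K \<subseteq> zero_index n" using J1(3) by (fastforce simp: K_def t_def zero_index_def)
      fix f assume f: "annih n f"
      define f' where "f' u = of_bool (height u = 0) * f u" for u
      have f': "annih n f'" unfolding f'_def by (rule annih_graded[OF f, of "\<lambda>d. of_bool (d (\<lambda>a. a) = 0)"])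
      have annih: "annih n (\<lambda>w. of_bool (weight w = \<nu>) * conv n f' h w)" by (rule annih_graded[OF annih_conv[OF f' h]])
      have coprod: "conv n f' h (yw n S g @ w) = (\<Sum>T \<in> Pow S. split_sign n [] S T g w * f (yw n (S - T) (G1 n T g w)) * h (yw n T (G2 n (S - T) g []) @ w))"
        if a: "((S, g), w) \<in> J1" for w S g
      proof -
        have "conv n f' h ([] @ yw n S g @ w) = (\<Sum>T \<in> Pow S. split_sign n [] S T g w * f' ([] @ yw n (S - T) (G1 n T g w)) * h (yw n T (G2 n (S - T) g []) @ w))"
        proof (rule conv_triangular[OF f' _ h])
          fix u assume "f' u \<noteq> 0"
          then show "int (length ([] :: wd)) \<le> height u" by (simp add: f'_def)
        qed (use J1[OF a] in auto)
        also have "\<dots> = (\<Sum>T \<in> Pow S. split_sign n [] S T g w * f (yw n (S - T) (G1 n T g w)) * h (yw n T (G2 n (S - T) g []) @ w))"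
        proof (rule sum.cong[OF refl])
          fix T
          have "S - T \<subseteq> {1..int n}" using J1(3)[OF a] by auto
          then show "split_sign n [] S T g w * f' ([] @ yw n (S - T) (G1 n T g w)) * h (yw n T (G2 n (S - T) g []) @ w) =
            split_sign n [] S T g w * f (yw n (S - T) (G1 n T g w)) * h (yw n T (G2 n (S - T) g []) @ w)"
            by (simp add: f'_def weight_yw)
        qed
        finally show ?thesis by simp
      qed
      have "(\<Sum>k \<in> K. d h k * f (case t k of (S, g) \<Rightarrow> yw n S g)) =
        (\<Sum>a \<in> J1. \<Sum>T \<in> Pow (fst (fst a)). d h (a, T) * f (case t (a, T) of (S, g) \<Rightarrow> yw n S g))"
        unfolding K_def using fJ1 J1(4) by (subst sum.Sigma) auto
      also have "\<dots> = (\<Sum>a \<in> J1. c a * conv n f' h ((\<lambda>((S, g), w). yw n S g @ w) a))"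
      proof (rule sum.cong[OF refl], clarify)
        fix w S g assume a: "((S, g), w) \<in> J1"
        show "(\<Sum>T \<in> Pow (fst (fst ((S, g), w))). d h (((S, g), w), T) * f (case t (((S, g), w), T) of (S, g) \<Rightarrow> yw n S g)) =
          c ((S, g), w) * conv n f' h (yw n S g @ w)"
          unfolding coprod[OF a] by (simp add: d_def t_def sum_distrib_left mult.assoc mult.left_commute mult.commute)
      qed
      also have "\<dots> = (\<Sum>a \<in> J. c a * (of_bool (weight ((\<lambda>((S, g), w). yw n S g @ w) a) = \<nu>) * conv n f' h ((\<lambda>((S, g), w). yw n S g @ w) a)))"
      proof (rule sum.mono_neutral_cong_left)
        show "\<forall>a \<in> J - J1. c a * (of_bool (weight ((\<lambda>((S, g), w). yw n S g @ w) a) = \<nu>) * conv n f' h ((\<lambda>((S, g), w). yw n S g @ w) a)) = 0"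
          using J(2) by (auto simp: J1_def \<nu>_def zero_index_def weight_yw)
      next
        fix a assume "a \<in> J1"
        moreover obtain w S g where "a = ((S, g), w)" by (metis surj_pair)
        ultimately show "c a * conv n f' h ((\<lambda>((S, g), w). yw n S g @ w) a) =
          c a * (of_bool (weight ((\<lambda>((S, g), w). yw n S g @ w) a) = \<nu>) * conv n f' h ((\<lambda>((S, g), w). yw n S g @ w) a))"
          using J1(3,6) by (simp add: weight_yw)
      qed (use J(1) in \<open>auto simp: J1_def\<close>)
      also have "\<dots> = 0" using z annih by blast
      finally show "(\<Sum>k \<in> K. d h k * f (case t k of (S, g) \<Rightarrow> yw n S g)) = 0" .
    qed
    then show ?thesis unfolding e by (subst (asm) sum.reindex) (auto simp: inj_on_def d_def)
  qed
  have "(\<Sum>w \<in> W1. (c ((S0, g0), w) * split_sign n [] S0 {} g0 w) * h w) = 0" if h: "annih n h" for h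
  proof -
    let ?g = "G2 n S0 g0 []"
    have "h (kw n (\<lambda>i. - ?g i) @ kw n ?g @ w) = h w" if w: "w \<in> W1" for w
    proof -
      have "set w \<subseteq> queer_gens n" using w J1(2) by (auto simp: W1_def plus_words_def)
      from weq_right[OF weq_kw_inverse(2) this, of ?g] show ?thesis using h by (simp add: weq_def)
    qed
    moreover have "annih n (\<lambda>u. h (kw n (\<lambda>i. - ?g i) @ u))" by (rule annih_left[OF h kw_gens])
    from main[OF this] have "(\<Sum>w \<in> W1. c ((S0, g0), w) * split_sign n [] S0 {} g0 w * h (kw n (\<lambda>i. - ?g i) @ kw n ?g @ w)) = 0" by simp
    ultimately show ?thesis by simp
  qed
  moreover have "W1 \<subseteq> W" using J1(1) by (auto simp: W1_def)
  ultimately have "\<forall>w \<in> W1. c ((S0, g0), w) * split_sign n [] S0 {} g0 w = 0"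
    using W(2)[unfolded indep_def, rule_format, of W1 "\<lambda>w. c ((S0, g0), w) * split_sign n [] S0 {} g0 w"] \<open>finite W1\<close> by blast
  then show False using a0 J1(7) by (auto simp: W1_def)
qed

text \<open>
  The terms with \<open>x\<close> of maximal length survive convolution with an \<open>f\<close> supported in that height.  Collecting those
  with a fixed left factor \<open>x y'\<close> is allowed by \<open>left_indep\<close> and leaves a dependence excluded by \<open>right_indep\<close>.
\<close>

theorem triangular_indep:
  assumes B: "B \<subseteq> minus_words n" "indep n B (\<lambda>x. x)" and W: "W \<subseteq> plus_words n" "indep n W (\<lambda>w. w)"
  shows "indep n (B \<times> zero_index n \<times> W) (\<lambda>(x, (S, g), w). x @ yw n S g @ w)"
  unfolding indep_def
proof (intro allI impI, rule ccontr)
  fix J :: "(wd \<times> (int set \<times> (int \<Rightarrow> int)) \<times> wd) set" and c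
  let ?y = "\<lambda>(x, (S, g), w). x @ yw n S g @ w"
  assume J: "finite J" "J \<subseteq> B \<times> zero_index n \<times> W"
    and z: "\<forall>h. annih n h \<longrightarrow> (\<Sum>a \<in> J. c a * h (?y a)) = 0"
    and "\<not> (\<forall>a \<in> J. c a = 0)"
  then have "finite {a \<in> J. c a \<noteq> 0}" "{a \<in> J. c a \<noteq> 0} \<noteq> {}" by auto
  from finite_arg_max[OF this, of "\<lambda>a. length (fst a)"]
  obtain x0 S0 g0 w0 where a0: "(x0, (S0, g0), w0) \<in> J" "c (x0, (S0, g0), w0) \<noteq> 0"
    and mx: "\<And>a. a \<in> J \<Longrightarrow> c a \<noteq> 0 \<Longrightarrow> length (fst a) \<le> length x0"
    by (auto simp: Bex_def) blast
  define N where "N = length x0"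
  define J1 where "J1 = {a \<in> J. c a \<noteq> 0 \<and> length (fst a) = N}"
  have fJ1: "finite J1" using J(1) by (simp add: J1_def)
  have a01: "(x0, (S0, g0), w0) \<in> J1" using a0 by (simp add: J1_def N_def)
  have JX: "x \<in> B" "x \<in> minus_words n" "S \<subseteq> {1..int n}" "finite S" "g \<in> P_dual n" "w \<in> W" "w \<in> plus_words n"
    if "(x, (S, g), w) \<in> J" for x S g w
  proof -
    show S: "x \<in> B" "S \<subseteq> {1..int n}" "g \<in> P_dual n" "w \<in> W"
      using that J(2) by (auto simp: zero_index_def)
    show "x \<in> minus_words n" "w \<in> plus_words n" using S B W by auto
    show "finite S" using S finite_subset by blast
  qed
  have J1: "x \<in> B" "x \<in> minus_words n" "S \<subseteq> {1..int n}" "finite S" "g \<in> P_dual n" "w \<in> W" "w \<in> plus_words n" "length x = N"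
    if "(x, (S, g), w) \<in> J1" for x S g w
    using JX[of x S g w] that by (auto simp: J1_def)
  define K where "K = (SIGMA a:J1. Pow (fst (fst (snd a))))"
  define t where "t k = (case k of ((x, (S, g), w), T) \<Rightarrow> (x, S - T, G1 n T g w))"
    for k :: "(wd \<times> (int set \<times> (int \<Rightarrow> int)) \<times> wd) \<times> int set"
  define d where "d h k = (case k of ((x, (S, g), w), T) \<Rightarrow> c (x, (S, g), w) * split_sign n x S T g w * h (yw n T (G2 n (S - T) g x) @ w))"
    for h :: "wd \<Rightarrow> cq" and k :: "(wd \<times> (int set \<times> (int \<Rightarrow> int)) \<times> wd) \<times> int set"
  have fK: "finite K" unfolding K_def using fJ1 J1(4) by (intro finite_SigmaI) auto
  let ?g1 = "G1 n S0 g0 w0"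
  \<comment> \<open>The summands whose left factor is \<open>x0\<close> times an even Cartan word
    with exponents \<open>?g1\<close>. All odd letters have gone to the right, so \<open>S\<close>
    may still vary, and the next relation is one between products \<open>y w\<close>.\<close>
  define K1 where "K1 = {(S, g, w). (x0, (S, g), w) \<in> J1 \<and> G1 n S g w = ?g1}"
  have fK1: "finite K1"
    by (rule finite_surj[OF fJ1, of _ "\<lambda>(x, (S, g), w). (S, g, w)"]) (auto simp: K1_def intro: rev_image_eqI)
  have e: "{k \<in> K. t k = (x0, {}, ?g1)} = (\<lambda>(S, g, w). ((x0, (S, g), w), S)) ` K1"
  proof (intro equalityI subsetI)
    fix k assume "k \<in> {k \<in> K. t k = (x0, {}, ?g1)}"
    then obtain S g w T where k: "k = ((x0, (S, g), w), T)" "(x0, (S, g), w) \<in> J1" "T \<subseteq> S" "S - T = {}" "G1 n T g w = ?g1"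
      by (auto simp: K_def t_def)
    have "T = S" using k by auto
    then have "(S, g, w) \<in> K1" using k by (simp add: K1_def)
    then show "k \<in> (\<lambda>(S, g, w). ((x0, (S, g), w), S)) ` K1" unfolding k(1) \<open>T = S\<close> by (intro rev_image_eqI) auto
  next
    fix k assume "k \<in> (\<lambda>(S, g, w). ((x0, (S, g), w), S)) ` K1"
    then show "k \<in> {k \<in> K. t k = (x0, {}, ?g1)}" by (auto simp: K1_def K_def t_def)
  qed
  have main: "(\<Sum>(S, g, w) \<in> K1. c (x0, (S, g), w) * split_sign n x0 S S g w * h (yw n S (G2 n {} g x0) @ w)) = 0" if h: "annih n h" for h
  proof -
    have "(\<Sum>k \<in> {k \<in> K. t k = (x0, {}, ?g1)}. d h k) = 0"
    proof (rule indep_regroup[OF left_indep[OF B] fK])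
      show "t ` K \<subseteq> B \<times> zero_index n" using J1(1,3) by (fastforce simp: K_def t_def zero_index_def)
      fix f assume f: "annih n f"
      define f' where "f' u = of_bool (height u = int N) * f u" for u
      have f': "annih n f'" unfolding f'_def by (rule annih_graded[OF f, of "\<lambda>d. of_bool (d (\<lambda>a. a) = int N)"])
      have coprod: "conv n f' h (x @ yw n S g @ w) = (\<Sum>T \<in> Pow S. split_sign n x S T g w * f (x @ yw n (S - T) (G1 n T g w)) * h (yw n T (G2 n (S - T) g x) @ w))"
        if a: "(x, (S, g), w) \<in> J1" for x w S g
      proof -
        have "conv n f' h (x @ yw n S g @ w) = (\<Sum>T \<in> Pow S. split_sign n x S T g w * f' (x @ yw n (S - T) (G1 n T g w)) * h (yw n T (G2 n (S - T) g x) @ w))"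
        proof (rule conv_triangular[OF f' _ h])
          fix u assume "f' u \<noteq> 0"
          then show "int (length x) \<le> height u" using J1(8)[OF a] by (auto simp: f'_def)
        qed (use J1[OF a] in auto)
        also have "\<dots> = (\<Sum>T \<in> Pow S. split_sign n x S T g w * f (x @ yw n (S - T) (G1 n T g w)) * h (yw n T (G2 n (S - T) g x) @ w))"
        proof (rule sum.cong[OF refl])
          fix T
          have "S - T \<subseteq> {1..int n}" using J1(3)[OF a] by auto
          then show "split_sign n x S T g w * f' (x @ yw n (S - T) (G1 n T g w)) * h (yw n T (G2 n (S - T) g x) @ w) =
            split_sign n x S T g w * f (x @ yw n (S - T) (G1 n T g w)) * h (yw n T (G2 n (S - T) g x) @ w)"
            using height_minus[OF J1(2)[OF a]] J1(8)[OF a] by (simp add: f'_def weight_yw)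
        qed
        finally show ?thesis .
      qed
      have "(\<Sum>k \<in> K. d h k * f (case t k of (x, S, g) \<Rightarrow> x @ yw n S g)) =
        (\<Sum>a \<in> J1. \<Sum>T \<in> Pow (fst (fst (snd a))). d h (a, T) * f (case t (a, T) of (x, S, g) \<Rightarrow> x @ yw n S g))"
        unfolding K_def using fJ1 J1(4) by (subst sum.Sigma) auto
      also have "\<dots> = (\<Sum>a \<in> J1. c a * conv n f' h (?y a))"
      proof (rule sum.cong[OF refl], clarify)
        fix x w S g assume a: "(x, (S, g), w) \<in> J1"
        show "(\<Sum>T \<in> Pow (fst (fst (snd (x, (S, g), w)))). d h ((x, (S, g), w), T) * f (case t ((x, (S, g), w), T) of (x, S, g) \<Rightarrow> x @ yw n S g)) =
          c (x, (S, g), w) * conv n f' h (x @ yw n S g @ w)"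
          unfolding coprod[OF a] by (simp add: d_def t_def sum_distrib_left mult.assoc mult.left_commute mult.commute)
      qed
      also have "\<dots> = (\<Sum>a \<in> J. c a * conv n f' h (?y a))"
      proof (rule sum.mono_neutral_left)
        show "\<forall>a \<in> J - J1. c a * conv n f' h (?y a) = 0"
        proof (clarify)
          fix x S g w assume a: "(x, (S, g), w) \<in> J" "(x, (S, g), w) \<notin> J1"
          show "c (x, (S, g), w) * conv n f' h (x @ yw n S g @ w) = 0"
          proof (cases "c (x, (S, g), w) = 0")
            case False
            then have "length x < N" using a mx[OF a(1)] by (auto simp: J1_def N_def)
            then have "conv n f' h (x @ yw n S g @ w) = 0"
              using JX[OF a(1)] by (intro conv_low[OF f' _ h]) (auto simp: f'_def)
            then show ?thesis by simp
          qed simp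
        qed
      qed (use J(1) in \<open>auto simp: J1_def\<close>)
      also have "\<dots> = 0" using z annih_conv[OF f' h] by blast
      finally show "(\<Sum>k \<in> K. d h k * f (case t k of (x, S, g) \<Rightarrow> x @ yw n S g)) = 0" .
    qed
    then show ?thesis unfolding e by (subst (asm) sum.reindex) (auto simp: inj_on_def d_def case_prod_beta)
  qed
  \<comment> \<open>For fixed \<open>x0\<close> the exponents \<open>G2\<close> determine
    \<open>g\<close>, so over the right factor of the chosen term lies that term alone.\<close>
  define t1 where "t1 k = (case k of (S, g, w) \<Rightarrow> ((S, G2 n {} g x0), w))" for k :: "int set \<times> (int \<Rightarrow> int) \<times> wd"
  define c1 where "c1 k = (case k of (S, g, w) \<Rightarrow> c (x0, (S, g), w) * split_sign n x0 S S g w)" for k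
  have "(\<Sum>k \<in> {k \<in> K1. t1 k = ((S0, G2 n {} g0 x0), w0)}. c1 k) = 0"
  proof (rule indep_regroup[OF right_indep[OF W] fK1])
    show "t1 ` K1 \<subseteq> zero_index n \<times> W" using J1(3,6) by (fastforce simp: K1_def t1_def zero_index_def)
    fix h assume "annih n h"
    from main[OF this] show "(\<Sum>k \<in> K1. c1 k * h ((\<lambda>((S, g), w). yw n S g @ w) (t1 k))) = 0"
      by (simp add: case_prod_beta c1_def t1_def)
  qed
  moreover have "{k \<in> K1. t1 k = ((S0, G2 n {} g0 x0), w0)} = {(S0, g0, w0)}"
  proof (intro equalityI subsetI)
    fix k assume k: "k \<in> {k \<in> K1. t1 k = ((S0, G2 n {} g0 x0), w0)}"
    then obtain g where "k = (S0, g, w0)" "(x0, (S0, g), w0) \<in> J1" "G2 n {} g x0 = G2 n {} g0 x0" by (auto simp: K1_def t1_def)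
    then show "k \<in> {(S0, g0, w0)}" using G2_inject[of n "{}" g x0 g0 x0] J1 J1[OF a01] by auto
  qed (use a01 in \<open>auto simp: K1_def t1_def\<close>)
  ultimately show False using a0 by (simp add: c1_def)
qed

section \<open>Spanning by triangular products\<close>

text \<open>With the ideal included, these are the preimages of the subspaces of the algebra that
  words span, and rewriting can be carried out in the free algebra.\<close>

definition Sp :: "nat \<Rightarrow> wd set \<Rightarrow> queer_free set" where
  "Sp n A = fv.span (wmon ` A \<union> queer_ideal n)"

lemma Sp_word: "a \<in> A \<Longrightarrow> wmon a \<in> Sp n A"
  and Sp_ideal: "p \<in> queer_ideal n \<Longrightarrow> p \<in> Sp n A"
  and Sp_add: "p \<in> Sp n A \<Longrightarrow> q \<in> Sp n A \<Longrightarrow> p + q \<in> Sp n A"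
  and Sp_diff: "p \<in> Sp n A \<Longrightarrow> q \<in> Sp n A \<Longrightarrow> p - q \<in> Sp n A"
  and Sp_scal: "p \<in> Sp n A \<Longrightarrow> scal c p \<in> Sp n A"
  and Sp_zero: "0 \<in> Sp n A"
  unfolding Sp_def by (auto intro: fv.span_base fv.span_add fv.span_scale fv.span_diff fv.span_zero)

lemma Sp_minimal:
  assumes "p \<in> Sp n A" "\<And>a. a \<in> A \<Longrightarrow> wmon a \<in> M" "queer_ideal n \<subseteq> M" "fv.subspace M"
  shows "p \<in> M"
  using assms fv.span_minimal[of "wmon ` A \<union> queer_ideal n" M] unfolding Sp_def by auto

lemma Sp_subspace: "fv.subspace (Sp n A)"
  unfolding Sp_def by (rule fv.subspace_span)

lemma Sp_trans: "p \<in> Sp n A \<Longrightarrow> (\<And>a. a \<in> A \<Longrightarrow> wmon a \<in> Sp n B) \<Longrightarrow> p \<in> Sp n B"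
  by (rule Sp_minimal[OF _ _ _ Sp_subspace]) (auto intro: Sp_ideal)

lemma Sp_mono: "p \<in> Sp n A \<Longrightarrow> A \<subseteq> B \<Longrightarrow> p \<in> Sp n B"
  by (rule Sp_trans) (auto intro: Sp_word)

lemma Sp_app:
  assumes "p \<in> Sp n A" "\<And>a. a \<in> A \<Longrightarrow> wmon (u @ a @ v) \<in> Sp n B" "set u \<subseteq> queer_gens n" "set v \<subseteq> queer_gens n"
  shows "wmon u * p * wmon v \<in> Sp n B"
proof -
  let ?M = "{p. wmon u * p * wmon v \<in> Sp n B}"
  have "p \<in> ?M"
  proof (rule Sp_minimal[OF assms(1)])
    show "wmon a \<in> ?M" if "a \<in> A" for a using assms(2)[OF that] by (simp add: mon_append mult.assoc)
    show "queer_ideal n \<subseteq> ?M" using assms(3,4) by (auto intro!: Sp_ideal ideal_mult_right[OF ideal_mult_left])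
    show "fv.subspace ?M"
      by (auto simp: fv.subspace_def algebra_simps mult_scal_left mult_scal_right intro: Sp_add Sp_scal Sp_zero)
  qed
  then show ?thesis by simp
qed

lemma Sp_word_app:
  assumes "wmon w \<in> Sp n A" "\<And>a. a \<in> A \<Longrightarrow> wmon (u @ a @ v) \<in> Sp n B" "set u \<subseteq> queer_gens n" "set v \<subseteq> queer_gens n"
  shows "wmon (u @ w @ v) \<in> Sp n B"
  using Sp_app[OF assms] by (simp add: mon_append mult.assoc)

lemma Sp_weq: "weq n w w' \<Longrightarrow> wmon w' \<in> Sp n A \<Longrightarrow> wmon w \<in> Sp n A"
  using Sp_add[of "wmon w - wmon w'" n A "wmon w'"] by (simp add: weq_ideal Sp_ideal)

lemma Sp_annih:
  assumes "\<And>h. annih n h \<Longrightarrow> c * h w = lin h q" "c \<noteq> 0" "q \<in> Sp n A"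
  shows "wmon w \<in> Sp n A"
proof -
  have "scal c (wmon w) - q \<in> queer_ideal n" using assms(1) by (simp add: ideal_iff_annih)
  then have "scal c (wmon w) \<in> Sp n A" using Sp_add[OF Sp_ideal assms(3), of "scal c (wmon w) - q"] by simp
  from Sp_scal[OF this, of "inverse c"] show ?thesis using assms(2) by (simp add: scal_algebra)
qed

lemma Sp_scal_if: "(c \<noteq> 0 \<Longrightarrow> a \<in> A) \<Longrightarrow> scal c (wmon a) \<in> Sp n A"
  by (cases "c = 0") (auto simp: scal_algebra Sp_zero intro: Sp_scal Sp_word)

text \<open>The two ways of solving the defining relation for \<open>L\<^sub>i\<^sub>j L\<^sub>k\<^sub>l\<close>.\<close>

lemma straighten_left:
  assumes g: "(i, j) \<in> queer_gens n" "(k, l) \<in> queer_gens n"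
    and "[(k, l), (i, j)] \<in> A"
    and "(k \<le> j \<and> j < l) \<noteq> (k < i \<and> i \<le> l) \<Longrightarrow> [(i, l), (k, j)] \<in> A"
    and "i \<le> -l \<and> -l < j \<and> j \<le> -k \<Longrightarrow> [(i, -l), (k, -j)] \<in> A"
    and "-l \<le> i \<and> i < -k \<and> -k \<le> j \<Longrightarrow> [(-i, l), (-k, j)] \<in> A"
  shows "wmon [(i, j), (k, l)] \<in> Sp n A"
proof (rule Sp_annih)
  \<comment> \<open>The exchange terms of both sides are multiples of the same word, so only the
    difference of their brackets matters; this is the origin of the inequation in the
    hypothesis.\<close>
  let ?q = "scal (qvar powi phi i k) (wmon [(k, l), (i, j)])
    + scal ((of_bool (k < i \<and> i \<le> l) - of_bool (k \<le> j \<and> j < l)) * of_int (theta i j k) * zq) (wmon [(i, l), (k, j)])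
    - scal (of_bool (i \<le> -l \<and> -l < j \<and> j \<le> -k) * of_int (theta (-i) (-j) k) * zq) (wmon [(i, -l), (k, -j)])
    + scal (of_bool (-l \<le> i \<and> i < -k \<and> -k \<le> j) * of_int (theta (-i) (-j) k) * zq) (wmon [(-i, l), (-k, j)])"
  show "(-1) ^ (parity i j * parity k l) * qvar powi phi j l * h [(i, j), (k, l)] = lin h ?q" if "annih n h" for h
    using annih_relator[OF that g] by (simp add: algebra_simps del: of_bool_conj)
  show "(-1) ^ (parity i j * parity k l) * qvar powi phi j l \<noteq> 0" by simp
  show "?q \<in> Sp n A" by (intro Sp_add Sp_diff Sp_scal_if assms(3-)) (auto simp: of_bool_def split: if_splits)
qed

lemma straighten_right:
  assumes g: "(i, j) \<in> queer_gens n" "(k, l) \<in> queer_gens n"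
    and "[(k, l), (i, j)] \<in> A"
    and "(i \<le> l \<and> l < j) \<noteq> (i < k \<and> k \<le> j) \<Longrightarrow> [(k, j), (i, l)] \<in> A"
    and "k \<le> -j \<and> -j < l \<and> l \<le> -i \<Longrightarrow> [(k, -j), (i, -l)] \<in> A"
    and "-j \<le> k \<and> k < -i \<and> -i \<le> l \<Longrightarrow> [(-k, j), (-i, l)] \<in> A"
  shows "wmon [(i, j), (k, l)] \<in> Sp n A"
proof (rule Sp_annih)
  let ?q = "scal ((-1) ^ (parity k l * parity i j) * qvar powi phi l j) (wmon [(k, l), (i, j)])
    + scal ((of_bool (i \<le> l \<and> l < j) - of_bool (i < k \<and> k \<le> j)) * of_int (theta k l i) * zq) (wmon [(k, j), (i, l)])
    + scal (of_bool (k \<le> -j \<and> -j < l \<and> l \<le> -i) * of_int (theta (-k) (-l) i) * zq) (wmon [(k, -j), (i, -l)])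
    - scal (of_bool (-j \<le> k \<and> k < -i \<and> -i \<le> l) * of_int (theta (-k) (-l) i) * zq) (wmon [(-k, j), (-i, l)])"
  show "qvar powi phi k i * h [(i, j), (k, l)] = lin h ?q" if "annih n h" for h
    using annih_relator[OF that g(2,1)] by (simp add: algebra_simps del: of_bool_conj)
  show "qvar powi phi k i \<noteq> 0" by simp
  show "?q \<in> Sp n A" by (intro Sp_add Sp_diff Sp_scal_if assms(3-)) (auto simp: of_bool_def split: if_splits)
qed

section \<open>Exchanging letters of different kinds\<close>

definition mlet :: "nat \<Rightarrow> (int \<times> int) set" where
  "mlet n = {p \<in> queer_gens n. minus_letter p}"

definition plet :: "nat \<Rightarrow> (int \<times> int) set" where
  "plet n = {p \<in> queer_gens n. plus_letter p}"

definition zlet :: "nat \<Rightarrow> (int \<times> int) set" where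
  "zlet n = {p. zero_letter n p}"

lemma mlet_iff: "(i, j) \<in> mlet n \<longleftrightarrow> i \<noteq> 0 \<and> j = \<bar>i\<bar> + 1 \<and> j \<le> int n"
  by (auto simp: mlet_def queer_gens_def queer_index_def minus_letter_def)

lemma plet_iff: "(i, j) \<in> plet n \<longleftrightarrow> j \<noteq> 0 \<and> i = - \<bar>j\<bar> - 1 \<and> - i \<le> int n"
  by (auto simp: plet_def queer_gens_def queer_index_def plus_letter_def)

lemma zlet_iff: "(i, j) \<in> zlet n \<longleftrightarrow> i \<noteq> 0 \<and> \<bar>j\<bar> \<le> int n \<and> (i = j \<or> i = -j \<and> j > 0)"
  by (auto simp: zlet_def zero_letter_def queer_index_def)

lemma let_gens: "p \<in> mlet n \<Longrightarrow> p \<in> queer_gens n" "p \<in> plet n \<Longrightarrow> p \<in> queer_gens n" "p \<in> zlet n \<Longrightarrow> p \<in> queer_gens n"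
  by (auto simp: mlet_def plet_def zlet_def zero_letter_gens)

lemma zero_minus_letter:
  assumes "t \<in> zlet n" "x \<in> mlet n"
  shows "wmon [t, x] \<in> Sp n {[x', t'] | x' t'. x' \<in> mlet n \<and> t' \<in> zlet n}"
proof -
  obtain i j k l where tx: "t = (i, j)" "x = (k, l)" by (cases t, cases x)
  note g = let_gens(3)[OF assms(1), unfolded tx] let_gens(1)[OF assms(2), unfolded tx]
  have t: "i \<noteq> 0" "\<bar>j\<bar> \<le> int n" "i = j \<or> i = -j \<and> j > 0" and x: "k \<noteq> 0" "l = \<bar>k\<bar> + 1" "l \<le> int n"
    using assms by (simp_all add: tx zlet_iff mlet_iff)
  show ?thesis
  proof (cases "j = l")
    \<comment> \<open>Here \<open>straighten_left\<close> would produce another zero letter in front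
      of a minus letter; the other solution of the relations avoids it.\<close>
    case True
    show ?thesis unfolding tx
      by (rule straighten_right[OF g]; insert t x True; cases "k > 0"; auto simp: zlet_iff mlet_iff)
  next
    case False
    show ?thesis unfolding tx
      by (rule straighten_left[OF g]; insert t x False; cases "k > 0"; auto simp: zlet_iff mlet_iff)
  qed
qed

lemma plus_zero_letter:
  assumes "e \<in> plet n" "t \<in> zlet n"
  shows "wmon [e, t] \<in> Sp n {[t', e'] | t' e'. t' \<in> zlet n \<and> e' \<in> plet n}"
proof -
  obtain i j k l where te: "e = (i, j)" "t = (k, l)" by (cases e, cases t)
  note g = let_gens(2)[OF assms(1), unfolded te] let_gens(3)[OF assms(2), unfolded te]
  have t: "k \<noteq> 0" "\<bar>l\<bar> \<le> int n" "k = l \<or> k = -l \<and> l > 0" and e: "j \<noteq> 0" "i = - \<bar>j\<bar> - 1" "- i \<le> int n"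
    using assms by (simp_all add: te zlet_iff plet_iff)
  show ?thesis
  proof (cases "k \<noteq> l \<and> \<bar>j\<bar> = l")
    \<comment> \<open>The case in which \<open>straighten_left\<close> would produce a plus letter
      in front of a zero letter again.\<close>
    case True
    show ?thesis unfolding te
      by (rule straighten_right[OF g]; insert t e True; cases "j > 0"; auto simp: zlet_iff plet_iff)
  next
    case False
    show ?thesis unfolding te
      by (rule straighten_left[OF g]; insert t e False; cases "j > 0"; auto simp: zlet_iff plet_iff)
  qed
qed

text \<open>The counterpart of the fact that commutators of raising and lowering elements lie in the
  Cartan part: the corrections are products of two zero letters.\<close>

lemma plus_minus_letter:
  assumes "e \<in> plet n" "x \<in> mlet n"
  shows "wmon [e, x] \<in> Sp n ({[x', e'] | x' e'. x' \<in> mlet n \<and> e' \<in> plet n} \<union> {[t, t'] | t t'. t \<in> zlet n \<and> t' \<in> zlet n})"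
proof -
  obtain i j k l where te: "e = (i, j)" "x = (k, l)" by (cases e, cases x)
  note g = let_gens(2)[OF assms(1), unfolded te] let_gens(1)[OF assms(2), unfolded te]
  have x: "k \<noteq> 0" "l = \<bar>k\<bar> + 1" "l \<le> int n" and e: "j \<noteq> 0" "i = - \<bar>j\<bar> - 1" "- i \<le> int n"
    using assms by (simp_all add: te mlet_iff plet_iff)
  show ?thesis unfolding te
    by (rule straighten_left[OF g]; insert x e; cases "j > 0"; cases "k > 0"; auto simp: zlet_iff plet_iff mlet_iff)
qed

section \<open>Ordered monomials in the Cartan part\<close>

lemma odd_commute:
  assumes "0 < s" "s < i" "i \<le> int n"
  shows "wmon [(-i, i), (-s, s)] \<in> Sp n {[(-s, s), (-i, i)]}"
  by (rule straighten_left; use assms in \<open>auto simp: queer_gens_def queer_index_def\<close>)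

lemma qvar_plus_inverse: "qvar + inverse qvar \<noteq> 0"
proof
  assume "qvar + inverse qvar = 0"
  then have "qvar * (qvar + inverse qvar) = 0" by simp
  then have "qvar * qvar = -1" by (simp add: distrib_left eq_neg_iff_add_eq_0)
  then have "qvar ^ 4 = 1" by (simp add: numeral_eq_Suc flip: mult.assoc)
  then have "qvar powi 4 = 1" by (simp add: power_int_def)
  then show False using qvar_powi_eq_1 by fastforce
qed

text \<open>In terms of \<open>k_bar\<close> this is the Clifford-type relation that its square
  equals \<open>(q^(2k) - q^(-2k)) / (q^2 - q^(-2))\<close>; solving for the square requires
  \<open>qvar + inverse qvar\<close> to be invertible.\<close>

lemma odd_square:
  assumes "0 < i" "i \<le> int n"
  shows "wmon [(-i, i), (-i, i)] \<in> Sp n {[(i, i), (i, i)], [(-i, -i), (-i, -i)]}"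
proof (rule Sp_annih)
  let ?q = "scal zq (wmon [(i, i), (i, i)]) - scal zq (wmon [(-i, -i), (-i, -i)])"
  have g: "(-i, i) \<in> queer_gens n" using assms by (auto simp: queer_gens_def queer_index_def)
  have p: "parity (-i) i = 1" using assms by (auto simp: parity_def zero_less_mult_iff)
  show "(qvar + inverse qvar) * h [(-i, i), (-i, i)] = lin h ?q" if "annih n h" for h
  proof -
    have "- (qvar * h [(-i, i), (-i, i)]) - zq * h [(-i, -i), (-i, -i)] = inverse qvar * h [(-i, i), (-i, i)] - zq * h [(i, i), (i, i)]"
      using annih_relator[OF that g g] assms p by (simp add: phi_def theta_def)
    then show ?thesis by (simp add: algebra_simps)
  qed
  show "?q \<in> Sp n {[(i, i), (i, i)], [(-i, -i), (-i, -i)]}" by (intro Sp_diff Sp_scal Sp_word) auto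
qed (rule qvar_plus_inverse)

lemma weq_zero_word:
  assumes "\<forall>p \<in> set t. zero_letter n p"
  shows "\<exists>g. weq n t (filter (\<lambda>(a, b). a \<noteq> b) t @ kw n g)"
  using weq_normal_form[OF assms] by blast

definition yset :: "nat \<Rightarrow> int list set \<Rightarrow> wd set" where
  "yset n L = {odd_word l @ kw n g | l g. l \<in> L}"

lemma ysetI: "l \<in> L \<Longrightarrow> odd_word l @ kw n g \<in> yset n L"
  by (auto simp: yset_def)

text \<open>One step of insertion sort. The letter passes smaller ones by
  \<open>odd_commute\<close>; if it meets its equal, \<open>odd_square\<close> replaces the pair by
  diagonal letters, which are absorbed into the exponents.\<close>

lemma odd_insert:
  assumes "sorted_wrt (<) l" "set l \<subseteq> {1..int n}" "i \<in> {1..int n}"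
  shows "wmon ((-i, i) # odd_word l @ kw n g) \<in> Sp n (yset n {l'. sorted_wrt (<) l' \<and> set l' \<subseteq> insert i (set l)})"
  using assms(1,2)
proof (induction l arbitrary: g)
  case Nil
  then show ?case by (intro Sp_word) (auto simp: yset_def intro!: exI[of _ "[i]"])
next
  case (Cons s l)
  let ?L = "{l'. sorted_wrt (<) l' \<and> set l' \<subseteq> insert i (set (s # l))}"
  have sl: "sorted_wrt (<) l" "\<forall>y \<in> set l. s < y" "set l \<subseteq> {1..int n}" "s \<in> {1..int n}" using Cons.prems by auto
  have zl: "\<forall>p \<in> set (odd_word l @ kw n g). zero_letter n p"
  proof -
    have "\<forall>p \<in> set (kw n g). zero_letter n p" using zero_letter_blocks[of "[1..int n]" n] by simp
    moreover have "\<forall>p \<in> set (odd_word l). zero_letter n p" using sl(3) by (auto simp: zero_letter_def)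
    ultimately show ?thesis by auto
  qed
  have gl: "set (odd_word l @ kw n g) \<subseteq> queer_gens n" using zl zero_letter_gens by blast
  have fl: "filter (\<lambda>(a, b). a \<noteq> b) (odd_word l) = odd_word l"
    using sl(3) by (intro filter_True) fastforce
  have fk: "filter (\<lambda>(a, b). a \<noteq> b) (kw n g) = []" by (rule filter_diag) (auto dest: diag_blocks)
  consider "i < s" | "i = s" | "s < i" by linarith
  then show ?case
  proof cases
    case 1
    then have "i # s # l \<in> ?L" using Cons.prems by fastforce
    from ysetI[OF this, of n g] show ?thesis by (intro Sp_word) simp
  next
    case 2
    have d: "wmon ([] @ [a, a] @ (odd_word l @ kw n g)) \<in> Sp n (yset n ?L)" if a: "a = (b, b)" "b \<in> {i, -i}" for a b
    proof -
      have "\<forall>p \<in> set ([a, a] @ odd_word l @ kw n g). zero_letter n p"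
        using zl a assms(3) by (auto simp: zero_letter_def queer_index_def)
      from weq_zero_word[OF this] obtain g' where "weq n ([a, a] @ odd_word l @ kw n g) (odd_word l @ kw n g')"
        using fl fk a by auto
      moreover have "l \<in> ?L" using sl by auto
      then have "wmon (odd_word l @ kw n g') \<in> Sp n (yset n ?L)" by (intro Sp_word) (auto simp: yset_def)
      ultimately show ?thesis using Sp_weq by simp
    qed
    have "wmon ([] @ [(-i, i), (-i, i)] @ (odd_word l @ kw n g)) \<in> Sp n (yset n ?L)"
      by (rule Sp_word_app[OF odd_square]) (use assms(3) gl d in auto)
    then show ?thesis using 2 by simp
  next
    case 3
    let ?L' = "{l'. sorted_wrt (<) l' \<and> set l' \<subseteq> insert i (set l)}"
    have ih: "wmon ((-i, i) # odd_word l @ kw n g) \<in> Sp n (yset n ?L')" by (rule Cons.IH) (use sl in auto)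
    have s: "set [(-s, s)] \<subseteq> queer_gens n" using sl(4) by (auto simp: queer_gens_def queer_index_def)
    have "wmon ([(-s, s)] @ ((-i, i) # odd_word l @ kw n g) @ []) \<in> Sp n (yset n ?L)"
    proof (rule Sp_word_app[OF ih _ s])
      fix a assume "a \<in> yset n ?L'"
      then obtain l' g' where a: "a = odd_word l' @ kw n g'" "sorted_wrt (<) l'" "set l' \<subseteq> insert i (set l)" by (auto simp: yset_def)
      have "s # l' \<in> ?L" using a sl 3 by auto
      from ysetI[OF this, of n g'] show "wmon ([(-s, s)] @ a @ []) \<in> Sp n (yset n ?L)" by (intro Sp_word) (simp add: a(1))
    qed simp
    then have "wmon ([] @ [(-s, s), (-i, i)] @ (odd_word l @ kw n g)) \<in> Sp n (yset n ?L)" by simp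
    then have "wmon ([] @ [(-i, i), (-s, s)] @ (odd_word l @ kw n g)) \<in> Sp n (yset n ?L)"
      by (intro Sp_word_app[OF odd_commute]) (use 3 sl assms(3) gl in auto)
    then show ?thesis by simp
  qed
qed

definition ywords :: "nat \<Rightarrow> wd set" where
  "ywords n = (\<lambda>(S, g). yw n S g) ` zero_index n"

lemma yset_ywords: "yset n {l'. sorted_wrt (<) l' \<and> set l' \<subseteq> {1..int n}} \<subseteq> ywords n"
proof
  fix a assume "a \<in> yset n {l'. sorted_wrt (<) l' \<and> set l' \<subseteq> {1..int n}}"
  then obtain l g where a: "a = odd_word l @ kw n g" "sorted_wrt (<) l" "set l \<subseteq> {1..int n}" by (auto simp: yset_def)
  have "sorted_list_of_set (set l) = l" using a(2) by (simp add: strict_sorted_equal_Uniq sorted_list_of_set.idem_if_sorted_distinct strict_sorted_iff)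
  moreover have "kw n g = kw n (restrict g {1..int n})" by (rule blocks_cong) simp
  ultimately have "a = yw n (set l) (restrict g {1..int n})" by (simp add: a yw_def)
  moreover have "(set l, restrict g {1..int n}) \<in> zero_index n" using a(3) by (auto simp: zero_index_def P_dual_def)
  ultimately show "a \<in> ywords n" unfolding ywords_def by force
qed

lemma zero_words_span:
  assumes "\<forall>p \<in> set t. zero_letter n p"
  shows "wmon t \<in> Sp n (ywords n)"
proof -
  let ?L = "{l'. sorted_wrt (<) l' \<and> set l' \<subseteq> {1..int n}}"
  have o: "wmon (odd_word l @ kw n g) \<in> Sp n (yset n ?L)" if "set l \<subseteq> {1..int n}" for l g
    using that
  proof (induction l)
    case Nil
    then show ?case by (intro Sp_word) (auto simp: yset_def intro!: exI[of _ "[]"])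
  next
    case (Cons i l)
    have "wmon ([(-i, i)] @ (odd_word l @ kw n g) @ []) \<in> Sp n (yset n ?L)"
    proof (rule Sp_word_app)
      show "wmon (odd_word l @ kw n g) \<in> Sp n (yset n ?L)" using Cons by simp
      fix a assume "a \<in> yset n ?L"
      then obtain l' g' where a: "a = odd_word l' @ kw n g'" "sorted_wrt (<) l'" "set l' \<subseteq> {1..int n}" by (auto simp: yset_def)
      have "wmon ((-i, i) # odd_word l' @ kw n g') \<in> Sp n (yset n {l''. sorted_wrt (<) l'' \<and> set l'' \<subseteq> insert i (set l')})"
        by (rule odd_insert) (use a Cons.prems in auto)
      from this have "wmon ((-i, i) # odd_word l' @ kw n g') \<in> Sp n (yset n ?L)"
      proof (rule Sp_mono)
        have i: "insert i (set l') \<subseteq> {1..int n}" using a(3) Cons.prems by simp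
        show "yset n {l''. sorted_wrt (<) l'' \<and> set l'' \<subseteq> insert i (set l')} \<subseteq> yset n ?L"
        proof
          fix c assume "c \<in> yset n {l''. sorted_wrt (<) l'' \<and> set l'' \<subseteq> insert i (set l')}"
          then obtain l'' g'' where c: "c = odd_word l'' @ kw n g''" "sorted_wrt (<) l''" "set l'' \<subseteq> insert i (set l')"
            by (auto simp: yset_def)
          have "l'' \<in> ?L" using c(2,3) i by (intro CollectI conjI) (assumption, rule subset_trans)
          from ysetI[OF this, of n g''] show "c \<in> yset n ?L" by (simp only: c(1))
        qed
      qed
      then show "wmon ([(-i, i)] @ a @ []) \<in> Sp n (yset n ?L)" by (simp add: a(1))
    qed (use Cons.prems in \<open>auto simp: queer_gens_def queer_index_def\<close>)
    then show ?case by simp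
  qed
  obtain g where g: "weq n t (filter (\<lambda>(a, b). a \<noteq> b) t @ kw n g)" using weq_zero_word[OF assms] by blast
  have "\<exists>l. filter (\<lambda>(a, b). a \<noteq> b) t = odd_word l \<and> set l \<subseteq> {1..int n}" using assms
  proof (induction t)
    case (Cons p t)
    then obtain l where l: "filter (\<lambda>(a, b). a \<noteq> b) t = odd_word l" "set l \<subseteq> {1..int n}" by auto
    obtain a b where p: "p = (a, b)" by force
    have "zero_letter n p" using Cons.prems by simp
    then consider "a = b" | "a \<noteq> b" "a = -b" "b \<in> {1..int n}" by (auto simp: zero_letter_def p)
    then show ?case
    proof cases
      case 1
      then show ?thesis using l by (intro exI[of _ l]) (simp add: p)
    next
      case 2
      then show ?thesis using l by (intro exI[of _ "b # l"]) (simp add: p)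
    qed
  qed simp
  then obtain l where "filter (\<lambda>(a, b). a \<noteq> b) t = odd_word l" "set l \<subseteq> {1..int n}" by blast
  then have "wmon t \<in> Sp n (yset n ?L)" using Sp_weq[OF g] o by simp
  then show ?thesis using Sp_mono yset_ywords by blast
qed

section \<open>Left multiplication preserves the span of triangular words\<close>

definition tri_words :: "nat \<Rightarrow> wd set" where
  "tri_words n = {x @ y @ w | x y w. set x \<subseteq> mlet n \<and> set y \<subseteq> zlet n \<and> set w \<subseteq> plet n}"

lemma zero_minus_word:
  assumes "t \<in> zlet n" "set x \<subseteq> mlet n"
  shows "wmon (t # x) \<in> Sp n {x' @ [t'] | x' t'. set x' \<subseteq> mlet n \<and> t' \<in> zlet n}"
  using assms
proof (induction x arbitrary: t)
  case Nil
  then show ?case by (intro Sp_word) force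
next
  case (Cons c x)
  let ?A = "{x' @ [t'] | x' t'. set x' \<subseteq> mlet n \<and> t' \<in> zlet n}"
  have "wmon ([] @ [t, c] @ x) \<in> Sp n ?A"
  proof (rule Sp_word_app[OF zero_minus_letter])
    fix a assume "a \<in> {[x', t'] | x' t'. x' \<in> mlet n \<and> t' \<in> zlet n}"
    then obtain c' t' where a: "a = [c', t']" "c' \<in> mlet n" "t' \<in> zlet n" by auto
    have "wmon ([c'] @ (t' # x) @ []) \<in> Sp n ?A"
    proof (rule Sp_word_app)
      show "wmon (t' # x) \<in> Sp n ?A" using Cons.IH[OF a(3)] Cons.prems by auto
      fix b assume "b \<in> ?A"
      then obtain x' t' where "b = x' @ [t']" "set x' \<subseteq> mlet n" "t' \<in> zlet n" by blast
      then have "[c'] @ b @ [] \<in> ?A" using a(2) by (intro CollectI exI[of _ "c' # x'"] exI[of _ t']) auto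
      then show "wmon ([c'] @ b @ []) \<in> Sp n ?A" by (rule Sp_word)
    qed (use a let_gens in auto)
    then show "wmon ([] @ a @ x) \<in> Sp n ?A" by (simp add: a)
  qed (use Cons.prems let_gens in auto)
  then show ?case by simp
qed

lemma plus_zero_word:
  assumes "e \<in> plet n" "set y \<subseteq> zlet n"
  shows "wmon (e # y) \<in> Sp n {y' @ [e'] | y' e'. set y' \<subseteq> zlet n \<and> e' \<in> plet n}"
  using assms
proof (induction y arbitrary: e)
  case Nil
  then show ?case by (intro Sp_word) force
next
  case (Cons c x)
  let ?A = "{y' @ [e'] | y' e'. set y' \<subseteq> zlet n \<and> e' \<in> plet n}"
  have "wmon ([] @ [e, c] @ x) \<in> Sp n ?A"
  proof (rule Sp_word_app[OF plus_zero_letter])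
    fix a assume "a \<in> {[t', e'] | t' e'. t' \<in> zlet n \<and> e' \<in> plet n}"
    then obtain c' t' where a: "a = [c', t']" "c' \<in> zlet n" "t' \<in> plet n" by auto
    have "wmon ([c'] @ (t' # x) @ []) \<in> Sp n ?A"
    proof (rule Sp_word_app)
      show "wmon (t' # x) \<in> Sp n ?A" using Cons.IH[OF a(3)] Cons.prems by auto
      fix b assume "b \<in> ?A"
      then obtain x' t' where "b = x' @ [t']" "set x' \<subseteq> zlet n" "t' \<in> plet n" by blast
      then have "[c'] @ b @ [] \<in> ?A" using a(2) by (intro CollectI exI[of _ "c' # x'"] exI[of _ t']) auto
      then show "wmon ([c'] @ b @ []) \<in> Sp n ?A" by (rule Sp_word)
    qed (use a let_gens in auto)
    then show "wmon ([] @ a @ x) \<in> Sp n ?A" by (simp add: a)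
  qed (use Cons.prems let_gens in auto)
  then show ?case by simp
qed

text \<open>Once every generator has this property, the span of the triangular words is stable under
  all left multiplications; as it contains the empty word, it is everything.\<close>

definition left_stable :: "nat \<Rightarrow> wd \<Rightarrow> bool" where
  "left_stable n u \<longleftrightarrow> set u \<subseteq> queer_gens n \<and> (\<forall>a \<in> tri_words n. wmon (u @ a) \<in> Sp n (tri_words n))"

lemma left_stable_Sp: "left_stable n u \<Longrightarrow> p \<in> Sp n (tri_words n) \<Longrightarrow> wmon u * p \<in> Sp n (tri_words n)"
  using Sp_app[of p n "tri_words n" u "[]" "tri_words n"] by (simp add: left_stable_def mon_Nil)

lemma left_stable_app: "left_stable n u \<Longrightarrow> left_stable n v \<Longrightarrow> left_stable n (u @ v)"
proof -
  assume u: "left_stable n u" and v: "left_stable n v"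
  have "wmon ((u @ v) @ a) \<in> Sp n (tri_words n)" if "a \<in> tri_words n" for a
    using left_stable_Sp[OF u, of "wmon (v @ a)"] v that by (simp add: left_stable_def flip: mon_append)
  then show ?thesis using u v by (simp add: left_stable_def)
qed

lemma let_words_gens:
  "set x \<subseteq> mlet n \<Longrightarrow> set x \<subseteq> queer_gens n" "set x \<subseteq> plet n \<Longrightarrow> set x \<subseteq> queer_gens n" "set x \<subseteq> zlet n \<Longrightarrow> set x \<subseteq> queer_gens n"
  using let_gens by blast+

lemma TriI: "set x \<subseteq> mlet n \<Longrightarrow> set y \<subseteq> zlet n \<Longrightarrow> set w \<subseteq> plet n \<Longrightarrow> x @ y @ w \<in> tri_words n"
  unfolding tri_words_def by blast

lemma left_stable_minus: "p \<in> mlet n \<Longrightarrow> left_stable n [p]"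
  unfolding left_stable_def
proof (intro conjI ballI)
  assume p: "p \<in> mlet n"
  then show "set [p] \<subseteq> queer_gens n" using let_gens by auto
  fix a assume "a \<in> tri_words n"
  then obtain x y w where a: "a = x @ y @ w" "set x \<subseteq> mlet n" "set y \<subseteq> zlet n" "set w \<subseteq> plet n" by (auto simp: tri_words_def)
  then show "wmon ([p] @ a) \<in> Sp n (tri_words n)" using TriI[of "p # x" n y w] p by (intro Sp_word) auto
qed

lemma left_stable_zero: "t \<in> zlet n \<Longrightarrow> left_stable n [t]"
  unfolding left_stable_def
proof (intro conjI ballI)
  assume t: "t \<in> zlet n"
  then show "set [t] \<subseteq> queer_gens n" using let_gens by auto
  fix a assume "a \<in> tri_words n"
  then obtain x y w where a: "a = x @ y @ w" "set x \<subseteq> mlet n" "set y \<subseteq> zlet n" "set w \<subseteq> plet n" by (auto simp: tri_words_def)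
  have "wmon ([] @ (t # x) @ (y @ w)) \<in> Sp n (tri_words n)"
  proof (rule Sp_word_app[OF zero_minus_word[OF t a(2)]])
    fix b assume "b \<in> {x' @ [t'] | x' t'. set x' \<subseteq> mlet n \<and> t' \<in> zlet n}"
    then obtain x' t' where b: "b = x' @ [t']" "set x' \<subseteq> mlet n" "t' \<in> zlet n" by blast
    then show "wmon ([] @ b @ (y @ w)) \<in> Sp n (tri_words n)" using TriI[of x' n "t' # y" w] a by (intro Sp_word) auto
  qed (use a let_words_gens in auto)
  then show "wmon ([t] @ a) \<in> Sp n (tri_words n)" by (simp add: a)
qed

text \<open>The plus letter moves to the right through \<open>x\<close> one letter at a time. The
  pairs of zero letters that split off on the way are covered by
  \<open>left_stable_zero\<close>.\<close>

lemma left_stable_plus: "e \<in> plet n \<Longrightarrow> left_stable n [e]"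
proof -
  have *: "wmon (e # x @ y @ w) \<in> Sp n (tri_words n)"
    if "e \<in> plet n" "set x \<subseteq> mlet n" "set y \<subseteq> zlet n" "set w \<subseteq> plet n" for e x y w
    using that
  proof (induction x arbitrary: e)
    case Nil
    have "wmon ([] @ (e # y) @ w) \<in> Sp n (tri_words n)"
    proof (rule Sp_word_app[OF plus_zero_word])
      fix b assume "b \<in> {y' @ [e'] | y' e'. set y' \<subseteq> zlet n \<and> e' \<in> plet n}"
      then obtain y' e' where b: "b = y' @ [e']" "set y' \<subseteq> zlet n" "e' \<in> plet n" by blast
      then show "wmon ([] @ b @ w) \<in> Sp n (tri_words n)" using TriI[of "[]" n y' "e' # w"] Nil by (intro Sp_word) auto
    qed (use Nil let_words_gens in auto)
    then show ?case by simp
  next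
    case (Cons c x)
    have g: "set (x @ y @ w) \<subseteq> queer_gens n" using Cons.prems let_words_gens by auto
    have "wmon ([] @ [e, c] @ (x @ y @ w)) \<in> Sp n (tri_words n)"
    proof (rule Sp_word_app[OF plus_minus_letter])
      fix b assume "b \<in> {[x', e'] | x' e'. x' \<in> mlet n \<and> e' \<in> plet n} \<union> {[t, t'] | t t'. t \<in> zlet n \<and> t' \<in> zlet n}"
      then consider c' e' where "b = [c', e']" "c' \<in> mlet n" "e' \<in> plet n" | t t' where "b = [t, t']" "t \<in> zlet n" "t' \<in> zlet n" by blast
      then show "wmon ([] @ b @ (x @ y @ w)) \<in> Sp n (tri_words n)"
      proof cases
        case 1
        have "wmon (e' # x @ y @ w) \<in> Sp n (tri_words n)" using Cons.IH[OF 1(3)] Cons.prems by auto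
        from left_stable_Sp[OF left_stable_minus[OF 1(2)] this] show ?thesis by (simp add: 1 flip: mon_append)
      next
        case 2
        have "left_stable n ([t] @ [t'])" using left_stable_app left_stable_zero 2 by blast
        moreover have "x @ y @ w \<in> tri_words n" using Cons.prems by (intro TriI) auto
        ultimately show ?thesis using 2 by (auto simp: left_stable_def)
      qed
    qed (use Cons.prems g in auto)
    then show ?case by simp
  qed
  have "wmon ([e] @ a) \<in> Sp n (tri_words n)" if "e \<in> plet n" "a \<in> tri_words n" for a
    proof -
    obtain x y w where "a = x @ y @ w" "set x \<subseteq> mlet n" "set y \<subseteq> zlet n" "set w \<subseteq> plet n" using \<open>a \<in> tri_words n\<close> by (auto simp: tri_words_def)
    then show ?thesis using * that(1) by simp
  qed
  then show "e \<in> plet n \<Longrightarrow> left_stable n [e]" using let_gens(2) by (simp add: left_stable_def)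
qed

text \<open>A commutator yields \<open>p\<close> only together with a diagonal letter
  \<open>(j, j)\<close>. Its inverse \<open>(-j, -j)\<close> is put in front of \<open>a\<close> to
  remove it, and it is left stable itself.\<close>

lemma left_stable_expand:
  assumes "\<And>h. annih n h \<Longrightarrow> c * h [p, (j, j)] = h w1 - h w2" "c \<noteq> 0" "p \<in> queer_gens n" "j \<in> queer_index n"
    and "left_stable n w1" "left_stable n w2"
  shows "left_stable n [p]"
  unfolding left_stable_def
proof (intro conjI ballI)
  show "set [p] \<subseteq> queer_gens n" using assms by simp
  fix a assume a: "a \<in> tri_words n"
  have j: "left_stable n [(-j, -j)]" using assms(4) by (intro left_stable_zero) (auto simp: zlet_def zero_letter_def)
  have 1: "wmon (w1 @ [(-j, -j)] @ a) \<in> Sp n (tri_words n)" "wmon (w2 @ [(-j, -j)] @ a) \<in> Sp n (tri_words n)"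
    using left_stable_app[OF assms(5) j] left_stable_app[OF assms(6) j] a by (auto simp: left_stable_def)
  obtain x y w where "a = x @ y @ w" "set x \<subseteq> mlet n" "set y \<subseteq> zlet n" "set w \<subseteq> plet n" using a by (auto simp: tri_words_def)
  then have ag: "set a \<subseteq> queer_gens n" using let_words_gens by simp
  show "wmon ([p] @ a) \<in> Sp n (tri_words n)"
  proof (rule Sp_annih)
    fix h assume h: "annih n h"
    have "set ((-j, -j) # a) \<subseteq> queer_gens n" using ag assms(4) by (auto simp: diag_gens)
    from assms(1)[OF annih_right[OF h this]]
    have "c * h (p # (j, j) # (-j, -j) # a) = h (w1 @ (-j, -j) # a) - h (w2 @ (-j, -j) # a)" by simp
    moreover have "weq n ([p] @ [(j, j), (-j, -j)] @ a) ([p] @ [] @ a)"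
      using weq_app[OF weq_diag_cancel[OF assms(4)], of "[p]" a] assms(3) ag by simp
    then have "h (p # (j, j) # (-j, -j) # a) = h (p # a)" using h by (simp add: weq_def)
    ultimately show "c * h ([p] @ a) = lin h (wmon (w1 @ [(-j, -j)] @ a) - wmon (w2 @ [(-j, -j)] @ a))"
      by simp
  qed (use assms(2) 1 in \<open>auto intro: Sp_diff\<close>)
qed

lemma left_stable_upper: "i \<noteq> 0 \<Longrightarrow> \<bar>i\<bar> < l \<Longrightarrow> l \<le> int n \<Longrightarrow> left_stable n [(i, l)]"
proof (induction "nat (l - \<bar>i\<bar>)" arbitrary: l rule: less_induct)
  case less
  show ?case
  proof (cases "l = \<bar>i\<bar> + 1")
    case True
    then show ?thesis using less.prems by (intro left_stable_minus) (simp add: mlet_iff)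
  next
    case False
    \<comment> \<open>The index just below \<open>l\<close>: then \<open>(j, l)\<close> is a minus
      letter, and the induction hypothesis applies to \<open>(i, j)\<close>.\<close>
    define j where "j = l - 1"
    have j: "\<bar>i\<bar> < j" "j < l" "j > 0" "l = \<bar>j\<bar> + 1" using False less.prems by (auto simp: j_def)
    have 1: "left_stable n [(i, j)]" using j less.prems by (intro less.hyps) auto
    have 2: "left_stable n [(j, l)]" using j less.prems by (intro left_stable_minus) (simp add: mlet_iff)
    have g: "(i, j) \<in> queer_gens n" "(j, l) \<in> queer_gens n" using 1 2 by (auto simp: left_stable_def)
    show ?thesis
    proof (rule left_stable_expand[OF _ zq_nonzero _ _ left_stable_app[OF 2 1] left_stable_app[OF 1 2]])
      fix h assume h: "annih n h"
      have "h [(i, j), (j, l)] + zq * h [(i, l), (j, j)] = h [(j, l), (i, j)]"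
        using annih_relator[OF h g] j less.prems
        by (simp add: phi_def parity_def theta_def sgn_if split: if_splits)
      then show "zq * h [(i, l), (j, j)] = h ([(j, l)] @ [(i, j)]) - h ([(i, j)] @ [(j, l)])" by (simp add: algebra_simps)
    qed (use j less.prems in \<open>auto simp: queer_gens_def queer_index_def\<close>)
  qed
qed

lemma left_stable_lower: "j \<noteq> 0 \<Longrightarrow> \<bar>j\<bar> < -i \<Longrightarrow> -i \<le> int n \<Longrightarrow> left_stable n [(i, j)]"
proof (induction "nat (-i - \<bar>j\<bar>)" arbitrary: i rule: less_induct)
  case less
  show ?case
  proof (cases "i = - \<bar>j\<bar> - 1")
    case True
    then show ?thesis using less.prems by (intro left_stable_plus) (simp add: plet_iff)
  next
    case False
    \<comment> \<open>The mirror choice: \<open>(i, -m)\<close> is a plus letter, the induction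
      hypothesis applies to \<open>(-m, j)\<close>, and the diagonal letter to be removed is
      \<open>(-m, -m)\<close>.\<close>
    define m where "m = -i - 1"
    have m: "\<bar>j\<bar> < m" "m < -i" "m > 0" "i = - \<bar>- m\<bar> - 1" using False less.prems by (auto simp: m_def)
    have 1: "left_stable n [(-m, j)]" using m less.prems by (intro less.hyps) auto
    have 2: "left_stable n [(i, -m)]" using m less.prems by (intro left_stable_plus) (simp add: plet_iff)
    have g: "(i, -m) \<in> queer_gens n" "(-m, j) \<in> queer_gens n" using 1 2 by (auto simp: left_stable_def)
    show ?thesis
    proof (rule left_stable_expand[OF _ zq_nonzero _ _ left_stable_app[OF 2 1] left_stable_app[OF 1 2]])
      fix h assume h: "annih n h"
      have p: "parity i (-m) = 0" using m by (simp add: parity_def mult_neg_pos)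
      have "-m < j" "\<not> m < j" using m by auto
      then have "h [(i, -m), (-m, j)] - zq * h [(i, j), (-m, -m)] = h [(-m, j), (i, -m)]"
        using annih_relator[OF h g] m less.prems unfolding p
        by (simp add: phi_def theta_def sgn_if)
      then show "zq * h [(i, j), (-m, -m)] = h ([(i, -m)] @ [(-m, j)]) - h ([(-m, j)] @ [(i, -m)])" by (simp add: algebra_simps)
    qed (use m less.prems in \<open>auto simp: queer_gens_def queer_index_def\<close>)
  qed
qed

lemma left_stable_gens: "p \<in> queer_gens n \<Longrightarrow> left_stable n [p]"
proof -
  assume p: "p \<in> queer_gens n"
  obtain i j where ij: "p = (i, j)" by force
  have x: "i \<noteq> 0" "j \<noteq> 0" "\<bar>i\<bar> \<le> int n" "\<bar>j\<bar> \<le> int n" "i \<le> j" using p by (auto simp: ij queer_gens_def queer_index_def)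
  consider "\<bar>i\<bar> < j" | "\<bar>j\<bar> < -i" | "p \<in> zlet n" using x by (fastforce simp: ij zlet_iff)
  then show ?thesis
    by cases (use x left_stable_upper left_stable_lower left_stable_zero in \<open>auto simp: ij\<close>)
qed

definition pbw_words :: "nat \<Rightarrow> wd set" where
  "pbw_words n = {x @ y @ w | x y w. x \<in> minus_words n \<and> y \<in> ywords n \<and> w \<in> plus_words n}"

lemma minus_words_iff: "x \<in> minus_words n \<longleftrightarrow> set x \<subseteq> mlet n"
  and plus_words_iff: "x \<in> plus_words n \<longleftrightarrow> set x \<subseteq> plet n"
  by (auto simp: minus_words_def plus_words_def mlet_def plet_def)

theorem triangular_span: "p \<in> Fc n \<Longrightarrow> p \<in> Sp n (pbw_words n)"
proof -
  have w: "wmon w \<in> Sp n (tri_words n)" if "set w \<subseteq> queer_gens n" for w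
    using that
  proof (induction w)
    case Nil
    then show ?case using TriI[of "[]" n "[]" "[]"] by (intro Sp_word) auto
  next
    case (Cons p w)
    then show ?case using left_stable_Sp[OF left_stable_gens, of p n "wmon w"] by (simp flip: mon_append)
  qed
  have "wmon a \<in> Sp n (pbw_words n)" if "a \<in> tri_words n" for a
  proof -
    obtain x y w where a: "a = x @ y @ w" "set x \<subseteq> mlet n" "set y \<subseteq> zlet n" "set w \<subseteq> plet n" using \<open>a \<in> tri_words n\<close> by (auto simp: tri_words_def)
    have "wmon y \<in> Sp n (ywords n)" using a(3) by (intro zero_words_span) (auto simp: zlet_def)
    then show ?thesis unfolding a(1)
    proof (rule Sp_word_app)
      show "wmon (x @ b @ w) \<in> Sp n (pbw_words n)" if "b \<in> ywords n" for b
        using that a by (intro Sp_word) (auto simp: pbw_words_def minus_words_iff plus_words_iff)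
    qed (use a let_words_gens in auto)
  qed
  then have w': "wmon w \<in> Sp n (pbw_words n)" if "set w \<subseteq> queer_gens n" for w using Sp_trans[OF w[OF that]] by blast
  assume p: "p \<in> Fc n"
  have "(\<Sum>w \<in> keys p. scal (lookup p w) (wmon (letters w))) \<in> Sp n (pbw_words n)"
    using p by (intro fv.subspace_sum[OF Sp_subspace] Sp_scal w') (auto simp: Fc_def)
  then show ?thesis by (subst mon_expand)
qed

section \<open>Bases consisting of words\<close>

lemma wmon_inj: "inj wmon"
proof (rule injI)
  fix x y assume "wmon x = wmon y"
  then have "keys (wmon x) = keys (wmon y)" by simp
  then show "x = y" by (simp add: wmon_def)
qed

text \<open>A basis of the ideal is extended by words of \<open>A\<close> to an independent set that
  spans both. The added words are independent modulo the ideal because a relation between them would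
  be one inside this larger set.\<close>

theorem basis_mod_ideal: "\<exists>B \<subseteq> A. indep n B (\<lambda>x. x) \<and> (\<forall>a \<in> A. wmon a \<in> Sp n B)"
proof -
  obtain B0 where B0: "B0 \<subseteq> queer_ideal n" "fv.independent B0" "queer_ideal n \<subseteq> fv.span B0"
    using fv.maximal_independent_subset by blast
  obtain B1 where B1: "B0 \<subseteq> B1" "B1 \<subseteq> B0 \<union> wmon ` A" "fv.independent B1" "B0 \<union> wmon ` A \<subseteq> fv.span B1"
    using fv.maximal_independent_subset_extend[of B0 "B0 \<union> wmon ` A"] B0(2) by blast
  define B where "B = {a \<in> A. wmon a \<in> B1 - B0}"
  have "wmon a \<in> Sp n B" if "a \<in> A" for a
  proof -
    have "B1 \<subseteq> wmon ` B \<union> queer_ideal n" using B1(2) B0(1) by (auto simp: B_def)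
    then have "fv.span B1 \<subseteq> Sp n B" unfolding Sp_def by (rule fv.span_mono)
    then show ?thesis using B1(4) that by blast
  qed
  moreover have "indep n B (\<lambda>x. x)" unfolding indep_def
  proof (intro allI impI)
    fix J c assume J: "finite J" "J \<subseteq> B" and z: "\<forall>h. annih n h \<longrightarrow> (\<Sum>a \<in> J. c a * h a) = 0"
    have "(\<Sum>a \<in> J. scal (c a) (wmon a)) \<in> queer_ideal n" using z by (simp add: ideal_iff_annih lin_sum)
    then obtain T r where T: "finite T" "T \<subseteq> B0" "(\<Sum>a \<in> J. scal (c a) (wmon a)) = (\<Sum>b \<in> T. scal (r b) b)"
      using B0(3) unfolding fv.span_explicit by blast
    define u where "u v = (if v \<in> T then - r v else c (inv_into UNIV wmon v))" for v
    have d: "T \<inter> wmon ` J = {}" using T(2) J(2) by (auto simp: B_def)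
    then have d': "\<forall>a \<in> J. wmon a \<notin> T" by blast
    have "(\<Sum>v \<in> T \<union> wmon ` J. scal (u v) v) = (\<Sum>v \<in> T. scal (u v) v) + (\<Sum>v \<in> wmon ` J. scal (u v) v)"
      using T(1) J(1) d by (intro sum.union_disjoint) auto
    also have "(\<Sum>v \<in> T. scal (u v) v) = - (\<Sum>b \<in> T. scal (r b) b)"
      by (simp add: u_def scal_algebra flip: sum_negf)
    also have "(\<Sum>v \<in> wmon ` J. scal (u v) v) = (\<Sum>a \<in> J. scal (c a) (wmon a))"
      using d' inj_on_subset[OF wmon_inj] by (subst sum.reindex) (auto simp: u_def inv_f_f[OF wmon_inj] intro!: sum.cong)
    finally have s: "(\<Sum>v \<in> T \<union> wmon ` J. scal (u v) v) = 0" using T(3) by simp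
    have "u v = 0" if "v \<in> T \<union> wmon ` J" for v
      by (rule fv.independentD[OF B1(3) _ _ s that]) (use T J B1(1) in \<open>auto simp: B_def\<close>)
    then have "u (wmon a) = 0" if "a \<in> J" for a using that by blast
    then show "\<forall>a \<in> J. c a = 0" using d' by (auto simp: u_def inv_f_f[OF wmon_inj] split: if_splits)
  qed
  ultimately show ?thesis by (intro exI[of _ B]) (auto simp: B_def)
qed

section \<open>The three subalgebras\<close>

definition cs :: "'a::ab_group_add set \<Rightarrow> 'a \<Rightarrow> 'a set" where
  "cs N x = (\<lambda>h. h + x) ` N"

text \<open>Common ground of the two quotients that occur, by the ideal and by the tensor relations.
  Closure under scalars includes negatives, so equality of cosets becomes membership of a
  difference.\<close>

locale add_closed =
  fixes N :: "('x \<Rightarrow>\<^sub>0 'k::comm_ring_1) set"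
  assumes zero: "0 \<in> N" and add: "x \<in> N \<Longrightarrow> y \<in> N \<Longrightarrow> x + y \<in> N" and scal: "x \<in> N \<Longrightarrow> scal c x \<in> N"
begin

lemma uminus: "x \<in> N \<Longrightarrow> - x \<in> N"
  using scal[of x "-1"] by (simp add: scal_algebra)

lemma diff: "x \<in> N \<Longrightarrow> y \<in> N \<Longrightarrow> x - y \<in> N"
  using add[of x "- y"] uminus by simp

lemma mem_cs: "y \<in> cs N x \<longleftrightarrow> y - x \<in> N"
  unfolding cs_def by (auto simp: image_iff intro!: bexI[of _ "y - x"])

lemma cs_eq_iff: "cs N x = cs N y \<longleftrightarrow> x - y \<in> N"
proof
  assume "cs N x = cs N y"
  then have "x \<in> cs N y" using mem_cs[of x x] zero by simp
  then show "x - y \<in> N" by (simp add: mem_cs)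
next
  assume d: "x - y \<in> N"
  have "z - x \<in> N \<longleftrightarrow> z - y \<in> N" for z
    using add[OF _ d, of "z - x"] diff[OF _ d, of "z - y"] by auto
  then show "cs N x = cs N y" by (auto simp: mem_cs)
qed

lemma r_coset_cs: "ring.add M = (+) \<Longrightarrow> N +>\<^bsub>M\<^esub> x = cs N x"
  by (auto simp: a_r_coset_def' cs_def)

lemma quotient_carrier:
  "ring.add M = (+) \<Longrightarrow> carrier (quotient_module M N) = cs N ` carrier M"
  by (auto simp: quotient_module_def FactRing_def ring.defs module.defs A_RCOSETS_def' r_coset_cs)

lemma quotient_add: "ring.add M = (+) \<Longrightarrow> cs N x \<oplus>\<^bsub>quotient_module M N\<^esub> cs N y = cs N (x + y)"
proof -
  assume M: "ring.add M = (+)"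
  have "cs N x \<oplus>\<^bsub>quotient_module M N\<^esub> cs N y = (\<Union>a \<in> cs N x. \<Union>b \<in> cs N y. {a + b})"
    by (auto simp: quotient_module_def FactRing_def ring.defs module.defs set_add_def' M)
  also have "\<dots> = cs N (x + y)"
  proof (intro equalityI subsetI)
    fix z assume "z \<in> (\<Union>a \<in> cs N x. \<Union>b \<in> cs N y. {a + b})"
    then obtain a b where "a - x \<in> N" "b - y \<in> N" "z = a + b" by (auto simp: mem_cs)
    then show "z \<in> cs N (x + y)" using add[of "a - x" "b - y"] by (simp add: mem_cs algebra_simps)
  next
    fix z assume "z \<in> cs N (x + y)"
    then have "z - y \<in> cs N x" "y \<in> cs N y" by (simp_all add: mem_cs algebra_simps zero)
    then show "z \<in> (\<Union>a \<in> cs N x. \<Union>b \<in> cs N y. {a + b})" by (intro UN_I[of "z - y"] UN_I[of y]) auto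
  qed
  finally show ?thesis .
qed

lemma quotient_smult:
  "ring.add M = (+) \<Longrightarrow> module.smult M = scal \<Longrightarrow> c \<odot>\<^bsub>quotient_module M N\<^esub> cs N x = cs N (scal c x)"
proof -
  assume M: "ring.add M = (+)" "module.smult M = scal"
  have "c \<odot>\<^bsub>quotient_module M N\<^esub> cs N x = (\<Union>a \<in> cs N x. cs N (scal c a))"
    by (simp add: quotient_module_def FactRing_def ring.defs module.defs M r_coset_cs)
  moreover have "cs N (scal c a) = cs N (scal c x)" if "a \<in> cs N x" for a
    using that scal[of "a - x" c] by (simp add: mem_cs cs_eq_iff scal_algebra)
  moreover have "x \<in> cs N x" by (simp add: mem_cs zero)
  ultimately show ?thesis by blast
qed

end

interpretation qi: add_closed "queer_ideal n" for n
  by unfold_locales (auto intro: ideal_add ideal_scal)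

abbreviation cl :: "nat \<Rightarrow> queer_free \<Rightarrow> queer_free set" where
  "cl n \<equiv> cs (queer_ideal n)"

lemma cl_eq_iff: "cl n p = cl n q \<longleftrightarrow> p - q \<in> queer_ideal n"
  by (rule qi.cs_eq_iff)

section \<open>The operations of the quotient on representatives\<close>

lemma Uq_carrier: "carrier (Uq n) = cl n ` Fc n"
  unfolding Uq_def by (subst qi.quotient_carrier) (simp_all add: carrier_free_algebra)

lemma Uq_add [simp]: "cl n p \<oplus>\<^bsub>Uq n\<^esub> cl n q = cl n (p + q)"
  unfolding Uq_def by (rule qi.quotient_add) simp

lemma Uq_smult [simp]: "c \<odot>\<^bsub>Uq n\<^esub> cl n p = cl n (scal c p)"
  unfolding Uq_def by (rule qi.quotient_smult) simp_all

lemma Uq_one: "\<one>\<^bsub>Uq n\<^esub> = cl n 1"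
  by (simp add: Uq_def quotient_module_def FactRing_def ring.defs module.defs qi.r_coset_cs)

lemma Uq_mult: "p \<in> Fc n \<Longrightarrow> q \<in> Fc n \<Longrightarrow> cl n p \<otimes>\<^bsub>Uq n\<^esub> cl n q = cl n (p * q)"
proof -
  assume p: "p \<in> Fc n" "q \<in> Fc n"
  have "cl n p \<otimes>\<^bsub>Uq n\<^esub> cl n q = (\<Union>a \<in> cl n p. \<Union>b \<in> cl n q. cl n (a * b))"
    by (simp add: Uq_def quotient_module_def FactRing_def ring.defs module.defs rcoset_mult_def qi.r_coset_cs)
  moreover have "cl n (a * b) = cl n (p * q)" if a: "a \<in> cl n p" "b \<in> cl n q" for a b
  proof -
    have ab: "a - p \<in> queer_ideal n" "b - q \<in> queer_ideal n" using a by (simp_all add: qi.mem_cs)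
    then have "a \<in> Fc n" using p ideal_sub[of "a - p" n] Fc_closed(3)[of "a - p" n p] by simp
    then have "(a - p) * q + a * (b - q) \<in> queer_ideal n"
      using ab p by (intro ideal_add ideal_mult_left ideal_mult_right)
    then show ?thesis by (simp add: cl_eq_iff algebra_simps)
  qed
  moreover have "p \<in> cl n p" "q \<in> cl n q" by (simp_all add: qi.mem_cs)
  ultimately show ?thesis by blast
qed

lemma L_gen_cl: "L_gen n i j = cl n (wmon [(i, j)])"
  by (simp add: L_gen_def qi.r_coset_cs free_L_mon)

section \<open>Generated subalgebras as spans of words\<close>

lemma Sp_mult:
  assumes "p \<in> Sp n A" "q \<in> Sp n A" "A \<subseteq> {w. set w \<subseteq> queer_gens n}" "\<And>u v. u \<in> A \<Longrightarrow> v \<in> A \<Longrightarrow> u @ v \<in> A" "p \<in> Fc n" "q \<in> Fc n"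
  shows "p * q \<in> Sp n A"
proof -
  have 1: "wmon u * q \<in> Sp n A" if u: "u \<in> A" for u
  proof -
    have "set u \<subseteq> queer_gens n" using u assms(3) by blast
    then show ?thesis using Sp_app[OF assms(2), of u "[]" A] u assms(4) by (simp add: mon_Nil Sp_word)
  qed
  have "p \<in> {p. p * q \<in> Sp n A}"
  proof (rule Sp_minimal[OF assms(1)])
    show "fv.subspace {p. p * q \<in> Sp n A}"
      by (auto simp: fv.subspace_def algebra_simps mult_scal_left intro: Sp_add Sp_scal Sp_zero)
  qed (use 1 assms(6) in \<open>auto intro: Sp_ideal ideal_mult_right\<close>)
  then show ?thesis by simp
qed

lemma Sp_Fc: "p \<in> Sp n A \<Longrightarrow> A \<subseteq> {w. set w \<subseteq> queer_gens n} \<Longrightarrow> p \<in> Fc n"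
  by (rule Sp_minimal) (auto simp: fv.subspace_def ideal_sub)

lemma Sp_uminus: "p \<in> Sp n A \<Longrightarrow> - p \<in> Sp n A"
  using Sp_scal[of p n A "-1"] by (simp add: scal_algebra)

lemma cl_bexI: "p \<in> A \<Longrightarrow> \<exists>q \<in> A. cl n p = cl n q"
  by blast

lemma one_carrier_ring [simp]: "c \<in> carrier cq_ring"
  by (simp add: ring_of_type_algebra_def)

text \<open>The given generators and the letters of \<open>D\<close> need not match one by one: a
  \<open>q_pow\<close> is the class of a long word. The hypotheses therefore ask for generation in
  both directions.\<close>

lemma subalgebra_generated_words:
  assumes D: "D \<subseteq> queer_gens n"
    and G: "\<And>g. g \<in> G \<Longrightarrow> \<exists>p \<in> Sp n (lists D). g = cl n p"
    and L: "\<And>d. d \<in> D \<Longrightarrow> cl n (wmon [d]) \<in> subalgebra_generated cq_ring (Uq n) G"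
  shows "subalgebra_generated cq_ring (Uq n) G = cl n ` Sp n (lists D)"
proof (intro equalityI subsetI)
  have W: "lists D \<subseteq> {w. set w \<subseteq> queer_gens n}" using D by auto
  fix x assume "x \<in> subalgebra_generated cq_ring (Uq n) G"
  then show "x \<in> cl n ` Sp n (lists D)"
  proof induction
    case one
    have "wmon [] \<in> Sp n (lists D)" by (rule Sp_word) simp
    then show ?case by (auto simp: Uq_one mon_Nil)
  next
    case (incl x)
    then show ?case using G by blast
  next
    case (add x y)
    then show ?case by (auto intro: Sp_add)
  next
    case (mult x y)
    then obtain p q where pq: "x = cl n p" "y = cl n q" "p \<in> Sp n (lists D)" "q \<in> Sp n (lists D)" by auto
    then have "p \<in> Fc n" "q \<in> Fc n" using Sp_Fc W by blast+
    moreover have "p * q \<in> Sp n (lists D)" using pq W calculation by (intro Sp_mult) auto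
    ultimately show ?case using pq by (auto simp: Uq_mult)
  next
    case (smult c x)
    then show ?case by (auto intro: Sp_scal)
  qed
next
  let ?S = "subalgebra_generated cq_ring (Uq n) G"
  fix x assume "x \<in> cl n ` Sp n (lists D)"
  then obtain p where p: "x = cl n p" "p \<in> Sp n (lists D)" by auto
  have z: "cl n 0 \<in> ?S"
    using subalgebra_generated.smult[where R = cq_ring and c = 0 and A = "Uq n" and S = G and x = "\<one>\<^bsub>Uq n\<^esub>"] subalgebra_generated.one[where R = cq_ring and A = "Uq n" and S = G]
    by (simp add: Uq_one scal_algebra)
  have w: "cl n (wmon w) \<in> ?S" if "set w \<subseteq> D" for w
    using that
  proof (induction w)
    case Nil
    then show ?case using subalgebra_generated.one[where R = cq_ring and A = "Uq n" and S = G] by (simp add: mon_Nil Uq_one)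
  next
    case (Cons d w)
    have "cl n (wmon [d]) \<otimes>\<^bsub>Uq n\<^esub> cl n (wmon w) \<in> ?S" using Cons L by (intro subalgebra_generated.mult) auto
    moreover have "wmon [d] \<in> Fc n" "wmon w \<in> Fc n" using Cons.prems D by auto
    ultimately show ?case by (simp add: Uq_mult flip: mon_append)
  qed
  have "p \<in> {p. cl n p \<in> ?S}"
  proof (rule Sp_minimal[OF p(2)])
    show "queer_ideal n \<subseteq> {p. cl n p \<in> ?S}"
    proof
      fix q assume "q \<in> queer_ideal n"
      then have "cl n q = cl n 0" by (simp add: cl_eq_iff)
      then show "q \<in> {p. cl n p \<in> ?S}" using z by simp
    qed
    show "fv.subspace {p. cl n p \<in> ?S}"
      unfolding fv.subspace_def
    proof (intro conjI ballI allI)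
      show "0 \<in> {p. cl n p \<in> ?S}" using z by simp
      show "x + y \<in> {p. cl n p \<in> ?S}" if "x \<in> {p. cl n p \<in> ?S}" "y \<in> {p. cl n p \<in> ?S}" for x y
        using that subalgebra_generated.add[where R = cq_ring and A = "Uq n" and S = G and x = "cl n x" and y = "cl n y"] by simp
      show "scal c x \<in> {p. cl n p \<in> ?S}" if "x \<in> {p. cl n p \<in> ?S}" for c x
        using that subalgebra_generated.smult[where R = cq_ring and A = "Uq n" and S = G and x = "cl n x" and c = c] by simp
    qed
  qed (use w in auto)
  then show "x \<in> ?S" using p by simp
qed

lemma smult_letter:
  assumes "c \<odot>\<^bsub>Uq n\<^esub> cl n p \<in> subalgebra_generated cq_ring (Uq n) G" "c \<noteq> 0"
  shows "cl n p \<in> subalgebra_generated cq_ring (Uq n) G"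
  using subalgebra_generated.smult[where c = "inverse c", OF _ assms(1)] assms(2) by (simp add: scal_algebra)

lemma minus_words_lists: "minus_words n = lists (mlet n)" and plus_words_lists: "plus_words n = lists (plet n)"
  by (auto simp: minus_words_iff plus_words_iff)

lemma Uq_minus_words: "Uq_minus n = cl n ` Sp n (minus_words n)"
  unfolding Uq_minus_def minus_words_lists
proof (rule subalgebra_generated_words)
  let ?G = "f_gen n ` {1..int n - 1} \<union> f_bar n ` {1..int n - 1}"
  show "mlet n \<subseteq> queer_gens n" using let_gens by auto
  have l: "[(i, i + 1)] \<in> lists (mlet n)" "[(-i, i + 1)] \<in> lists (mlet n)" if "i \<in> {1..int n - 1}" for i
    using that by (auto simp: mlet_iff)
  show "\<exists>p \<in> Sp n (lists (mlet n)). g = cl n p" if "g \<in> ?G" for g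
    using that by (auto simp: f_gen_def f_bar_def L_gen_cl intro!: cl_bexI Sp_uminus Sp_scal Sp_word l)
  show "cl n (wmon [d]) \<in> subalgebra_generated cq_ring (Uq n) ?G" if d: "d \<in> mlet n" for d
  proof -
    obtain i j where ij: "d = (i, j)" by force
    have i: "\<bar>i\<bar> \<in> {1..int n - 1}" "j = \<bar>i\<bar> + 1" using d by (auto simp: ij mlet_iff)
    show ?thesis
    proof (cases "i > 0")
      case True
      then have "f_gen n i \<in> ?G" using i by auto
      then have "(1 / zq) \<odot>\<^bsub>Uq n\<^esub> cl n (wmon [d]) \<in> subalgebra_generated cq_ring (Uq n) ?G"
        unfolding f_gen_def L_gen_cl zq_def[symmetric] using True i by (auto simp: ij intro: subalgebra_generated.incl)
      then show ?thesis by (rule smult_letter) simp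
    next
      case False
      then have "f_bar n (-i) \<in> ?G" using i by auto
      then have "(- (1 / zq)) \<odot>\<^bsub>Uq n\<^esub> cl n (wmon [d]) \<in> subalgebra_generated cq_ring (Uq n) ?G"
        unfolding f_bar_def L_gen_cl zq_def[symmetric] using False i by (auto simp: ij intro: subalgebra_generated.incl)
      then show ?thesis by (rule smult_letter) simp
    qed
  qed
qed

lemma Uq_plus_words: "Uq_plus n = cl n ` Sp n (plus_words n)"
  unfolding Uq_plus_def plus_words_lists
proof (rule subalgebra_generated_words)
  let ?G = "e_gen n ` {1..int n - 1} \<union> e_bar n ` {1..int n - 1}"
  show "plet n \<subseteq> queer_gens n" using let_gens by auto
  have l: "[(-i - 1, -i)] \<in> lists (plet n)" "[(-i - 1, i)] \<in> lists (plet n)" if "i \<in> {1..int n - 1}" for i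
    using that by (auto simp: plet_iff)
  show "\<exists>p \<in> Sp n (lists (plet n)). g = cl n p" if "g \<in> ?G" for g
    using that by (auto simp: e_gen_def e_bar_def L_gen_cl intro!: cl_bexI Sp_uminus Sp_scal Sp_word l)
  show "cl n (wmon [d]) \<in> subalgebra_generated cq_ring (Uq n) ?G" if d: "d \<in> plet n" for d
  proof -
    obtain i j where ij: "d = (i, j)" by force
    have i: "\<bar>j\<bar> \<in> {1..int n - 1}" "i = - \<bar>j\<bar> - 1" using d by (auto simp: ij plet_iff)
    show ?thesis
    proof (cases "j > 0")
      case True
      then have "e_bar n j \<in> ?G" using i by auto
      then have "(- (1 / zq)) \<odot>\<^bsub>Uq n\<^esub> cl n (wmon [d]) \<in> subalgebra_generated cq_ring (Uq n) ?G"
        unfolding e_bar_def L_gen_cl zq_def[symmetric] using True i by (auto simp: ij intro: subalgebra_generated.incl)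
      then show ?thesis by (rule smult_letter) simp
    next
      case False
      then have "e_gen n (-j) \<in> ?G" using i by auto
      then have "(- (1 / zq)) \<odot>\<^bsub>Uq n\<^esub> cl n (wmon [d]) \<in> subalgebra_generated cq_ring (Uq n) ?G"
        unfolding e_gen_def L_gen_cl zq_def[symmetric] using False i by (auto simp: ij intro: subalgebra_generated.incl)
      then show ?thesis by (rule smult_letter) simp
    qed
  qed
qed

lemma monoid_Uq: "Group.monoid (Uq n)"
  by (rule monoidI) (auto simp: Uq_carrier Uq_one Uq_mult mult.assoc)

lemma pow_diag: "i \<in> queer_index n \<Longrightarrow> cl n (wmon [(i, i)]) [^]\<^bsub>Uq n\<^esub> (m :: nat) = cl n (wmon (replicate m (i, i)))"
proof (induction m)
  case 0
  then show ?case by (simp add: Uq_one mon_Nil)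
next
  case (Suc m)
  have "set (replicate m (i, i)) \<subseteq> queer_gens n" using Suc.prems by (cases m) (auto simp: diag_gens)
  then show ?case using Suc by (simp add: diag_gens Uq_mult flip: mon_append replicate_append_same)
qed

text \<open>A negative power is defined through the inverse in the monoid \<open>Uq n\<close>, which
  has to be identified with the class of a word in the letter \<open>(-i, -i)\<close>.\<close>

lemma int_pow_diag: "i \<in> {1..int n} \<Longrightarrow> L_gen n i i [^]\<^bsub>Uq n\<^esub> (z :: int) = cl n (wmon (block i z))"
proof -
  assume i: "i \<in> {1..int n}"
  then have ix: "i \<in> queer_index n" "-i \<in> queer_index n" by (auto simp: queer_index_def)
  show ?thesis
  proof (cases "z < 0")
    case False
    then show ?thesis by (simp add: L_gen_cl int_pow_def2 pow_diag[OF ix(1)] block_def)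
  next
    case True
    let ?m = "nat (- z)"
    have g: "set (replicate m (a, a)) \<subseteq> queer_gens n" if "a \<in> queer_index n" for m a using that by (cases m) (auto simp: diag_gens)
    have c: "weq n (replicate m (a, a) @ replicate m (-a, -a)) []" if a: "a \<in> queer_index n" for m a
    proof (induction m)
      case (Suc m)
      have "weq n (replicate m (a, a) @ [(a, a), (-a, -a)] @ replicate m (-a, -a)) (replicate m (a, a) @ [] @ replicate m (-a, -a))"
        using a by (intro weq_app weq_diag_cancel g) simp_all
      then have "weq n (replicate (Suc m) (a, a) @ replicate (Suc m) (-a, -a)) (replicate m (a, a) @ replicate m (-a, -a))"
        by (simp add: replicate_app_Cons_same)
      then show ?case using Suc weq_trans by blast
    qed simp
    interpret m: Group.monoid "Uq n" by (rule monoid_Uq)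
    have "inv\<^bsub>Uq n\<^esub> (cl n (wmon (replicate ?m (i, i)))) = cl n (wmon (replicate ?m (-i, -i)))"
    proof (rule m.inv_char)
      show "cl n (wmon (replicate ?m (i, i))) \<otimes>\<^bsub>Uq n\<^esub> cl n (wmon (replicate ?m (-i, -i))) = \<one>\<^bsub>Uq n\<^esub>"
        using c[OF ix(1), of ?m] g ix by (simp add: Uq_mult Uq_one cl_eq_iff weq_ideal flip: mon_append mon_Nil)
      show "cl n (wmon (replicate ?m (-i, -i))) \<otimes>\<^bsub>Uq n\<^esub> cl n (wmon (replicate ?m (i, i))) = \<one>\<^bsub>Uq n\<^esub>"
        using c[OF ix(2), of ?m] g ix by (simp add: Uq_mult Uq_one cl_eq_iff weq_ideal flip: mon_append mon_Nil)
    qed (use g ix in \<open>auto simp: Uq_carrier\<close>)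
    then show ?thesis using True by (simp add: L_gen_cl int_pow_def2 pow_diag[OF ix(1)] block_def)
  qed
qed

lemma q_pow_kw: "q_pow n a = cl n (wmon (kw n a))"
proof -
  have "foldr (\<lambda>i x. (L_gen n i i [^]\<^bsub>Uq n\<^esub> a i) \<otimes>\<^bsub>Uq n\<^esub> x) l \<one>\<^bsub>Uq n\<^esub> = cl n (wmon (blocks l a))" if "set l \<subseteq> {1..int n}" for l
    using that
  proof (induction l)
    case Nil
    then show ?case by (simp add: Uq_one blocks_def mon_Nil)
  next
    case (Cons i l)
    have "set (block i (a i)) \<subseteq> queer_gens n" using Cons.prems zero_letter_block zero_letter_gens by auto
    moreover have "set (blocks l a) \<subseteq> queer_gens n" using Cons.prems by (intro gens_blocks) auto
    ultimately have "cl n (wmon (block i (a i))) \<otimes>\<^bsub>Uq n\<^esub> cl n (wmon (blocks l a)) = cl n (wmon (blocks (i # l) a))"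
      by (simp add: Uq_mult mon_append blocks_def)
    then show ?case using Cons by (simp add: int_pow_diag)
  qed
  then show ?thesis by (simp add: q_pow_def)
qed

lemma ywords_lists: "ywords n \<subseteq> lists (zlet n)"
proof
  fix w assume "w \<in> ywords n"
  then obtain S g where w: "w = yw n S g" "S \<subseteq> {1..int n}" by (auto simp: ywords_def zero_index_def)
  then have "finite S" using finite_subset by blast
  then have "p \<in> zlet n" if "p \<in> set (odd_word (sorted_list_of_set S))" for p
    using that w(2) by (auto simp: zlet_iff)
  moreover have "p \<in> zlet n" if "p \<in> set (kw n g)" for p
    using that zero_letter_blocks[of "[1..int n]" n] by (simp add: zlet_def)
  ultimately show "w \<in> lists (zlet n)" using w(1) by (auto simp: yw_def)
qed

lemma Uq_zero_words: "Uq_zero n = cl n ` Sp n (ywords n)"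
proof -
  let ?G = "q_pow n ` P_dual n \<union> k_bar n ` {1..int n}"
  have "Uq_zero n = cl n ` Sp n (lists (zlet n))"
    unfolding Uq_zero_def
  proof (rule subalgebra_generated_words)
    show "zlet n \<subseteq> queer_gens n" using let_gens by auto
    have l: "kw n a \<in> lists (zlet n)" for a using zero_letter_blocks[of "[1..int n]" n] by (auto simp: zlet_def)
    have l': "[(-i, i)] \<in> lists (zlet n)" if "i \<in> {1..int n}" for i using that by (auto simp: zlet_iff)
    show "\<exists>p \<in> Sp n (lists (zlet n)). g = cl n p" if "g \<in> ?G" for g
      using that by (auto simp: q_pow_kw k_bar_def L_gen_cl intro!: cl_bexI Sp_uminus Sp_scal Sp_word l l')
    show "cl n (wmon [d]) \<in> subalgebra_generated cq_ring (Uq n) ?G" if d: "d \<in> zlet n" for d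
    proof -
      obtain i j where ij: "d = (i, j)" by force
      consider "i = j" "i \<in> queer_index n" | "i = -j" "j \<in> {1..int n}" using d by (auto simp: ij zlet_def zero_letter_def)
      then show ?thesis
      proof cases
        case 1
        \<comment> \<open>The exponents of the single letter \<open>d\<close>, a unit vector or its
          negative; \<open>restrict\<close> makes the function extensional, as \<open>P_dual\<close>
          requires.\<close>
        define a where "a = restrict (cnt [d]) {1..int n}"
        have z: "\<forall>p \<in> set [d]. zero_letter n p" using d by (simp add: zlet_def)
        have "weq n [d] (kw n (cnt [d]))" using weq_normal_form[OF z] 1 by (simp add: ij del: cnt_simps)
        moreover have "kw n (cnt [d]) = kw n a" unfolding a_def by (rule blocks_cong) simp
        ultimately have "cl n (wmon [d]) = q_pow n a" by (simp add: q_pow_kw cl_eq_iff weq_ideal)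
        moreover have "a \<in> P_dual n" by (simp add: a_def P_dual_def)
        ultimately show ?thesis by (auto intro: subalgebra_generated.incl)
      next
        case 2
        then have "k_bar n j \<in> ?G" by auto
        then have "(- (1 / zq)) \<odot>\<^bsub>Uq n\<^esub> cl n (wmon [d]) \<in> subalgebra_generated cq_ring (Uq n) ?G"
          unfolding k_bar_def L_gen_cl zq_def[symmetric] using 2 by (auto simp: ij intro: subalgebra_generated.incl)
        then show ?thesis by (rule smult_letter) simp
      qed
    qed
  qed
  moreover have "Sp n (lists (zlet n)) = Sp n (ywords n)"
  proof (intro equalityI subsetI)
    fix p assume "p \<in> Sp n (lists (zlet n))"
    then show "p \<in> Sp n (ywords n)" by (rule Sp_trans) (auto intro!: zero_words_span simp: zlet_def)
  next
    fix p assume "p \<in> Sp n (ywords n)"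
    then show "p \<in> Sp n (lists (zlet n))" using ywords_lists by (rule Sp_mono)
  qed
  ultimately show ?thesis by simp
qed

section \<open>Tensor products\<close>

definition free_on :: "'x set \<Rightarrow> ('x \<Rightarrow>\<^sub>0 'k::comm_ring_1) set" where
  "free_on A = {p. keys p \<subseteq> A}"

lemma free_module_simps [simp]:
  "carrier (free_module A) = free_on A" "ring.add (free_module A) = (+)" "module.smult (free_module A) = scal"
  "ring.zero (free_module A) = 0"
  by (simp_all add: free_module_def free_on_def)

lemma free_on_closed: "add_closed (free_on A)"
proof
  show "x + y \<in> free_on A" if "x \<in> free_on A" "y \<in> free_on A" for x y :: "'a \<Rightarrow>\<^sub>0 'b"
    using that Poly_Mapping.keys_add[of x y] by (auto simp: free_on_def)
  show "scal c x \<in> free_on A" if "x \<in> free_on A" for c and x :: "'a \<Rightarrow>\<^sub>0 'b"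
    using that keys_scal[of c x] by (auto simp: free_on_def)
qed (simp add: free_on_def)

lemma module_free_module: "module ring_of_type_algebra (free_module A :: ('k::comm_ring_1, 'x \<Rightarrow>\<^sub>0 'k) module)"
proof (rule moduleI)
  interpret F: add_closed "free_on A :: ('x \<Rightarrow>\<^sub>0 'k) set" by (rule free_on_closed)
  show "cring (ring_of_type_algebra :: 'k ring)" by (rule cring_from_type_algebra)
  show "abelian_group (free_module A :: ('k, 'x \<Rightarrow>\<^sub>0 'k) module)"
  proof (rule abelian_groupI)
    fix x :: "'x \<Rightarrow>\<^sub>0 'k" assume "x \<in> carrier (free_module A)"
    then show "\<exists>y \<in> carrier (free_module A). y \<oplus>\<^bsub>free_module A\<^esub> x = \<zero>\<^bsub>free_module A\<^esub>"
      by (intro bexI[of _ "- x"]) (simp_all add: F.uminus)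
  qed (auto simp: F.add F.zero algebra_simps)
qed (auto simp: ring_of_type_algebra_def free_on_closed[THEN add_closed.scal] scal_algebra)

lemma submodule_free_module:
  assumes "add_closed J" "J \<subseteq> free_on A"
  shows "submodule J ring_of_type_algebra (free_module A :: ('k::comm_ring_1, 'x \<Rightarrow>\<^sub>0 'k) module)"
proof -
  interpret J: add_closed J by (rule assms)
  interpret M: module "ring_of_type_algebra :: 'k ring" "free_module A" by (rule module_free_module)
  show ?thesis
  proof (rule M.submoduleI)
    show "\<ominus>\<^bsub>free_module A\<^esub> a \<in> J" if "a \<in> J" for a
    proof -
      have "\<ominus>\<^bsub>free_module A\<^esub> a = - a"
        using that assms(2) J.uminus[OF that] by (intro M.minus_equality) auto
      then show ?thesis using J.uminus[OF that] by simp
    qed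
  qed (use assms J.zero J.add J.scal in auto)
qed

lemma add_closed_submodule:
  assumes "submodule J ring_of_type_algebra (free_module A :: ('k::comm_ring_1, 'x \<Rightarrow>\<^sub>0 'k) module)"
  shows "add_closed J" "J \<subseteq> free_on A"
proof -
  interpret submodule J "ring_of_type_algebra :: 'k ring" "free_module A" by (rule assms)
  show "J \<subseteq> free_on A" using subset by simp
  show "add_closed J"
    using one_closed m_closed smult_closed by unfold_locales (auto simp: ring_of_type_algebra_def)
qed

text \<open>Closure of the carriers is what puts the relators into the free module. Zero vectors
  enter later in the form \<open>0 \<odot> x\<close>.\<close>

locale tensor =
  fixes M :: "('k::comm_ring_1, 'a, 'm) module_scheme" and N :: "('k, 'b, 'n) module_scheme"
  assumes M_add: "x \<in> carrier M \<Longrightarrow> x' \<in> carrier M \<Longrightarrow> x \<oplus>\<^bsub>M\<^esub> x' \<in> carrier M"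
    and M_smult: "x \<in> carrier M \<Longrightarrow> c \<odot>\<^bsub>M\<^esub> x \<in> carrier M"
    and N_add: "y \<in> carrier N \<Longrightarrow> y' \<in> carrier N \<Longrightarrow> y \<oplus>\<^bsub>N\<^esub> y' \<in> carrier N"
    and N_smult: "y \<in> carrier N \<Longrightarrow> c \<odot>\<^bsub>N\<^esub> y \<in> carrier N"
begin

abbreviation null :: "('a \<times> 'b \<Rightarrow>\<^sub>0 'k) set" where
  "null \<equiv> tensor_null M N"

abbreviation dl :: "'a \<Rightarrow> 'b \<Rightarrow> ('a \<times> 'b \<Rightarrow>\<^sub>0 'k)" where
  "dl x y \<equiv> Poly_Mapping.single (x, y) 1"

abbreviation Fr :: "('a \<times> 'b \<Rightarrow>\<^sub>0 'k) set" where
  "Fr \<equiv> free_on (carrier M \<times> carrier N)"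

lemma dl_Fr: "x \<in> carrier M \<Longrightarrow> y \<in> carrier N \<Longrightarrow> Poly_Mapping.single (x, y) c \<in> Fr"
  by (simp add: free_on_def)

sublocale Fr: add_closed Fr
  by (rule free_on_closed)

lemma relators_Fr: "tensor_relators M N \<subseteq> Fr"
  unfolding tensor_relators_def Let_def
  by (auto intro!: Fr.diff Fr.scal dl_Fr M_add M_smult N_add N_smult)

lemma null_iff:
  "p \<in> null \<longleftrightarrow> (\<forall>J. submodule J ring_of_type_algebra (free_module (carrier M \<times> carrier N)) \<longrightarrow>
    tensor_relators M N \<subseteq> J \<longrightarrow> p \<in> J)"
  by (auto simp: tensor_null_def submodule_generated_def)

sublocale null: add_closed null
proof
  note J = add_closed_submodule(1)
  show "0 \<in> null" using J add_closed.zero unfolding null_iff by blast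
  show "x + y \<in> null" if x: "x \<in> null" and y: "y \<in> null" for x y
    unfolding null_iff
  proof (intro allI impI)
    fix J assume "submodule J ring_of_type_algebra (free_module (carrier M \<times> carrier N))" "tensor_relators M N \<subseteq> J"
    then show "x + y \<in> J" using x y J add_closed.add unfolding null_iff by blast
  qed
  show "scal c x \<in> null" if x: "x \<in> null" for c x
    unfolding null_iff
  proof (intro allI impI)
    fix J assume "submodule J ring_of_type_algebra (free_module (carrier M \<times> carrier N))" "tensor_relators M N \<subseteq> J"
    then show "scal c x \<in> J" using x J add_closed.scal unfolding null_iff by blast
  qed
qed

lemma null_minimal: "add_closed J \<Longrightarrow> J \<subseteq> Fr \<Longrightarrow> tensor_relators M N \<subseteq> J \<Longrightarrow> null \<subseteq> J"
  unfolding tensor_null_def submodule_generated_def using submodule_free_module by blast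

lemma null_relators: "tensor_relators M N \<subseteq> null"
  unfolding tensor_null_def submodule_generated_def by blast

lemma null_rules:
  "x \<in> carrier M \<Longrightarrow> x' \<in> carrier M \<Longrightarrow> y \<in> carrier N \<Longrightarrow> dl (x \<oplus>\<^bsub>M\<^esub> x') y - dl x y - dl x' y \<in> null"
  "x \<in> carrier M \<Longrightarrow> y \<in> carrier N \<Longrightarrow> y' \<in> carrier N \<Longrightarrow> dl x (y \<oplus>\<^bsub>N\<^esub> y') - dl x y - dl x y' \<in> null"
  "x \<in> carrier M \<Longrightarrow> y \<in> carrier N \<Longrightarrow> dl (c \<odot>\<^bsub>M\<^esub> x) y - scal c (dl x y) \<in> null"
  "x \<in> carrier M \<Longrightarrow> y \<in> carrier N \<Longrightarrow> dl x (c \<odot>\<^bsub>N\<^esub> y) - scal c (dl x y) \<in> null"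
  by (rule subsetD[OF null_relators], unfold tensor_relators_def Let_def, blast)+

lemma tensor_carrier: "carrier (tensor_product M N) = cs null ` Fr"
  unfolding tensor_product_def by (subst null.quotient_carrier) simp_all

lemma tensor_add: "cs null p \<oplus>\<^bsub>tensor_product M N\<^esub> cs null q = cs null (p + q)"
  unfolding tensor_product_def by (rule null.quotient_add) simp

lemma tensor_smult: "c \<odot>\<^bsub>tensor_product M N\<^esub> cs null p = cs null (scal c p)"
  unfolding tensor_product_def by (rule null.quotient_smult) simp_all

lemma pure_tensor_cs: "pure_tensor M N x y = cs null (dl x y)"
  unfolding pure_tensor_def by (rule null.r_coset_cs) simp

definition rep :: "('a \<times> 'b \<Rightarrow>\<^sub>0 'k) set \<Rightarrow> ('a \<times> 'b \<Rightarrow>\<^sub>0 'k)" where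
  "rep t = (SOME p. p \<in> Fr \<and> t = cs null p)"

lemma rep: "t \<in> carrier (tensor_product M N) \<Longrightarrow> rep t \<in> Fr \<and> t = cs null (rep t)"
  unfolding rep_def tensor_carrier by (rule someI_ex) blast

end

section \<open>Linear maps out of a tensor product\<close>

text \<open>The values lie in the free algebra, where addition and scaling are operations of a type.
  A map into \<open>Uq n\<close> then needs a \<open>B\<close> that is bilinear modulo the
  ideal.\<close>

definition lext :: "('x \<Rightarrow> queer_free) \<Rightarrow> ('x \<Rightarrow>\<^sub>0 cq) \<Rightarrow> queer_free" where
  "lext B p = (\<Sum>x \<in> keys p. scal (lookup p x) (B x))"

lemma lext_superset: "finite A \<Longrightarrow> keys p \<subseteq> A \<Longrightarrow> lext B p = (\<Sum>x \<in> A. scal (lookup p x) (B x))"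
  unfolding lext_def by (rule sum.mono_neutral_left) (auto simp: in_keys_iff scal_algebra)

lemma lext_simps [simp]:
  "lext B 0 = 0" "lext B (p + q) = lext B p + lext B q" "lext B (scal c p) = scal c (lext B p)"
  "lext B (p - q) = lext B p - lext B q" "lext B (Poly_Mapping.single x c) = scal c (B x)"
proof -
  show s: "lext B (scal c p) = scal c (lext B p)" for c p
    using keys_scal[of c p] by (subst (1 2) lext_superset[of "keys p"]) (simp_all add: scal_sum scal_algebra)
  show a: "lext B (p + q) = lext B p + lext B q" for p q
    using Poly_Mapping.keys_add[of p q]
    by (simp add: lext_superset[of "keys p \<union> keys q"] lookup_add scal_algebra sum.distrib)
  show "lext B 0 = 0" by (simp add: lext_def)
  show "lext B (p - q) = lext B p - lext B q"
    using a[of p "scal (-1) q"] s[of "-1" q] by (simp add: scal_algebra)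
  show "lext B (Poly_Mapping.single x c) = scal c (B x)" by (simp add: lext_def scal_algebra)
qed

lemma lext_sum: "lext B (\<Sum>x \<in> A. f x) = (\<Sum>x \<in> A. lext B (f x))"
  by (induction A rule: infinite_finite_induct) simp_all

locale bilinear_lift = tensor M N
  for M :: "(cq, 'a, 'm) module_scheme" and N :: "(cq, 'b, 'n) module_scheme" +
  fixes n :: nat and B :: "'a \<times> 'b \<Rightarrow> queer_free"
  assumes B_closed: "x \<in> carrier M \<Longrightarrow> y \<in> carrier N \<Longrightarrow> B (x, y) \<in> Fc n"
    and B_rules:
      "x \<in> carrier M \<Longrightarrow> x' \<in> carrier M \<Longrightarrow> y \<in> carrier N \<Longrightarrow> B (x \<oplus>\<^bsub>M\<^esub> x', y) - B (x, y) - B (x', y) \<in> queer_ideal n"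
      "x \<in> carrier M \<Longrightarrow> y \<in> carrier N \<Longrightarrow> y' \<in> carrier N \<Longrightarrow> B (x, y \<oplus>\<^bsub>N\<^esub> y') - B (x, y) - B (x, y') \<in> queer_ideal n"
      "x \<in> carrier M \<Longrightarrow> y \<in> carrier N \<Longrightarrow> B (c \<odot>\<^bsub>M\<^esub> x, y) - scal c (B (x, y)) \<in> queer_ideal n"
      "x \<in> carrier M \<Longrightarrow> y \<in> carrier N \<Longrightarrow> B (x, c \<odot>\<^bsub>N\<^esub> y) - scal c (B (x, y)) \<in> queer_ideal n"
begin

lemma lext_null: "p \<in> null \<Longrightarrow> lext B p \<in> queer_ideal n"
proof -
  have "null \<subseteq> {p \<in> Fr. lext B p \<in> queer_ideal n}"
  proof (rule null_minimal)
    show "add_closed {p \<in> Fr. lext B p \<in> queer_ideal n}"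
      by unfold_locales (auto intro: Fr.zero Fr.add Fr.scal ideal_add ideal_scal)
    show "tensor_relators M N \<subseteq> {p \<in> Fr. lext B p \<in> queer_ideal n}"
    proof
      fix r assume r: "r \<in> tensor_relators M N"
      then have "lext B r \<in> queer_ideal n"
        unfolding tensor_relators_def Let_def by (auto simp: scal_algebra B_rules simp del: map_single)
      then show "r \<in> {p \<in> Fr. lext B p \<in> queer_ideal n}" using r relators_Fr by auto
    qed
  qed auto
  then show "p \<in> null \<Longrightarrow> lext B p \<in> queer_ideal n" by blast
qed

lemma lext_closed: "p \<in> Fr \<Longrightarrow> lext B p \<in> Fc n"
  unfolding lext_def free_on_def by (auto intro!: Fc_sum Fc_closed B_closed)

definition lift :: "('a \<times> 'b \<Rightarrow>\<^sub>0 cq) set \<Rightarrow> queer_free set" where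
  "lift t = cl n (lext B (rep t))"

lemma lext_rep: "p \<in> Fr \<Longrightarrow> lext B (rep (cs null p)) - lext B p \<in> queer_ideal n"
proof -
  assume "p \<in> Fr"
  then have "cs null p = cs null (rep (cs null p))" using rep by (auto simp: tensor_carrier)
  then have "rep (cs null p) - p \<in> null" using null.cs_eq_iff by metis
  then show ?thesis using lext_null by fastforce
qed

lemma lift_cs: "p \<in> Fr \<Longrightarrow> lift (cs null p) = cl n (lext B p)"
  by (simp add: lift_def cl_eq_iff lext_rep)

lemma lift_hom:
  "t \<in> carrier (tensor_product M N) \<Longrightarrow> t' \<in> carrier (tensor_product M N) \<Longrightarrow>
    lift (t \<oplus>\<^bsub>tensor_product M N\<^esub> t') = lift t \<oplus>\<^bsub>Uq n\<^esub> lift t'"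
  "t \<in> carrier (tensor_product M N) \<Longrightarrow> lift (c \<odot>\<^bsub>tensor_product M N\<^esub> t) = c \<odot>\<^bsub>Uq n\<^esub> lift t"
  by (auto simp: tensor_carrier tensor_add tensor_smult lift_cs Fr.add Fr.scal)

end

section \<open>Tensors whose second factor is spanned by words\<close>

locale span_tensor = tensor M "(Uq n)\<lparr>carrier := cl n ` Sp n A\<rparr>"
  for M :: "(cq, 'a, 'm) module_scheme" and n A +
  assumes nonempty: "carrier M \<noteq> {}"
begin

abbreviation "N \<equiv> (Uq n)\<lparr>carrier := cl n ` Sp n A\<rparr>"

lemma null_zero_left: "x \<in> carrier M \<Longrightarrow> y \<in> carrier N \<Longrightarrow> dl (0 \<odot>\<^bsub>M\<^esub> x) y \<in> null"
  using null_rules(3)[of x y 0] by (simp add: scal_algebra)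

text \<open>At most one summand occurs for each word of the second factor, so injectivity becomes a
  statement about the family of coefficients \<open>x\<close>. This family is total, so that two of
  them can be added on the union of their index sets.\<close>

definition normal :: "('a \<times> queer_free set \<Rightarrow>\<^sub>0 cq) \<Rightarrow> bool" where
  "normal p \<longleftrightarrow> (\<exists>J x. finite J \<and> J \<subseteq> A \<and> (\<forall>a. x a \<in> carrier M) \<and> p - (\<Sum>a \<in> J. dl (x a) (cl n (wmon a))) \<in> null)"

lemma word_N: "a \<in> A \<Longrightarrow> cl n (wmon a) \<in> carrier N"
  by (simp add: Sp_word)

lemma normal_cong: "normal p \<Longrightarrow> q - p \<in> null \<Longrightarrow> normal q"
proof -
  assume p: "normal p" and q: "q - p \<in> null"
  then obtain J x where J: "finite J" "J \<subseteq> A" "\<forall>a. x a \<in> carrier M" "p - (\<Sum>a \<in> J. dl (x a) (cl n (wmon a))) \<in> null"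
    by (auto simp: normal_def)
  have "(q - p) + (p - (\<Sum>a \<in> J. dl (x a) (cl n (wmon a)))) \<in> null" by (rule null.add[OF q J(4)])
  then show "normal q" unfolding normal_def using J(1-3) by (intro exI[of _ J] exI[of _ x]) simp
qed

lemma null_sum: "(\<And>x. x \<in> J \<Longrightarrow> f x \<in> null) \<Longrightarrow> (\<Sum>x \<in> J. f x) \<in> null"
  by (induction J rule: infinite_finite_induct) (simp_all add: null.zero null.add)

lemma normal_add:
  assumes "normal p" "normal q"
  shows "normal (p + q)"
proof -
  obtain x0 where x0: "x0 \<in> carrier M" using nonempty by blast
  \<comment> \<open>A stand-in for the zero vector of \<open>M\<close>; it serves as coefficient at
    the words outside an index set, where the pure tensor is null by
    \<open>null_zero_left\<close>.\<close>
  let ?z = "0 \<odot>\<^bsub>M\<^esub> x0" and ?s = "\<lambda>J x. \<Sum>a \<in> J. dl (x a) (cl n (wmon a))"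
  obtain J x where J: "finite J" "J \<subseteq> A" "\<forall>a. x a \<in> carrier M" "p - ?s J x \<in> null"
    using assms(1) by (auto simp: normal_def)
  obtain J' x' where J': "finite J'" "J' \<subseteq> A" "\<forall>a. x' a \<in> carrier M" "q - ?s J' x' \<in> null"
    using assms(2) by (auto simp: normal_def)
  define u where "u a = (if a \<in> J then x a else ?z)" for a
  define u' where "u' a = (if a \<in> J' then x' a else ?z)" for a
  have U: "u a \<in> carrier M" "u' a \<in> carrier M" for a using J(3) J'(3) M_smult[OF x0] by (auto simp: u_def u'_def)
  have 1: "?s (J \<union> J') u - ?s J x \<in> null"
  proof -
    have "?s (J \<union> J') u = ?s J u + ?s (J' - J) u"
      using J(1) J'(1) sum.union_disjoint[of J "J' - J" "\<lambda>a. dl (u a) (cl n (wmon a))"] by simp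
    moreover have "?s J u = ?s J x" by (rule sum.cong) (simp_all add: u_def)
    moreover have "?s (J' - J) u \<in> null" using J'(2) by (intro null_sum) (auto simp: u_def intro!: null_zero_left[OF x0] word_N)
    ultimately show ?thesis by simp
  qed
  have 2: "?s (J \<union> J') u' - ?s J' x' \<in> null"
  proof -
    have "?s (J \<union> J') u' = ?s J' u' + ?s (J - J') u'"
      using J(1) J'(1) sum.union_disjoint[of J' "J - J'" "\<lambda>a. dl (u' a) (cl n (wmon a))"] by (simp add: Un_commute)
    moreover have "?s J' u' = ?s J' x'" by (rule sum.cong) (simp_all add: u'_def)
    moreover have "?s (J - J') u' \<in> null" using J(2) by (intro null_sum) (auto simp: u'_def intro!: null_zero_left[OF x0] word_N)
    ultimately show ?thesis by simp
  qed
  have 3: "?s (J \<union> J') (\<lambda>a. u a \<oplus>\<^bsub>M\<^esub> u' a) - ?s (J \<union> J') u - ?s (J \<union> J') u' \<in> null"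
  proof -
    have "(\<Sum>a \<in> J \<union> J'. dl (u a \<oplus>\<^bsub>M\<^esub> u' a) (cl n (wmon a)) - dl (u a) (cl n (wmon a)) - dl (u' a) (cl n (wmon a))) \<in> null"
      using U J(2) J'(2) by (intro null_sum null_rules(1) word_N) auto
    then show ?thesis by (simp only: sum_subtractf)
  qed
  have "(p - ?s J x) + (q - ?s J' x') - (?s (J \<union> J') u - ?s J x) - (?s (J \<union> J') u' - ?s J' x')
     - (?s (J \<union> J') (\<lambda>a. u a \<oplus>\<^bsub>M\<^esub> u' a) - ?s (J \<union> J') u - ?s (J \<union> J') u') \<in> null"
    by (intro null.diff null.add J(4) J'(4) 1 2 3)
  then have "p + q - ?s (J \<union> J') (\<lambda>a. u a \<oplus>\<^bsub>M\<^esub> u' a) \<in> null" by (simp add: algebra_simps)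
  then show ?thesis unfolding normal_def using J(1,2) J'(1,2) U M_add
    by (intro exI[of _ "J \<union> J'"] exI[of _ "\<lambda>a. u a \<oplus>\<^bsub>M\<^esub> u' a"]) auto
qed

lemma normal_scal:
  assumes "normal p"
  shows "normal (scal c p)"
proof -
  let ?s = "\<lambda>J x. \<Sum>a \<in> J. dl (x a) (cl n (wmon a))"
  obtain J x where J: "finite J" "J \<subseteq> A" "\<forall>a. x a \<in> carrier M" "p - ?s J x \<in> null"
    using assms(1) by (auto simp: normal_def)
  have "(\<Sum>a \<in> J. dl (c \<odot>\<^bsub>M\<^esub> x a) (cl n (wmon a)) - scal c (dl (x a) (cl n (wmon a)))) \<in> null"
    using J by (intro null_sum null_rules(3) word_N) auto
  then have 1: "?s J (\<lambda>a. c \<odot>\<^bsub>M\<^esub> x a) - scal c (?s J x) \<in> null" by (simp only: sum_subtractf scal_sum)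
  have "scal c (p - ?s J x) - (?s J (\<lambda>a. c \<odot>\<^bsub>M\<^esub> x a) - scal c (?s J x)) \<in> null"
    by (intro null.diff null.scal J(4) 1)
  then have "scal c p - ?s J (\<lambda>a. c \<odot>\<^bsub>M\<^esub> x a) \<in> null" by (simp only: scal_algebra) simp
  then show ?thesis unfolding normal_def using J(1-3) M_smult
    by (intro exI[of _ J] exI[of _ "\<lambda>a. c \<odot>\<^bsub>M\<^esub> x a"]) auto
qed

lemma normal_null: "p \<in> null \<Longrightarrow> normal p"
  unfolding normal_def using nonempty by (intro exI[of _ "{}"] exI[of _ "\<lambda>_. SOME x. x \<in> carrier M"]) (auto simp: some_in_eq)

lemma normal_dl: "x \<in> carrier M \<Longrightarrow> y \<in> carrier N \<Longrightarrow> normal (dl x y)"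
proof -
  assume x: "x \<in> carrier M" and "y \<in> carrier N"
  then obtain f where f: "y = cl n f" "f \<in> Sp n A" by auto
  have "f \<in> {f \<in> Sp n A. normal (dl x (cl n f))}"
  proof (rule Sp_minimal[OF f(2)])
    have z: "dl x (cl n 0) \<in> null"
      using null_rules(4)[OF x, of "cl n 0" 0] by (simp add: Sp_zero scal_algebra)
    show "wmon a \<in> {f \<in> Sp n A. normal (dl x (cl n f))}" if a: "a \<in> A" for a
      unfolding normal_def using a x by (auto intro!: Sp_word exI[of _ "{a}"] exI[of _ "\<lambda>_. x"] null.zero)
    show "queer_ideal n \<subseteq> {f \<in> Sp n A. normal (dl x (cl n f))}"
    proof
      fix g assume g: "g \<in> queer_ideal n"
      then have "cl n g = cl n 0" by (simp add: cl_eq_iff)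
      then show "g \<in> {f \<in> Sp n A. normal (dl x (cl n f))}" using g z normal_null by (simp add: Sp_ideal)
    qed
    show "fv.subspace {f \<in> Sp n A. normal (dl x (cl n f))}"
      unfolding fv.subspace_def
    proof (intro conjI ballI allI)
      show "0 \<in> {f \<in> Sp n A. normal (dl x (cl n f))}" using z normal_null by (simp add: Sp_zero)
      fix f g assume f: "f \<in> {f \<in> Sp n A. normal (dl x (cl n f))}"
      have "dl x (cl n (scal c f)) - scal c (dl x (cl n f)) \<in> null" for c
        using null_rules(4)[OF x, of "cl n f" c] f by (simp del: map_single)
      then show "scal c f \<in> {f \<in> Sp n A. normal (dl x (cl n f))}" for c
        using f normal_cong[OF normal_scal, of "dl x (cl n f)" "dl x (cl n (scal c f))" c]
        by (auto simp del: map_single intro: Sp_scal)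
      assume g: "g \<in> {f \<in> Sp n A. normal (dl x (cl n f))}"
      have "dl x (cl n (f + g)) - (dl x (cl n f) + dl x (cl n g)) \<in> null"
        using null_rules(2)[OF x, of "cl n f" "cl n g"] f g by (simp add: diff_diff_eq)
      then show "f + g \<in> {f \<in> Sp n A. normal (dl x (cl n f))}"
        using f g normal_cong[OF normal_add] by (auto intro: Sp_add)
    qed
  qed
  then show ?thesis using f by simp
qed

lemma normal_Fr: "p \<in> Fr \<Longrightarrow> normal p"
proof -
  assume p: "p \<in> Fr"
  have "normal (\<Sum>u \<in> U. scal (lookup p u) (Poly_Mapping.single u 1))" if "U \<subseteq> keys p" "finite U" for U
    using that(2,1)
  proof (induction U)
    case empty
    then show ?case using normal_null[OF null.zero] by simp
  next
    case (insert u U)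
    then have "u \<in> carrier M \<times> carrier N" using p by (auto simp: free_on_def)
    then have "normal (Poly_Mapping.single u 1)" using normal_dl by auto
    then show ?case using insert by (simp del: map_single) (intro normal_add normal_scal; simp)
  qed
  from this[of "keys p"] show ?thesis using poly_mapping_sum_single[of p] by simp
qed

end

section \<open>The triangular decomposition\<close>

lemma Sp_explicit:
  assumes "p \<in> Sp n A"
  shows "\<exists>J c. finite J \<and> J \<subseteq> A \<and> p - (\<Sum>a \<in> J. scal (c a) (wmon a)) \<in> queer_ideal n"
proof -
  have "p \<in> fv.span (wmon ` A \<union> queer_ideal n)" using assms by (simp add: Sp_def)
  then obtain q r where qr: "p = q + r" "q \<in> fv.span (wmon ` A)" "r \<in> fv.span (queer_ideal n)"
    unfolding fv.span_Un by blast
  have "fv.span (queer_ideal n) = queer_ideal n" using ideal_subspace by (rule fv.span_eq_iff[THEN iffD2])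
  with qr have q: "q \<in> fv.span (wmon ` A)" and r: "p - q \<in> queer_ideal n" by simp_all
  from q obtain T c where T: "finite T" "T \<subseteq> wmon ` A" "q = (\<Sum>v \<in> T. scal (c v) v)"
    unfolding fv.span_explicit by blast
  obtain J where J: "J \<subseteq> A" "finite J" "T = wmon ` J" using finite_subset_image[OF T(1,2)] by blast
  then have "q = (\<Sum>a \<in> J. scal (c (wmon a)) (wmon a))"
    using T(3) inj_on_subset[OF wmon_inj] by (simp add: sum.reindex)
  then have "p - (\<Sum>a \<in> J. scal (c (wmon a)) (wmon a)) \<in> queer_ideal n" using r by simp
  then show ?thesis using J by (intro exI[of _ J] exI[of _ "\<lambda>a. c (wmon a)"]) simp
qed

lemma indep_reindex:
  assumes "indep n A f" "inj_on t K" "t ` K \<subseteq> A"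
  shows "indep n K (\<lambda>k. f (t k))"
  unfolding indep_def
proof (intro allI impI ballI)
  fix J c k assume J: "finite J" "J \<subseteq> K" and z: "\<forall>h. annih n h \<longrightarrow> (\<Sum>a \<in> J. c a * h (f (t a))) = 0" and k: "k \<in> J"
  have "t ` J \<subseteq> A" using assms(3) J(2) by auto
  then have "(\<Sum>b \<in> {b \<in> J. t b = t k}. c b) = 0"
    using z by (intro indep_regroup[OF assms(1) J(1)]) simp_all
  moreover have "{b \<in> J. t b = t k} = {k}" using k J(2) inj_onD[OF assms(2)] by auto
  ultimately show "c k = 0" by simp
qed

definition sec :: "nat \<Rightarrow> queer_free set \<Rightarrow> queer_free" where
  "sec n u = (SOME f. f \<in> Fc n \<and> u = cl n f)"

lemma sec: "u \<in> carrier (Uq n) \<Longrightarrow> sec n u \<in> Fc n \<and> cl n (sec n u) = u"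
  using someI_ex[of "\<lambda>f. f \<in> Fc n \<and> u = cl n f"] by (auto simp: sec_def Uq_carrier)

lemma sec_closed: "f \<in> Fc n \<Longrightarrow> sec n (cl n f) \<in> Fc n"
  and sec_cl: "f \<in> Fc n \<Longrightarrow> sec n (cl n f) - f \<in> queer_ideal n"
  using sec[of "cl n f" n] by (auto simp: Uq_carrier simp flip: cl_eq_iff)

lemma sec_add:
  assumes "f \<in> Fc n" "g \<in> Fc n"
  shows "sec n (cl n (f + g)) - sec n (cl n f) - sec n (cl n g) \<in> queer_ideal n"
proof -
  have "(sec n (cl n (f + g)) - (f + g)) - (sec n (cl n f) - f) - (sec n (cl n g) - g) \<in> queer_ideal n"
    using assms by (intro ideal_diff sec_cl) simp_all
  then show ?thesis by (simp add: algebra_simps)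
qed

lemma sec_scal:
  assumes "f \<in> Fc n"
  shows "sec n (cl n (scal c f)) - scal c (sec n (cl n f)) \<in> queer_ideal n"
proof -
  have "(sec n (cl n (scal c f)) - scal c f) - scal c (sec n (cl n f) - f) \<in> queer_ideal n"
    using assms by (intro ideal_diff ideal_scal sec_cl) simp_all
  then show ?thesis by (simp add: scal_algebra)
qed

lemma ideal_mult_cong:
  assumes "a - a' \<in> queer_ideal n" "b - b' \<in> queer_ideal n" "a \<in> Fc n" "b' \<in> Fc n"
  shows "a * b - a' * b' \<in> queer_ideal n"
proof -
  have "a * (b - b') + (a - a') * b' \<in> queer_ideal n"
    using assms by (intro ideal_add ideal_mult_left ideal_mult_right)
  then show ?thesis by (simp add: algebra_simps)
qed

text \<open>\<open>combination\<close> yields injectivity and \<open>spanning\<close> surjectivity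
  of the lifted map. Vanishing of a coefficient is phrased as \<open>x a = 0 \<odot> x0\<close>,
  from which \<open>null_zero_left\<close> concludes that its pure tensor is null.\<close>

locale span_lift = span_tensor M n A + bilinear_lift M "(Uq n)\<lparr>carrier := cl n ` Sp n A\<rparr>" n Bf
  for M :: "(cq, 'a, 'm) module_scheme" and n A Bf +
  assumes combination: "\<And>J x a. finite J \<Longrightarrow> J \<subseteq> A \<Longrightarrow> (\<And>a. x a \<in> carrier M) \<Longrightarrow>
      (\<Sum>a \<in> J. Bf (x a, cl n (wmon a))) \<in> queer_ideal n \<Longrightarrow> a \<in> J \<Longrightarrow> \<exists>x0 \<in> carrier M. x a = 0 \<odot>\<^bsub>M\<^esub> x0"
    and spanning: "\<And>f. f \<in> Fc n \<Longrightarrow> \<exists>p \<in> Fr. f - lext Bf p \<in> queer_ideal n"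
begin

lemma lext_injective:
  assumes p: "p \<in> Fr" "lext Bf p \<in> queer_ideal n"
  shows "p \<in> null"
proof -
  obtain J x where J: "finite J" "J \<subseteq> A" "\<And>a. x a \<in> carrier M" "p - (\<Sum>a \<in> J. dl (x a) (cl n (wmon a))) \<in> null"
    using normal_Fr[OF p(1)] by (auto simp: normal_def)
  have "lext Bf p - lext Bf (p - (\<Sum>a \<in> J. dl (x a) (cl n (wmon a)))) \<in> queer_ideal n"
    using p(2) lext_null[OF J(4)] by (rule ideal_diff)
  then have "(\<Sum>a \<in> J. Bf (x a, cl n (wmon a))) \<in> queer_ideal n" by (simp add: lext_sum scal_algebra)
  then have "\<exists>x0 \<in> carrier M. x a = 0 \<odot>\<^bsub>M\<^esub> x0" if "a \<in> J" for a
    using combination[of J x a] J that by blast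
  then have "dl (x a) (cl n (wmon a)) \<in> null" if "a \<in> J" for a
    using that J(2) null_zero_left word_N by fastforce
  then have "(\<Sum>a \<in> J. dl (x a) (cl n (wmon a))) \<in> null" by (rule null_sum)
  from null.add[OF J(4) this] show ?thesis by simp
qed

lemma lift_bij: "bij_betw lift (carrier (tensor_product M N)) (carrier (Uq n))"
  unfolding bij_betw_def
proof
  show "inj_on lift (carrier (tensor_product M N))"
  proof (rule inj_onI)
    fix t t' assume t: "t \<in> carrier (tensor_product M N)" "t' \<in> carrier (tensor_product M N)" and e: "lift t = lift t'"
    then obtain p q where pq: "p \<in> Fr" "q \<in> Fr" "t = cs null p" "t' = cs null q" by (auto simp: tensor_carrier)
    then have "lext Bf (p - q) \<in> queer_ideal n" using e by (simp add: lift_cs cl_eq_iff)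
    then have "p - q \<in> null" using pq Fr.diff by (intro lext_injective) auto
    then show "t = t'" using pq by (simp add: null.cs_eq_iff)
  qed
  have "cl n f \<in> lift ` carrier (tensor_product M N)" if f: "f \<in> Fc n" for f
  proof -
    obtain p where p: "p \<in> Fr" "f - lext Bf p \<in> queer_ideal n" using spanning[OF f] by blast
    then have "cl n f = lift (cs null p)" by (simp add: lift_cs cl_eq_iff)
    then show ?thesis using p(1) by (auto simp: tensor_carrier)
  qed
  then show "lift ` carrier (tensor_product M N) = carrier (Uq n)"
    using lext_closed by (auto simp: tensor_carrier Uq_carrier lift_cs)
qed

lemma lift_iso: "lift \<in> module_iso cq_ring (tensor_product M N) (Uq n)"
  using lift_bij lift_hom by (auto simp: module_iso_def)

end

section \<open>Multiplication as an isomorphism from the triple tensor product\<close>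

locale pbw_bases =
  fixes n :: nat and B W :: "wd set"
  assumes B: "B \<subseteq> minus_words n" "indep n B (\<lambda>x. x)" and W: "W \<subseteq> plus_words n" "indep n W (\<lambda>w. w)"
    and B_span: "\<And>x. x \<in> minus_words n \<Longrightarrow> wmon x \<in> Sp n B"
    and W_span: "\<And>x. x \<in> plus_words n \<Longrightarrow> wmon x \<in> Sp n W"
begin

abbreviation "M1 \<equiv> (Uq n)\<lparr>carrier := cl n ` Sp n B\<rparr>"
abbreviation "M0 \<equiv> (Uq n)\<lparr>carrier := cl n ` Sp n (ywords n)\<rparr>"
abbreviation "M2 \<equiv> (Uq n)\<lparr>carrier := cl n ` Sp n W\<rparr>"

lemma gens: "B \<subseteq> {w. set w \<subseteq> queer_gens n}" "ywords n \<subseteq> {w. set w \<subseteq> queer_gens n}" "W \<subseteq> {w. set w \<subseteq> queer_gens n}"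
proof -
  show "B \<subseteq> {w. set w \<subseteq> queer_gens n}" "W \<subseteq> {w. set w \<subseteq> queer_gens n}"
    using B(1) W(1) by (auto simp: minus_words_def plus_words_def)
  show "ywords n \<subseteq> {w. set w \<subseteq> queer_gens n}"
    using ywords_lists let_words_gens(3) by (fastforce simp: lists_eq_set)
qed

lemma Sp_gens: "p \<in> Sp n B \<Longrightarrow> p \<in> Fc n" "p \<in> Sp n (ywords n) \<Longrightarrow> p \<in> Fc n" "p \<in> Sp n W \<Longrightarrow> p \<in> Fc n"
  using Sp_Fc gens by blast+

text \<open>The products of Cartan monomials and words of \<open>W\<close> are independent even with
  coefficients from the minus part on the left: each coefficient is expanded in \<open>B\<close>,
  and \<open>triangular_indep\<close> makes all scalars vanish.\<close>

lemma triangular_sum_zero: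
  assumes K: "finite K" "K \<subseteq> ywords n \<times> W" and f: "\<And>k. k \<in> K \<Longrightarrow> f k \<in> Sp n B"
    and z: "(\<Sum>k \<in> K. f k * wmon (fst k @ snd k)) \<in> queer_ideal n" and k: "k \<in> K"
  shows "f k \<in> queer_ideal n"
proof -
  let ?yw = "\<lambda>(S, g). yw n S g"
  let ?t = "\<lambda>((b, w), x :: wd). (x, inv_into (zero_index n) ?yw b, w :: wd)"
  have t: "indep n (SIGMA k : ywords n \<times> W. B) (\<lambda>a. (\<lambda>(x, (S, g), w). x @ yw n S g @ w) (?t a))"
  proof (rule indep_reindex[OF triangular_indep[OF B W]])
    show "inj_on ?t (SIGMA k : ywords n \<times> W. B)"
      by (rule inj_onI) (auto simp: ywords_def dest: inv_into_injective)
    show "?t ` (SIGMA k : ywords n \<times> W. B) \<subseteq> B \<times> zero_index n \<times> W"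
    proof -
      have "inv_into (zero_index n) ?yw b \<in> zero_index n" if "b \<in> ywords n" for b
        using that by (intro inv_into_into) (simp add: ywords_def)
      then show ?thesis by auto
    qed
  qed
  have "\<forall>k. \<exists>J c. k \<in> K \<longrightarrow> finite J \<and> J \<subseteq> B \<and> f k - (\<Sum>a \<in> J. scal (c a) (wmon a)) \<in> queer_ideal n"
    using Sp_explicit[OF f] by blast
  then obtain J c where Jc: "\<forall>k. k \<in> K \<longrightarrow> finite (J k) \<and> J k \<subseteq> B \<and> f k - (\<Sum>a \<in> J k. scal (c k a) (wmon a)) \<in> queer_ideal n"
    unfolding choice_iff by blast
  then have J: "finite (J k)" "J k \<subseteq> B" "f k - (\<Sum>a \<in> J k. scal (c k a) (wmon a)) \<in> queer_ideal n"
    if "k \<in> K" for k using that Jc by blast+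
  have g: "set (fst k @ snd k) \<subseteq> queer_gens n" if "k \<in> K" for k
    using K(2) that gens by fastforce
  have "(\<Sum>k \<in> K. (f k - (\<Sum>a \<in> J k. scal (c k a) (wmon a))) * wmon (fst k @ snd k)) \<in> queer_ideal n"
    using J(3) g by (intro ideal_sum ideal_mult_right) auto
  from ideal_diff[OF z this] have s0: "(\<Sum>k \<in> K. \<Sum>a \<in> J k. scal (c k a) (wmon (a @ fst k @ snd k))) \<in> queer_ideal n"
    by (simp add: left_diff_distrib sum_subtractf sum_distrib_right mult_scal_left mon_append)
  then have s: "(\<Sum>k \<in> K. \<Sum>a \<in> J k. c k a * h (a @ fst k @ snd k)) = 0" if "annih n h" for h
  proof -
    have "lin h (\<Sum>k \<in> K. \<Sum>a \<in> J k. scal (c k a) (wmon (a @ fst k @ snd k))) = 0"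
      using s0 that by (simp only: ideal_iff_annih)
    then show ?thesis by (simp only: lin_sum lin_simps)
  qed
  have "\<forall>a \<in> Sigma K J. (\<lambda>(k, a). c k a) a = 0"
  proof (rule t[unfolded indep_def, THEN spec[of _ "Sigma K J"], THEN spec[of _ "\<lambda>(k, a). c k a"], THEN mp, THEN mp, THEN mp]; (intro allI impI)?)
    show "finite (Sigma K J)" using K J by auto
    show "Sigma K J \<subseteq> (SIGMA k : ywords n \<times> W. B)" using K J(2) by fastforce
    fix h assume h: "annih n h"
    have "?yw (inv_into (zero_index n) ?yw b) = b" if "b \<in> ywords n" for b
      using that f_inv_into_f[of b ?yw "zero_index n"] by (simp add: ywords_def)
    then have "(\<lambda>(x, (S, g), w). x @ yw n S g @ w) (?t (k, a)) = a @ fst k @ snd k" if "k \<in> K" for k a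
      using that K(2) by (cases k; cases "inv_into (zero_index n) ?yw (fst k)") fastforce
    then have "(\<Sum>a \<in> Sigma K J. (\<lambda>(k, a). c k a) a * h ((\<lambda>(x, (S, g), w). x @ yw n S g @ w) (?t a)))
      = (\<Sum>(k, a) \<in> Sigma K J. c k a * h (a @ fst k @ snd k))"
      by (intro sum.cong) auto
    also have "\<dots> = 0" using s[OF h] K J(1) by (subst sum.Sigma[symmetric]) auto
    finally show "(\<Sum>a \<in> Sigma K J. (\<lambda>(k, a). c k a) a * h ((\<lambda>(x, (S, g), w). x @ yw n S g @ w) (?t a))) = 0" .
  qed
  then have "(\<Sum>a \<in> J k. scal (c k a) (wmon a)) = 0" using k by (intro sum.neutral) (auto simp: scal_algebra)
  then show ?thesis using J(3)[OF k] by simp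
qed

lemma tensor_Sp: "tensor ((Uq n)\<lparr>carrier := cl n ` Sp n A\<rparr>) ((Uq n)\<lparr>carrier := cl n ` Sp n A'\<rparr>)"
  by unfold_locales (auto intro: Sp_add Sp_scal)

sublocale T1: span_tensor M1 n "ywords n"
  unfolding span_tensor_def span_tensor_axioms_def using tensor_Sp[of B "ywords n"] by (auto intro: Sp_zero)

text \<open>
  Products of chosen representatives; they are bilinear only modulo the ideal.
\<close>

definition B1 :: "queer_free set \<times> queer_free set \<Rightarrow> queer_free" where
  "B1 = (\<lambda>(u, v). sec n u * sec n v)"

sublocale T1: bilinear_lift M1 M0 n B1
proof unfold_locales
  fix x y x' y' c assume x: "x \<in> carrier M1" "x' \<in> carrier M1" and y: "y \<in> carrier M0" "y' \<in> carrier M0"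
  obtain f f' where f: "x = cl n f" "x' = cl n f'" "f \<in> Fc n" "f' \<in> Fc n" using x Sp_gens by auto
  obtain g g' where g: "y = cl n g" "y' = cl n g'" "g \<in> Fc n" "g' \<in> Fc n" using y Sp_gens by auto
  note fg = sec_closed[OF f(3)] sec_closed[OF g(3)]
  show "B1 (x, y) \<in> Fc n" using fg by (simp add: B1_def f g)
  show "B1 (x \<oplus>\<^bsub>M1\<^esub> x', y) - B1 (x, y) - B1 (x', y) \<in> queer_ideal n"
    using ideal_mult_right[OF sec_add[OF f(3,4)] fg(2)] by (simp add: B1_def f g left_diff_distrib)
  show "B1 (x, y \<oplus>\<^bsub>M0\<^esub> y') - B1 (x, y) - B1 (x, y') \<in> queer_ideal n"
    using ideal_mult_left[OF sec_add[OF g(3,4)] fg(1)] by (simp add: B1_def f g right_diff_distrib)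
  show "B1 (c \<odot>\<^bsub>M1\<^esub> x, y) - scal c (B1 (x, y)) \<in> queer_ideal n"
    using ideal_mult_right[OF sec_scal[OF f(3)] fg(2)] by (simp add: B1_def f g left_diff_distrib mult_scal_left)
  show "B1 (x, c \<odot>\<^bsub>M0\<^esub> y) - scal c (B1 (x, y)) \<in> queer_ideal n"
    using ideal_mult_left[OF sec_scal[OF g(3)] fg(1)] by (simp add: B1_def f g right_diff_distrib mult_scal_right)
qed

abbreviation "T \<equiv> tensor_product M1 M0"

sublocale T2: span_tensor T n W
proof unfold_locales
  show "x \<oplus>\<^bsub>T\<^esub> x' \<in> carrier T" if "x \<in> carrier T" "x' \<in> carrier T" for x x'
    using that unfolding T1.tensor_carrier by (auto simp only: T1.tensor_add intro!: imageI T1.Fr.add)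
  show "c \<odot>\<^bsub>T\<^esub> x \<in> carrier T" if "x \<in> carrier T" for c x
    using that unfolding T1.tensor_carrier by (auto simp only: T1.tensor_smult intro!: imageI T1.Fr.scal)
  show "carrier T \<noteq> {}" using T1.Fr.zero by (auto simp: T1.tensor_carrier)
qed (auto intro: Sp_add Sp_scal)

text \<open>The first component is itself a tensor; \<open>lext B1 (T1.rep t)\<close> represents its
  image under multiplication, kept in the free algebra so that it can be multiplied once
  more.\<close>

definition B2 :: "(queer_free set \<times> queer_free set \<Rightarrow>\<^sub>0 cq) set \<times> queer_free set \<Rightarrow> queer_free" where
  "B2 = (\<lambda>(t, w). lext B1 (T1.rep t) * sec n w)"

sublocale T2: bilinear_lift T M2 n B2
proof unfold_locales
  fix x y x' y' c assume x: "x \<in> carrier T" "x' \<in> carrier T" and y: "y \<in> carrier M2" "y' \<in> carrier M2"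
  obtain f f' where f: "x = cs T1.null f" "x' = cs T1.null f'" "f \<in> T1.Fr" "f' \<in> T1.Fr"
    using x by (auto simp: T1.tensor_carrier)
  obtain g g' where g: "y = cl n g" "y' = cl n g'" "g \<in> Fc n" "g' \<in> Fc n" using y Sp_gens by auto
  let ?r = "\<lambda>p. lext B1 (T1.rep (cs T1.null p))"
  have r: "?r p \<in> Fc n" if "p \<in> T1.Fr" for p
    using that T1.rep by (auto simp: T1.tensor_carrier intro: T1.lext_closed)
  note fg = r[OF f(3)] sec_closed[OF g(3)]
  have "(?r (f + f') - lext B1 (f + f')) - (?r f - lext B1 f) - (?r f' - lext B1 f') \<in> queer_ideal n"
    using f by (intro ideal_diff T1.lext_rep T1.Fr.add)
  then have a: "?r (f + f') - ?r f - ?r f' \<in> queer_ideal n" by (simp add: algebra_simps)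
  have "(?r (scal c f) - lext B1 (scal c f)) - scal c (?r f - lext B1 f) \<in> queer_ideal n"
    using f by (intro ideal_diff ideal_scal T1.lext_rep T1.Fr.scal)
  then have s: "?r (scal c f) - scal c (?r f) \<in> queer_ideal n" by (simp add: scal_algebra)
  show "B2 (x, y) \<in> Fc n" using fg by (simp add: B2_def f g)
  show "B2 (x \<oplus>\<^bsub>T\<^esub> x', y) - B2 (x, y) - B2 (x', y) \<in> queer_ideal n"
    using ideal_mult_right[OF a fg(2)] by (simp add: B2_def f g T1.tensor_add left_diff_distrib)
  show "B2 (x, y \<oplus>\<^bsub>M2\<^esub> y') - B2 (x, y) - B2 (x, y') \<in> queer_ideal n"
    using ideal_mult_left[OF sec_add[OF g(3,4)] fg(1)] by (simp add: B2_def f g right_diff_distrib)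
  show "B2 (c \<odot>\<^bsub>T\<^esub> x, y) - scal c (B2 (x, y)) \<in> queer_ideal n"
    using ideal_mult_right[OF s fg(2)] by (simp add: B2_def f g T1.tensor_smult left_diff_distrib mult_scal_left)
  show "B2 (x, c \<odot>\<^bsub>M2\<^esub> y) - scal c (B2 (x, y)) \<in> queer_ideal n"
    using ideal_mult_left[OF sec_scal[OF g(3)] fg(1)] by (simp add: B2_def f g right_diff_distrib mult_scal_right)
qed

lemma B2_pure:
  assumes "f \<in> Sp n B" "g \<in> Sp n (ywords n)" "h \<in> Sp n W"
  shows "B2 (cs T1.null (T1.dl (cl n f) (cl n g)), cl n h) - f * g * h \<in> queer_ideal n"
proof -
  let ?d = "T1.dl (cl n f) (cl n g)"
  have d: "?d \<in> T1.Fr" using assms by (intro T1.dl_Fr) auto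
  have fgh: "f \<in> Fc n" "g \<in> Fc n" "h \<in> Fc n" using assms Sp_gens by auto
  have c: "cs T1.null ?d \<in> carrier T" using d by (auto simp: T1.tensor_carrier)
  have "lext B1 (T1.rep (cs T1.null ?d)) - lext B1 ?d \<in> queer_ideal n" using d by (rule T1.lext_rep)
  moreover have "lext B1 ?d - f * g \<in> queer_ideal n"
    using fgh by (auto simp: B1_def scal_algebra intro!: ideal_mult_cong sec_cl sec_closed)
  ultimately have "lext B1 (T1.rep (cs T1.null ?d)) - f * g \<in> queer_ideal n"
    using ideal_add by fastforce
  then show ?thesis
    using fgh T1.rep[OF c] by (auto simp: B2_def intro!: ideal_mult_cong sec_cl T1.lext_closed)
qed

lemma sec_Sp: "u \<in> carrier M1 \<Longrightarrow> sec n u \<in> Sp n B \<and> u = cl n (sec n u)"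
proof -
  assume "u \<in> carrier M1"
  then obtain f where f: "u = cl n f" "f \<in> Sp n B" by auto
  then have s: "sec n u - f \<in> queer_ideal n" using sec_cl Sp_gens by auto
  have "(sec n u - f) + f \<in> Sp n B" by (rule Sp_add[OF Sp_ideal[OF s] f(2)])
  then show ?thesis using s f by (simp flip: cl_eq_iff)
qed

text \<open>Each \<open>x w\<close> is brought into normal form over the Cartan words. The sum then
  runs over distinct pairs of a Cartan word and a word of \<open>W\<close>, and
  \<open>triangular_sum_zero\<close> annihilates every coefficient.\<close>

lemma B2_combination:
  assumes J: "finite J" "J \<subseteq> W" and x: "\<And>w. x w \<in> carrier T"
    and z: "(\<Sum>w \<in> J. B2 (x w, cl n (wmon w))) \<in> queer_ideal n" and w: "w \<in> J"
  shows "\<exists>x0 \<in> carrier T. x w = 0 \<odot>\<^bsub>T\<^esub> x0"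
proof -
  have "\<forall>w. \<exists>L u. finite L \<and> L \<subseteq> ywords n \<and> (\<forall>b. u b \<in> carrier M1) \<and>
      T1.rep (x w) - (\<Sum>b \<in> L. T1.dl (u b) (cl n (wmon b))) \<in> T1.null"
    using T1.rep[OF x] T1.normal_Fr unfolding T1.normal_def by blast
  then obtain L u where Lu: "\<forall>w. finite (L w) \<and> L w \<subseteq> ywords n \<and> (\<forall>b. u w b \<in> carrier M1) \<and>
      T1.rep (x w) - (\<Sum>b \<in> L w. T1.dl (u w b) (cl n (wmon b))) \<in> T1.null"
    unfolding choice_iff by blast
  have L: "\<And>w. finite (L w)" "\<And>w. L w \<subseteq> ywords n" "\<And>w b. u w b \<in> carrier M1"
    "\<And>w. T1.rep (x w) - (\<Sum>b \<in> L w. T1.dl (u w b) (cl n (wmon b))) \<in> T1.null"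
    using Lu by blast+
  note u = sec_Sp[OF L(3)]
  have uF: "sec n (u w b) \<in> Fc n" for w b using u Sp_gens by blast
  have g: "wmon w \<in> Fc n" if "w \<in> W" for w using that gens by auto
  have gy: "wmon b \<in> Fc n" if "b \<in> ywords n" for b using that gens by auto
  have e: "B2 (x w, cl n (wmon w)) - (\<Sum>b \<in> L w. sec n (u w b) * wmon (b @ w)) \<in> queer_ideal n" if w: "w \<in> W" for w
  proof -
    let ?s = "\<Sum>b \<in> L w. sec n (u w b) * wmon b"
    have "lext B1 (T1.rep (x w) - (\<Sum>b \<in> L w. T1.dl (u w b) (cl n (wmon b)))) \<in> queer_ideal n"
      by (rule T1.lext_null[OF L(4)])
    then have 1: "lext B1 (T1.rep (x w)) - (\<Sum>b \<in> L w. sec n (u w b) * sec n (cl n (wmon b))) \<in> queer_ideal n"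
      by (simp add: lext_sum scal_algebra B1_def)
    have "(\<Sum>b \<in> L w. sec n (u w b) * sec n (cl n (wmon b)) - sec n (u w b) * wmon b) \<in> queer_ideal n"
    proof (rule ideal_sum)
      fix b assume b: "b \<in> L w"
      then have "wmon b \<in> Fc n" using gy L(2) by blast
      then show "sec n (u w b) * sec n (cl n (wmon b)) - sec n (u w b) * wmon b \<in> queer_ideal n"
        by (intro ideal_mult_cong sec_cl uF) (simp_all add: qi.zero)
    qed
    from ideal_add[OF 1 this] have "lext B1 (T1.rep (x w)) - ?s \<in> queer_ideal n" by (simp add: sum_subtractf)
    then have "lext B1 (T1.rep (x w)) * sec n (cl n (wmon w)) - ?s * wmon w \<in> queer_ideal n"
      using T1.rep[OF x[of w]] g[OF w] by (intro ideal_mult_cong sec_cl T1.lext_closed) auto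
    then show ?thesis by (simp add: B2_def sum_distrib_right mon_append mult.assoc)
  qed
  define K where "K = (\<lambda>(w, b). (b, w)) ` Sigma J L"
  have "(\<Sum>w \<in> J. B2 (x w, cl n (wmon w))) - (\<Sum>w \<in> J. B2 (x w, cl n (wmon w)) - (\<Sum>b \<in> L w. sec n (u w b) * wmon (b @ w))) \<in> queer_ideal n"
    using J(2) by (intro ideal_diff[OF z] ideal_sum e) auto
  then have "(\<Sum>w \<in> J. \<Sum>b \<in> L w. sec n (u w b) * wmon (b @ w)) \<in> queer_ideal n" by (simp add: sum_subtractf)
  moreover have "(\<Sum>w \<in> J. \<Sum>b \<in> L w. sec n (u w b) * wmon (b @ w)) =
      (\<Sum>k \<in> K. sec n (u (snd k) (fst k)) * wmon (fst k @ snd k))"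
    unfolding K_def using J(1) L(1) by (subst sum.reindex) (auto simp: inj_on_def sum.Sigma intro!: sum.cong)
  ultimately have kz: "(\<Sum>k \<in> K. sec n (u (snd k) (fst k)) * wmon (fst k @ snd k)) \<in> queer_ideal n" by simp
  have K: "finite K" "K \<subseteq> ywords n \<times> W" using J L(1,2) by (auto simp: K_def)
  have "u w b = 0 \<odot>\<^bsub>M1\<^esub> cl n 0" if "b \<in> L w" for b
  proof -
    have "(b, w) \<in> K" using that w by (auto simp: K_def)
    then have "sec n (u w b) \<in> queer_ideal n"
      using triangular_sum_zero[of K "\<lambda>k. sec n (u (snd k) (fst k))", OF K _ kz] u by fastforce
    then have "cl n (sec n (u w b)) = cl n 0" by (simp add: cl_eq_iff)
    then show ?thesis using u[of w b] by (simp add: scal_algebra)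
  qed
  then have "T1.dl (u w b) (cl n (wmon b)) \<in> T1.null" if "b \<in> L w" for b
  proof -
    have "cl n (wmon b) \<in> carrier M0" using that L(2) by (intro T1.word_N) blast
    then show ?thesis using that T1.null_zero_left[of "cl n 0"] \<open>\<And>b. b \<in> L w \<Longrightarrow> u w b = _\<close> by (simp add: Sp_zero)
  qed
  then have "(\<Sum>b \<in> L w. T1.dl (u w b) (cl n (wmon b))) \<in> T1.null" by (rule T1.null_sum)
  from T1.null.add[OF L(4)[of w] this] have "T1.rep (x w) - 0 \<in> T1.null" by simp
  then have "x w = cs T1.null 0" using T1.rep[OF x[of w]] T1.null.cs_eq_iff by metis
  then have "x w = 0 \<odot>\<^bsub>T\<^esub> cs T1.null 0" by (simp add: T1.tensor_smult scal_algebra)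
  then show ?thesis using T1.Fr.zero by (auto simp: T1.tensor_carrier)
qed

lemma B2_spanning:
  assumes "f \<in> Fc n"
  shows "\<exists>p \<in> T2.Fr. f - lext B2 p \<in> queer_ideal n"
proof -
  have "f \<in> {f. \<exists>p \<in> T2.Fr. f - lext B2 p \<in> queer_ideal n}"
  proof (rule Sp_minimal[OF triangular_span[OF assms]])
    fix a assume "a \<in> pbw_words n"
    then obtain x y w where a: "a = x @ y @ w" "x \<in> minus_words n" "y \<in> ywords n" "w \<in> plus_words n"
      by (auto simp: pbw_words_def)
    let ?t = "cs T1.null (T1.dl (cl n (wmon x)) (cl n (wmon y)))"
    have m: "wmon x \<in> Sp n B" "wmon y \<in> Sp n (ywords n)" "wmon w \<in> Sp n W"
      using a B_span W_span Sp_word by blast+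
    have t: "?t \<in> carrier T" unfolding T1.tensor_carrier using m by (intro imageI T1.dl_Fr) auto
    then have "T2.dl ?t (cl n (wmon w)) \<in> T2.Fr" using m by (intro T2.dl_Fr) auto
    moreover have "wmon a - lext B2 (T2.dl ?t (cl n (wmon w))) \<in> queer_ideal n"
      using ideal_uminus[OF B2_pure[OF m]] by (simp add: a scal_algebra mon_append mult.assoc)
    ultimately show "wmon a \<in> {f. \<exists>p \<in> T2.Fr. f - lext B2 p \<in> queer_ideal n}" by blast
  next
    show "queer_ideal n \<subseteq> {f. \<exists>p \<in> T2.Fr. f - lext B2 p \<in> queer_ideal n}"
      using T2.Fr.zero by (auto intro!: bexI[of _ 0])
    show "fv.subspace {f. \<exists>p \<in> T2.Fr. f - lext B2 p \<in> queer_ideal n}"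
      unfolding fv.subspace_def
    proof (intro conjI ballI allI)
      show "0 \<in> {f. \<exists>p \<in> T2.Fr. f - lext B2 p \<in> queer_ideal n}"
        using T2.Fr.zero by (auto intro!: bexI[of _ 0] simp: qi.zero)
      fix f c assume "f \<in> {f. \<exists>p \<in> T2.Fr. f - lext B2 p \<in> queer_ideal n}"
      then obtain p where p: "p \<in> T2.Fr" "f - lext B2 p \<in> queer_ideal n" by blast
      have "scal c f - lext B2 (scal c p) \<in> queer_ideal n"
        using ideal_scal[OF p(2), of c] by (simp add: scal_algebra)
      then show "scal c f \<in> {f. \<exists>p \<in> T2.Fr. f - lext B2 p \<in> queer_ideal n}"
        using p(1) T2.Fr.scal by blast
      fix g assume "g \<in> {f. \<exists>p \<in> T2.Fr. f - lext B2 p \<in> queer_ideal n}"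
      then obtain q where q: "q \<in> T2.Fr" "g - lext B2 q \<in> queer_ideal n" by blast
      have "(f + g) - lext B2 (p + q) \<in> queer_ideal n"
        using ideal_add[OF p(2) q(2)] by (simp add: algebra_simps)
      then show "f + g \<in> {f. \<exists>p \<in> T2.Fr. f - lext B2 p \<in> queer_ideal n}"
        using p(1) q(1) T2.Fr.add by blast
    qed
  qed
  then show ?thesis by simp
qed

sublocale T2: span_lift T n W B2
proof unfold_locales
  show "\<exists>x0 \<in> carrier T. x a = 0 \<odot>\<^bsub>T\<^esub> x0"
    if "finite J" "J \<subseteq> W" "\<And>a. x a \<in> carrier T" "(\<Sum>a \<in> J. B2 (x a, cl n (wmon a))) \<in> queer_ideal n" "a \<in> J"
    for J x a
    using that by (rule B2_combination)
  show "\<exists>p \<in> T2.Fr. f - lext B2 p \<in> queer_ideal n" if "f \<in> Fc n" for f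
    using that by (rule B2_spanning)
qed

lemma lift_pure:
  assumes "u \<in> carrier M1" "v \<in> carrier M0" "w \<in> carrier M2"
  shows "T2.lift (pure_tensor T M2 (pure_tensor M1 M0 u v) w) = u \<otimes>\<^bsub>Uq n\<^esub> v \<otimes>\<^bsub>Uq n\<^esub> w"
proof -
  obtain f g h where uvw: "u = cl n f" "v = cl n g" "w = cl n h"
    and m: "f \<in> Sp n B" "g \<in> Sp n (ywords n)" "h \<in> Sp n W" using assms by auto
  have "cs T1.null (T1.dl u v) \<in> carrier T" unfolding T1.tensor_carrier using assms by (intro imageI T1.dl_Fr)
  then have "T2.dl (cs T1.null (T1.dl u v)) w \<in> T2.Fr" using assms by (intro T2.dl_Fr)
  then have "T2.lift (pure_tensor T M2 (pure_tensor M1 M0 u v) w) = cl n (B2 (cs T1.null (T1.dl u v), w))"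
    by (simp add: T1.pure_tensor_cs T2.pure_tensor_cs T2.lift_cs scal_algebra)
  also have "\<dots> = cl n (f * g * h)" using B2_pure[OF m] by (simp add: uvw cl_eq_iff)
  finally show ?thesis using m Sp_gens by (simp add: uvw Uq_mult)
qed

end

lemma Sp_eq_of_spanning: "B \<subseteq> A \<Longrightarrow> \<forall>a \<in> A. wmon a \<in> Sp n B \<Longrightarrow> Sp n A = Sp n B"
  using Sp_mono[of _ n B A] Sp_trans[of _ n A B] by auto

theorem theorem2p3:
  fixes n :: nat
  assumes "n > 0"
  shows "\<exists>\<mu> \<in> module_iso cq_ring
      (tensor_product (tensor_product (Uq_minus_mod n) (Uq_zero_mod n)) (Uq_plus_mod n)) (Uq n).
    \<forall>u \<in> Uq_minus n. \<forall>v \<in> Uq_zero n. \<forall>w \<in> Uq_plus n.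
      \<mu> (pure_tensor (tensor_product (Uq_minus_mod n) (Uq_zero_mod n)) (Uq_plus_mod n)
          (pure_tensor (Uq_minus_mod n) (Uq_zero_mod n) u v) w)
      = u \<otimes>\<^bsub>Uq n\<^esub> v \<otimes>\<^bsub>Uq n\<^esub> w"
proof -
  obtain B where minus: "B \<subseteq> minus_words n" "indep n B (\<lambda>x. x)" "\<forall>a \<in> minus_words n. wmon a \<in> Sp n B"
    using basis_mod_ideal by blast
  obtain W where plus: "W \<subseteq> plus_words n" "indep n W (\<lambda>x. x)" "\<forall>a \<in> plus_words n. wmon a \<in> Sp n W"
    using basis_mod_ideal by blast
  interpret pbw_bases n B W
    by unfold_locales (rule minus plus | rule bspec[OF minus(3)] bspec[OF plus(3)], assumption)+
  \<comment> \<open>A basis spans the same subspace as all the words, so the three subalgebras are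
    exactly the carriers used in \<open>pbw_bases\<close>.\<close>
  have c: "Uq_minus n = cl n ` Sp n B" "Uq_zero n = cl n ` Sp n (ywords n)" "Uq_plus n = cl n ` Sp n W"
    by (simp_all only: Uq_minus_words Uq_zero_words Uq_plus_words
        Sp_eq_of_spanning[OF minus(1,3)] Sp_eq_of_spanning[OF plus(1,3)])
  show ?thesis
    unfolding c by (rule bexI[OF _ T2.lift_iso]) (intro ballI lift_pure; simp)
qed

end
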